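(* Let $V$ be an $\mathrm{FI}_G$-module over a commutative ring $k$ which is generated in finite degree. The following are equivalent: (1) $V$ is $\sharp$-filtered; (2) there is a sequence of surjections $V=Q^{(n)}\twoheadrightarrow Q^{(n-1)}\twoheadrightarrow\cdots\twoheadrightarrow Q^{(0)}=0$ whose successive kernels are relatively projective; (3) $V$ is homology acyclic; (4) $H_1(V)=0$; (5) $V$ admits a finite resolution $0\to P_s\to\cdots\to P_0\to V\to 0$ by homology acyclic $\mathrm{FI}_G$-modules $P_j$ which are generated in finite degree. If in addition $V$ is presented in finite degree, then each of these is also equivalent to: (6) $H_i(V)=0$ for some $i>0$.
   Context: Fix a commutative ring $k$ and a group $G$. $\mathrm{FI}_G$ is the category with objects $[n]=\{1,\dots,n\}$ ($n\ge 0$) and morphisms $[n]\to[m]$ the pairs $(f,g)$ with $f:[n]\to[m]$ injective and $g:[n]\to G$ a map of sets; composition is $(f,g)\circ(f',g')=(f\circ f',h)$ with $h(x)=g'(x)\,g(f'(x))$. Write $G_n=\mathfrak S_n\wr G=\mathrm{Aut}_{\mathrm{FI}_G}([n])$. An $\mathrm{FI}_G$-module is a functor $V:\mathrm{FI}_G\to\mathrm{Mod}_k$, $V_n:=V([n])$; these form an abelian category with pointwise kernels and cokernels. An $\mathrm{FB}_G$-module is a sequence $(W_n)_{n\ge0}$ with $W_n$ a $k[G_n]$-module. For a $k[G_n]$-module $W$, $M(W)$ is the $\mathrm{FI}_G$-module with $M(W)_m=W\otimes_{k[G_n]}k[\mathrm{Hom}_{\mathrm{FI}_G}([n],[m])]$,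 morphisms acting by postcomposition on the second factor; for an $\mathrm{FB}_G$-module $W$, $M(W)=\bigoplus_n M(W_n)$; $M(n):=M(k[G_n])$. Modules of the form $M(W)$ are called relatively projective. $V$ is $\sharp$-filtered if it has a finite filtration $0=V^{(0)}\subseteq\cdots\subseteq V^{(n)}=V$ with every $V^{(j)}/V^{(j-1)}$ relatively projective. $H_0(V)_n=V_n/V_{<n}$, where $V_{<n}$ is the span of images of all $V(f,g)$ with $(f,g):[m]\to[n]$, $m<n$; $H_i$ are the left derived functors of $H_0$. $V$ is homology acyclic if $H_i(V)=0$ for all $i\ge1$. $V$ is generated in degree $\le m$ if there is a surjection $\bigoplus_i M(n_i)\to V$ with all $n_i\le m$; generated in finite degree if this holds for some $m$. $V$ is related in degree $\le r$ if there is an exact sequence $0\to K\to M\to V\to 0$ with $M$ relatively projective and $K$ generated in degree $\le r$; $V$ is presented in finite degree if it is generated and related in finite degree. *)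

theory Defs
  imports Main
begin

text \<open>A morphism [n] -> [m] is a pair (f,g) with f injective {1..n} -> {1..m} and
 g : {1..n} -> G; both components are normalised to 0 outside {1..n}.
 The group G is a type of class group_add (group operation written +, not assumed commutative).\<close>

type_synonym 'g fiarr = "(nat \<Rightarrow> nat) \<times> (nat \<Rightarrow> 'g)"

definition Hom :: "nat \<Rightarrow> nat \<Rightarrow> ('g::group_add) fiarr set" where
  "Hom n m = {(f, g). inj_on f {1..n} \<and> f ` {1..n} \<subseteq> {1..m} \<and>
                      (\<forall>x. x \<notin> {1..n} \<longrightarrow> f x = 0 \<and> g x = 0)}"

definition comp :: "('g::group_add) fiarr \<Rightarrow> 'g fiarr \<Rightarrow> 'g fiarr" where
  "comp phi psi = (fst phi \<circ> fst psi, \<lambda>x. snd psi x + snd phi (fst psi x))"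

definition idm :: "nat \<Rightarrow> ('g::group_add) fiarr" where
  "idm n = (\<lambda>x. if x \<in> {1..n} then x else 0, \<lambda>x. 0)"

record ('k, 'a) kmod =
  carr :: "'a set"
  zer :: 'a
  pls :: "'a \<Rightarrow> 'a \<Rightarrow> 'a"
  sml :: "'k \<Rightarrow> 'a \<Rightarrow> 'a"

definition is_kmod :: "('k::comm_ring_1, 'a) kmod \<Rightarrow> bool" where
  "is_kmod M \<longleftrightarrow> zer M \<in> carr M
    \<and> (\<forall>x\<in>carr M. \<forall>y\<in>carr M. pls M x y \<in> carr M)
    \<and> (\<forall>a. \<forall>x\<in>carr M. sml M a x \<in> carr M)
    \<and> (\<forall>x\<in>carr M. \<forall>y\<in>carr M. \<forall>z\<in>carr M. pls M (pls M x y) z = pls M x (pls M y z))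
    \<and> (\<forall>x\<in>carr M. \<forall>y\<in>carr M. pls M x y = pls M y x)
    \<and> (\<forall>x\<in>carr M. pls M (zer M) x = x)
    \<and> (\<forall>x\<in>carr M. pls M x (sml M (-1) x) = zer M)
    \<and> (\<forall>a b. \<forall>x\<in>carr M. sml M (a + b) x = pls M (sml M a x) (sml M b x))
    \<and> (\<forall>a. \<forall>x\<in>carr M. \<forall>y\<in>carr M. sml M a (pls M x y) = pls M (sml M a x) (sml M a y))
    \<and> (\<forall>a b. \<forall>x\<in>carr M. sml M (a * b) x = sml M a (sml M b x))
    \<and> (\<forall>x\<in>carr M. sml M 1 x = x)"

definition lin :: "('k, 'a) kmod \<Rightarrow> ('k, 'b) kmod \<Rightarrow> ('a \<Rightarrow> 'b) \<Rightarrow> bool" where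
  "lin M N f \<longleftrightarrow> f ` carr M \<subseteq> carr N
    \<and> (\<forall>x\<in>carr M. \<forall>y\<in>carr M. f (pls M x y) = pls N (f x) (f y))
    \<and> (\<forall>a. \<forall>x\<in>carr M. f (sml M a x) = sml N a (f x))"

definition ksub :: "('k, 'a) kmod \<Rightarrow> 'a set \<Rightarrow> bool" where
  "ksub M T \<longleftrightarrow> T \<subseteq> carr M \<and> zer M \<in> T
    \<and> (\<forall>x\<in>T. \<forall>y\<in>T. pls M x y \<in> T) \<and> (\<forall>a. \<forall>x\<in>T. sml M a x \<in> T)"

definition kspan :: "('k, 'a) kmod \<Rightarrow> 'a set \<Rightarrow> 'a set" where
  "kspan M X = \<Inter>{T. ksub M T \<and> X \<subseteq> T}"

definition kcoset :: "('k, 'a) kmod \<Rightarrow> 'a set \<Rightarrow> 'a \<Rightarrow> 'a set" where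
  "kcoset M S x = {pls M x s | s. s \<in> S}"

definition kquot :: "('k, 'a) kmod \<Rightarrow> 'a set \<Rightarrow> ('k, 'a set) kmod" where
  "kquot M S = \<lparr> carr = kcoset M S ` carr M,
                 zer = kcoset M S (zer M),
                 pls = (\<lambda>C D. kcoset M S (pls M (SOME x. x \<in> C) (SOME y. y \<in> D))),
                 sml = (\<lambda>a C. kcoset M S (sml M a (SOME x. x \<in> C))) \<rparr>"

definition freek :: "'x set \<Rightarrow> ('k::comm_ring_1, 'x \<Rightarrow> 'k) kmod" where
  "freek X = \<lparr> carr = {c. finite {p. c p \<noteq> 0} \<and> {p. c p \<noteq> 0} \<subseteq> X},
               zer = (\<lambda>_. 0),
               pls = (\<lambda>c c' p. c p + c' p),
               sml = (\<lambda>a c p. a * c p) \<rparr>"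

record ('k, 'g, 'a) fimod =
  deg :: "nat \<Rightarrow> ('k, 'a) kmod"
  fac :: "nat \<Rightarrow> nat \<Rightarrow> 'g fiarr \<Rightarrow> 'a \<Rightarrow> 'a"

definition is_fimod :: "('k::comm_ring_1, 'g::group_add, 'a) fimod \<Rightarrow> bool" where
  "is_fimod V \<longleftrightarrow> (\<forall>n. is_kmod (deg V n))
    \<and> (\<forall>n m. \<forall>phi\<in>Hom n m. lin (deg V n) (deg V m) (fac V n m phi))
    \<and> (\<forall>n. \<forall>x\<in>carr (deg V n). fac V n n (idm n) x = x)
    \<and> (\<forall>n m l. \<forall>phi\<in>Hom n m. \<forall>psi\<in>Hom m l. \<forall>x\<in>carr (deg V n).
          fac V m l psi (fac V n m phi x) = fac V n l (comp psi phi) x)"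

definition fhom :: "('k, 'g::group_add, 'a) fimod \<Rightarrow> ('k, 'g, 'b) fimod \<Rightarrow> (nat \<Rightarrow> 'a \<Rightarrow> 'b) \<Rightarrow> bool" where
  "fhom A B h \<longleftrightarrow> (\<forall>n. lin (deg A n) (deg B n) (h n))
    \<and> (\<forall>n m. \<forall>phi\<in>Hom n m. \<forall>x\<in>carr (deg A n). h m (fac A n m phi x) = fac B n m phi (h n x))"

definition fsurj :: "('k, 'g, 'a) fimod \<Rightarrow> ('k, 'g, 'b) fimod \<Rightarrow> (nat \<Rightarrow> 'a \<Rightarrow> 'b) \<Rightarrow> bool" where
  "fsurj A B h \<longleftrightarrow> (\<forall>n. h n ` carr (deg A n) = carr (deg B n))"

definition fiso :: "('k, 'g::group_add, 'a) fimod \<Rightarrow> ('k, 'g, 'b) fimod \<Rightarrow> (nat \<Rightarrow> 'a \<Rightarrow> 'b) \<Rightarrow> bool" where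
  "fiso A B h \<longleftrightarrow> fhom A B h \<and> (\<forall>n. bij_betw (h n) (carr (deg A n)) (carr (deg B n)))"

definition fker :: "('k, 'g, 'a) fimod \<Rightarrow> ('k, 'g, 'b) fimod \<Rightarrow> (nat \<Rightarrow> 'a \<Rightarrow> 'b) \<Rightarrow> nat \<Rightarrow> 'a set" where
  "fker A B h n = {x \<in> carr (deg A n). h n x = zer (deg B n)}"

definition fimg :: "('k, 'g, 'a) fimod \<Rightarrow> (nat \<Rightarrow> 'a \<Rightarrow> 'b) \<Rightarrow> nat \<Rightarrow> 'b set" where
  "fimg A h n = h n ` carr (deg A n)"

definition fzero :: "('k, 'g, 'a) fimod \<Rightarrow> bool" where
  "fzero A \<longleftrightarrow> (\<forall>n. carr (deg A n) = {zer (deg A n)})"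

definition sub_fimod :: "('k, 'g::group_add, 'a) fimod \<Rightarrow> (nat \<Rightarrow> 'a set) \<Rightarrow> bool" where
  "sub_fimod V S \<longleftrightarrow> (\<forall>n. ksub (deg V n) (S n))
    \<and> (\<forall>n m. \<forall>phi\<in>Hom n m. fac V n m phi ` S n \<subseteq> S m)"

definition frestrict :: "('k, 'g, 'a) fimod \<Rightarrow> (nat \<Rightarrow> 'a set) \<Rightarrow> ('k, 'g, 'a) fimod" where
  "frestrict V S = V\<lparr> deg := (\<lambda>n. (deg V n)\<lparr> carr := S n \<rparr>) \<rparr>"

definition fquot :: "('k, 'g, 'a) fimod \<Rightarrow> (nat \<Rightarrow> 'a set) \<Rightarrow> ('k, 'g, 'a set) fimod" where
  "fquot V S = \<lparr> deg = (\<lambda>n. kquot (deg V n) (S n)),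
                 fac = (\<lambda>n m phi C. kcoset (deg V m) (S m) (fac V n m phi (SOME x. x \<in> C))) \<rparr>"

definition push :: "('g::group_add) fiarr \<Rightarrow> ('x \<times> 'g fiarr \<Rightarrow> 'k::comm_ring_1) \<Rightarrow> ('x \<times> 'g fiarr \<Rightarrow> 'k)" where
  "push psi c = (\<lambda>(x, phi). \<Sum>phi' \<in> {phi'. c (x, phi') \<noteq> 0 \<and> comp psi phi' = phi}. c (x, phi'))"

text \<open>The free FI_G-module (direct sum over i in I of M(d i)), M(n)_m = k[Hom([n],[m])].\<close>
definition freefi :: "'i set \<Rightarrow> ('i \<Rightarrow> nat) \<Rightarrow> ('k::comm_ring_1, 'g::group_add, 'i \<times> 'g fiarr \<Rightarrow> 'k) fimod" where
  "freefi I d = \<lparr> deg = (\<lambda>m. freek (Sigma I (\<lambda>i. Hom (d i) m))),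
                  fac = (\<lambda>n m psi c. push psi c) \<rparr>"

record ('k, 'g, 'w) fbmod =
  bdeg :: "nat \<Rightarrow> ('k, 'w) kmod"
  bac :: "nat \<Rightarrow> 'g fiarr \<Rightarrow> 'w \<Rightarrow> 'w"

text \<open>W_n is a k[G_n]-module, G_n = Aut([n]) = Hom n n.\<close>
definition is_fbmod :: "('k::comm_ring_1, 'g::group_add, 'w) fbmod \<Rightarrow> bool" where
  "is_fbmod W \<longleftrightarrow> (\<forall>n. is_kmod (bdeg W n)
    \<and> (\<forall>s\<in>Hom n n. lin (bdeg W n) (bdeg W n) (bac W n s))
    \<and> (\<forall>w\<in>carr (bdeg W n). bac W n (idm n) w = w)
    \<and> (\<forall>s\<in>Hom n n. \<forall>t\<in>Hom n n. \<forall>w\<in>carr (bdeg W n).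
          bac W n s (bac W n t w) = bac W n (comp s t) w))"

definition ind :: "'x \<Rightarrow> 'x \<Rightarrow> 'k::comm_ring_1" where
  "ind p q = (if q = p then 1 else 0)"

text \<open>Free k-module on W_n x Hom(n,m), and the relations defining W_n (x)_{k[G_n]} k[Hom(n,m)].\<close>
definition tfree :: "('k::comm_ring_1, 'g::group_add, 'w) fbmod \<Rightarrow> nat \<Rightarrow> nat \<Rightarrow> ('k, 'w \<times> 'g fiarr \<Rightarrow> 'k) kmod" where
  "tfree W n m = freek (carr (bdeg W n) \<times> Hom n m)"

definition rels :: "('k::comm_ring_1, 'g::group_add, 'w) fbmod \<Rightarrow> nat \<Rightarrow> nat \<Rightarrow> ('w \<times> 'g fiarr \<Rightarrow> 'k) set" where
  "rels W n m =
     {(\<lambda>q. ind (pls (bdeg W n) w w', phi) q - ind (w, phi) q - ind (w', phi) q) | w w' phi.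
        w \<in> carr (bdeg W n) \<and> w' \<in> carr (bdeg W n) \<and> phi \<in> Hom n m}
   \<union> {(\<lambda>q. ind (sml (bdeg W n) a w, phi) q - a * ind (w, phi) q) | a w phi.
        w \<in> carr (bdeg W n) \<and> phi \<in> Hom n m}
   \<union> {(\<lambda>q. ind (bac W n s w, phi) q - ind (w, comp phi s) q) | s w phi.
        s \<in> Hom n n \<and> w \<in> carr (bdeg W n) \<and> phi \<in> Hom n m}"

definition tsub :: "('k::comm_ring_1, 'g::group_add, 'w) fbmod \<Rightarrow> nat \<Rightarrow> nat \<Rightarrow> ('w \<times> 'g fiarr \<Rightarrow> 'k) set" where
  "tsub W n m = kspan (tfree W n m) (rels W n m)"

definition tens :: "('k::comm_ring_1, 'g::group_add, 'w) fbmod \<Rightarrow> nat \<Rightarrow> nat \<Rightarrow> ('k, ('w \<times> 'g fiarr \<Rightarrow> 'k) set) kmod" where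
  "tens W n m = kquot (tfree W n m) (tsub W n m)"

text \<open>M(W) = direct sum over n of M(W_n) (in degree m only the summands n <= m are nonzero).\<close>
definition MW :: "('k::comm_ring_1, 'g::group_add, 'w) fbmod \<Rightarrow> ('k, 'g, nat \<Rightarrow> ('w \<times> 'g fiarr \<Rightarrow> 'k) set) fimod" where
  "MW W = \<lparr> deg = (\<lambda>m. \<lparr> carr = {x. \<forall>n. x n \<in> carr (tens W n m)},
                         zer = (\<lambda>n. zer (tens W n m)),
                         pls = (\<lambda>x y n. pls (tens W n m) (x n) (y n)),
                         sml = (\<lambda>a x n. sml (tens W n m) a (x n)) \<rparr>),
            fac = (\<lambda>m l psi x n. kcoset (tfree W n l) (tsub W n l) (push psi (SOME c. c \<in> x n))) \<rparr>"

text \<open>V is relatively projective: V is isomorphic to M(W) for an FB_G-module W.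
  W is taken with elements in the element type of V; this is no loss since each W_n
  embeds G_n-equivariantly into M(W)_n.\<close>
definition relproj :: "('k::comm_ring_1, 'g::group_add, 'a) fimod \<Rightarrow> bool" where
  "relproj V \<longleftrightarrow> (\<exists>(W :: ('k, 'g, 'a) fbmod) h. is_fbmod W \<and> fiso (MW W) V h)"

definition sharp_filtered :: "('k::comm_ring_1, 'g::group_add, 'a) fimod \<Rightarrow> bool" where
  "sharp_filtered V \<longleftrightarrow> (\<exists>N (S :: nat \<Rightarrow> nat \<Rightarrow> 'a set).
      (\<forall>j\<le>N. sub_fimod V (S j))
    \<and> (\<forall>m. S 0 m = {zer (deg V m)})
    \<and> (\<forall>m. S N m = carr (deg V m))
    \<and> (\<forall>j. 1 \<le> j \<and> j \<le> N \<longrightarrow> (\<forall>m. S (j - 1) m \<subseteq> S j m)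
           \<and> relproj (fquot (frestrict V (S j)) (S (j - 1)))))"

text \<open>Index type for generators of free modules; large enough for all needed resolutions.\<close>
type_synonym ('a, 'k, 'g) ix = "('a + 'k + 'g) \<times> nat"

definition gen_deg :: "('k::comm_ring_1, 'g::group_add, 'a) fimod \<Rightarrow> nat \<Rightarrow> bool" where
  "gen_deg V m \<longleftrightarrow> (\<exists>(I :: ('a, 'k, 'g) ix set) d h.
      (\<forall>i\<in>I. d i \<le> m) \<and> fhom (freefi I d) V h \<and> fsurj (freefi I d) V h)"

definition gen_fin :: "('k::comm_ring_1, 'g::group_add, 'a) fimod \<Rightarrow> bool" where
  "gen_fin V \<longleftrightarrow> (\<exists>m. gen_deg V m)"

definition ltdeg :: "('k, 'g::group_add, 'a) fimod \<Rightarrow> nat \<Rightarrow> 'a set" where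
  "ltdeg V n = kspan (deg V n) (\<Union>m\<in>{..<n}. \<Union>phi\<in>Hom m n. fac V m n phi ` carr (deg V m))"

text \<open>A resolution ... -> F_1 -> F_0 -> V -> 0 by free modules F_j = freefi (I j) (d j)
  (direct sums of M(n), which are projective); delta j : F_(j+1) -> F_j, eps : F_0 -> V.\<close>
definition free_res :: "('k::comm_ring_1, 'g::group_add, 'a) fimod \<Rightarrow> (nat \<Rightarrow> 'i set) \<Rightarrow> (nat \<Rightarrow> 'i \<Rightarrow> nat)
    \<Rightarrow> (nat \<Rightarrow> nat \<Rightarrow> ('i \<times> 'g fiarr \<Rightarrow> 'k) \<Rightarrow> ('i \<times> 'g fiarr \<Rightarrow> 'k))
    \<Rightarrow> (nat \<Rightarrow> ('i \<times> 'g fiarr \<Rightarrow> 'k) \<Rightarrow> 'a) \<Rightarrow> bool" where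
  "free_res V I d delta eps \<longleftrightarrow>
      fhom (freefi (I 0) (d 0)) V eps \<and> fsurj (freefi (I 0) (d 0)) V eps
    \<and> fimg (freefi (I 1) (d 1)) (delta 0) = fker (freefi (I 0) (d 0)) V eps
    \<and> (\<forall>j. fhom (freefi (I (Suc j)) (d (Suc j))) (freefi (I j) (d j)) (delta j))
    \<and> (\<forall>j. fimg (freefi (I (Suc (Suc j))) (d (Suc (Suc j)))) (delta (Suc j))
            = fker (freefi (I (Suc j)) (d (Suc j))) (freefi (I j) (d j)) (delta j))"

text \<open>Hvan i V (for i >= 1) means H_i(V) = 0: the complex H_0(F_(i+1)) -> H_0(F_i) -> H_0(F_(i-1))
  obtained by applying H_0 to a projective (free) resolution is exact at H_0(F_i), in every degree n.
  (Left derived functors do not depend on the chosen projective resolution.)\<close>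
definition Hvan :: "nat \<Rightarrow> ('k::comm_ring_1, 'g::group_add, 'a) fimod \<Rightarrow> bool" where
  "Hvan i V \<longleftrightarrow> (\<exists>(I :: nat \<Rightarrow> ('a, 'k, 'g) ix set) d delta eps. free_res V I d delta eps \<and>
     (\<forall>n. \<forall>x\<in>carr (deg (freefi (I i) (d i)) n).
        delta (i - 1) n x \<in> ltdeg (freefi (I (i - 1)) (d (i - 1))) n \<longrightarrow>
        (\<exists>y\<in>carr (deg (freefi (I (Suc i)) (d (Suc i))) n).
           pls (deg (freefi (I i) (d i)) n) x (sml (deg (freefi (I i) (d i)) n) (-1) (delta i n y))
             \<in> ltdeg (freefi (I i) (d i)) n)))"

definition hom_acyclic :: "('k::comm_ring_1, 'g::group_add, 'a) fimod \<Rightarrow> bool" where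
  "hom_acyclic V \<longleftrightarrow> (\<forall>i\<ge>1. Hvan i V)"

definition surj_chain :: "'q itself \<Rightarrow> ('k::comm_ring_1, 'g::group_add, 'a) fimod \<Rightarrow> bool" where
  "surj_chain _ V \<longleftrightarrow> (\<exists>N (Q :: nat \<Rightarrow> ('k, 'g, 'q) fimod) pi h.
      (\<forall>j\<le>N. is_fimod (Q j)) \<and> fiso V (Q N) h \<and> fzero (Q 0)
    \<and> (\<forall>j. 1 \<le> j \<and> j \<le> N \<longrightarrow> fhom (Q j) (Q (j - 1)) (pi j) \<and> fsurj (Q j) (Q (j - 1)) (pi j)
           \<and> relproj (frestrict (Q j) (fker (Q j) (Q (j - 1)) (pi j)))))"

definition acyc_res :: "'p itself \<Rightarrow> ('k::comm_ring_1, 'g::group_add, 'a) fimod \<Rightarrow> bool" where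
  "acyc_res _ V \<longleftrightarrow> (\<exists>s (P :: nat \<Rightarrow> ('k, 'g, 'p) fimod) dd eps.
      (\<forall>j\<le>s. is_fimod (P j) \<and> hom_acyclic (P j) \<and> gen_fin (P j))
    \<and> fhom (P 0) V eps \<and> fsurj (P 0) V eps
    \<and> (s = 0 \<longrightarrow> fzero (frestrict (P 0) (fker (P 0) V eps)))
    \<and> (s > 0 \<longrightarrow> fimg (P 1) (dd 0) = fker (P 0) V eps
         \<and> (\<forall>j<s. fhom (P (Suc j)) (P j) (dd j))
         \<and> (\<forall>j. 1 \<le> j \<and> j < s \<longrightarrow> fimg (P (Suc j)) (dd j) = fker (P j) (P (j - 1)) (dd (j - 1)))
         \<and> fzero (frestrict (P s) (fker (P s) (P (s - 1)) (dd (s - 1))))))"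

definition pres_fin :: "'m itself \<Rightarrow> ('k::comm_ring_1, 'g::group_add, 'a) fimod \<Rightarrow> bool" where
  "pres_fin _ V \<longleftrightarrow> gen_fin V \<and> (\<exists>r (M :: ('k, 'g, 'm) fimod) h.
      is_fimod M \<and> relproj M \<and> fhom M V h \<and> fsurj M V h \<and> gen_deg (frestrict M (fker M V h)) r)"

end

theory Submission
  imports Defs "HOL-Algebra.FiniteProduct"
begin

text \<open>Let \<open>K V\<close> and \<open>D V\<close> be the kernel and the cokernel of the natural map from \<open>V\<close> to its shift
  \<open>\<Sigma> V\<close>. The functor \<open>D\<close> is right exact, it preserves a short exact sequence \<open>0 \<rightarrow> A \<rightarrow> B \<rightarrow> C \<rightarrow> 0\<close> if
  \<open>K C = 0\<close>, and \<open>H_0(V)\<close> in degree \<open>n\<close> is the degree 0 part of \<open>D^n V\<close>. Call \<open>V\<close> derivative acyclic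
  if \<open>K D^j V = 0\<close> for all \<open>j\<close>. If two terms of a short exact sequence are derivative acyclic, then so
  is the third; when the third is \<open>C\<close>, this is so because the connecting map embeds \<open>K C\<close>, on which
  all proper injections act by zero, into the torsion-free module \<open>D A\<close>. If \<open>C\<close> is derivative acyclic, the map \<open>H_0(A) \<rightarrow> H_0(B)\<close> is injective.

  FI#-modules are derivative acyclic, in particular all \<open>M(W)\<close>, hence all filtered modules. Conversely,
  let \<open>V\<close> be derivative acyclic and generated in degree \<open>\<le> d\<close>, and let \<open>S\<close> be generated by the elements
  of \<open>V\<close> of degree \<open>< d\<close>. Then injectivity on \<open>H_0\<close> shows \<open>V / S = M(W)\<close> with \<open>W = (V / S)_d\<close>, so \<open>S\<close> is
  again derivative acyclic and induction on \<open>d\<close> yields a filtration. This settles (1) to (5).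

  If \<open>V\<close> is presented in finite degree, then all \<open>K D^j V\<close> are bounded and \<open>D^a V = 0\<close> for large \<open>a\<close>.
  Syzygies inherit these properties (with \<open>D^a V\<close> derivative acyclic instead of zero), and together with
  \<open>H_1 = 0\<close> they imply derivative acyclicity. So \<open>H_i(V) = 0\<close> makes the \<open>(i - 1)\<close>-st syzygy derivative
  acyclic, and then \<open>V\<close> as well.\<close>

subsection \<open>The category $FI_G$\<close>

text \<open>The derivative is only right exact, and the work consists in controlling what is lost.
  For a short exact sequence with terms A, B, C the kernel T of DA -> DB comes from K C. The second
  sequence looks like the original one with two terms replaced by their derivatives, so inductions
  run along it. The first one controls T: all proper injections act on T by zero, so H_0(T) = T, and
  injectivity of H_0(T) -> H_0(DA) can force T to vanish. Injectivity of M(W) -> V / S cannot be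
  deduced from acyclicity of V / S, which is only known afterwards. The kernel is instead embedded
  into the pullback of M(W) and V over V / S, which is an extension of V by this kernel, and V is
  acyclic. Modules live on explicit carriers, so element types matter: pairs keep the type fixed
  under derivatives, and the elements of every syzygy are coded in one index type so that it can
  serve for the next free module.\<close>

lemma Hom_iff:
  "phi \<in> Hom n m \<longleftrightarrow> inj_on (fst phi) {1..n} \<and> fst phi ` {1..n} \<subseteq> {1..m} \<and>
     (\<forall>x. x \<notin> {1..n} \<longrightarrow> fst phi x = 0 \<and> snd phi x = 0)"
  by (cases phi) (simp add: Hom_def)

lemma Hom_zero [simp]: "phi \<in> Hom n m \<Longrightarrow> fst phi 0 = 0" "phi \<in> Hom n m \<Longrightarrow> snd phi 0 = 0"
  by (auto simp: Hom_iff)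

lemma Hom_in: "phi \<in> Hom n m \<Longrightarrow> x \<in> {1..n} \<Longrightarrow> fst phi x \<in> {1..m}"
  unfolding Hom_iff by blast

lemma Hom_le: "phi \<in> Hom n m \<Longrightarrow> fst phi x \<le> m"
  by (cases "x \<in> {1..n}") (use Hom_in[of phi n m x] in \<open>auto simp: Hom_iff\<close>)

lemma Hom_card_le: "phi \<in> Hom n m \<Longrightarrow> n \<le> m"
  using card_inj_on_le[of "fst phi" "{1..n}" "{1..m}"] by (auto simp: Hom_iff)

lemma idm_Hom [simp]: "n \<le> m \<Longrightarrow> idm n \<in> Hom n m"
  by (auto simp: Hom_iff idm_def inj_on_def)

lemma comp_Hom [simp]:
  assumes "phi \<in> Hom n m" "psi \<in> Hom m l"
  shows "comp psi phi \<in> Hom n l"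
proof -
  have "inj_on (fst psi \<circ> fst phi) {1..n}"
    using assms by (intro comp_inj_on) (auto simp: Hom_iff intro: inj_on_subset)
  moreover have "(fst psi \<circ> fst phi) ` {1..n} \<subseteq> {1..l}"
    using assms unfolding Hom_iff image_comp[symmetric] by (meson image_mono order_trans)
  ultimately show ?thesis
    using assms by (auto simp: Hom_iff comp_def)
qed

lemma comp_assoc: "comp chi (comp psi phi) = comp (comp chi psi) phi"
  by (simp add: comp_def fun_eq_iff add.assoc)

lemma comp_idm_left [simp]: "phi \<in> Hom n m \<Longrightarrow> m \<le> k \<Longrightarrow> comp (idm k) phi = phi"
proof -
  assume "phi \<in> Hom n m" "m \<le> k"
  then have "fst phi x \<le> k" for x using Hom_le[of phi n m x] by simp
  then show ?thesis by (cases phi) (auto simp: comp_def idm_def fun_eq_iff not_less_eq_eq)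
qed

lemma comp_idm_right [simp]: "phi \<in> Hom n m \<Longrightarrow> comp phi (idm n) = phi"
  by (cases phi) (fastforce simp: comp_def idm_def fun_eq_iff Hom_def)

lemma comp_idm_idm [simp]: "n \<le> m \<Longrightarrow> comp (idm m) (idm n) = (idm n)"
  by (rule comp_idm_left[of _ n n]) auto

lemma comp_inj:
  assumes "psi \<in> Hom m l" "phi \<in> Hom n m" "phi' \<in> Hom n m" "comp psi phi = comp psi phi'"
  shows "phi = phi'"
proof (intro prod_eqI ext)
  fix x
  have eq: "fst psi (fst phi x) = fst psi (fst phi' x)"
       "snd phi x + snd psi (fst phi x) = snd phi' x + snd psi (fst phi' x)"
    using assms(4) by (simp_all add: comp_def fun_eq_iff)
  show f: "fst phi x = fst phi' x"
  proof (cases "x \<in> {1..n}")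
    case True
    then have "fst phi x \<in> {1..m}" "fst phi' x \<in> {1..m}" using assms Hom_in by blast+
    moreover have "inj_on (fst psi) {1..m}" using assms(1) by (simp add: Hom_iff)
    ultimately show ?thesis using eq(1) by (meson inj_onD)
  qed (use assms in \<open>auto simp: Hom_iff\<close>)
  show "snd phi x = snd phi' x" using eq(2) f by simp
qed

text \<open>Adds one point to source and target and matches the new points. The label there has to
  be neutral, which \<open>snd phi\<close> already is outside its domain. Restriction along this
  functor is the shift.\<close>

definition up :: "nat \<Rightarrow> nat \<Rightarrow> ('g::group_add) fiarr \<Rightarrow> 'g fiarr" where
  "up n m phi = ((fst phi)(Suc n := Suc m), snd phi)"

lemma up_Hom [simp]: "phi \<in> Hom n m \<Longrightarrow> up n m phi \<in> Hom (Suc n) (Suc m)"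
proof -
  assume h: "phi \<in> Hom n m"
  have S: "{1..Suc n} = insert (Suc n) {1..n}" by auto
  have "fst phi ` {1..n} \<subseteq> {1..m}" "inj_on (fst phi) {1..n}" using h by (auto simp: Hom_iff)
  then have "inj_on ((fst phi)(Suc n := Suc m)) {1..Suc n}"
    unfolding S inj_on_def by fastforce
  moreover have "(fst phi)(Suc n := Suc m) ` {1..Suc n} \<subseteq> {1..Suc m}"
    using h unfolding S by (auto simp: Hom_iff)
  ultimately show ?thesis using h by (auto simp: Hom_iff up_def)
qed

lemma up_comp: "phi \<in> Hom n m \<Longrightarrow> psi \<in> Hom m l \<Longrightarrow> comp (up m l psi) (up n m phi) = up n l (comp psi phi)"
proof -
  assume h: "phi \<in> Hom n m" "psi \<in> Hom m l"
  then have "fst phi x \<noteq> Suc m" for x using Hom_le[of phi n m x] by auto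
  moreover have "fst phi (Suc n) = 0" "snd psi (Suc m) = 0" using h by (auto simp: Hom_iff)
  moreover have "snd psi 0 = 0" using h by simp
  ultimately show ?thesis by (auto simp: up_def comp_def fun_eq_iff)
qed

lemma up_idm [simp]: "up n n (idm n) = idm (Suc n)"
  by (auto simp: up_def idm_def fun_eq_iff)

lemma up_inc [simp]: "phi \<in> Hom n m \<Longrightarrow> comp (up n m phi) (idm n) = phi"
  by (cases phi) (fastforce simp: comp_def idm_def up_def fun_eq_iff Hom_def)

text \<open>The standard inclusion of the shift, \<open>up n (Suc n) (idm n)\<close>, omits n + 1,
  whereas \<open>idm (Suc n)\<close> as a map into [n+2] omits n + 2. This transposition converts
  one into the other.\<close>

definition swap_top :: "nat \<Rightarrow> ('g::group_add) fiarr" where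
  "swap_top n = ((fst (idm (Suc (Suc n)) :: 'g fiarr))(Suc n := Suc (Suc n), Suc (Suc n) := Suc n), \<lambda>x. 0)"

lemma swap_top_Hom [simp]: "swap_top n \<in> Hom (Suc (Suc n)) (Suc (Suc n))"
  by (auto simp: Hom_iff swap_top_def idm_def inj_on_def)

lemma swap_top_invol [simp]: "comp (swap_top n) (swap_top n) = idm (Suc (Suc n))"
  by (auto simp: comp_def swap_top_def idm_def fun_eq_iff)

lemma swap_top_inc: "comp (swap_top n) (idm (Suc n)) = up n (Suc n) (idm n)"
  by (auto simp: comp_def swap_top_def idm_def up_def fun_eq_iff)

lemma Hom_avoid: "phi \<in> Hom m (Suc n) \<Longrightarrow> Suc n \<notin> fst phi ` {1..m} \<Longrightarrow> phi \<in> Hom m n"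
proof -
  assume "phi \<in> Hom m (Suc n)" "Suc n \<notin> fst phi ` {1..m}"
  moreover have "{1..Suc n} = insert (Suc n) {1..n}" by auto
  ultimately show ?thesis unfolding Hom_iff by (metis subset_insert)
qed

text \<open>A transposition t of the source moves the preimage j of the top point to the last place;
  what remains sends top to top and is of the form \<open>up\<close>.\<close>

lemma Hom_hit:
  assumes "phi \<in> Hom m (Suc n)" "Suc n \<in> fst phi ` {1..m}"
  obtains k psi sigma where "m = Suc k" "psi \<in> Hom k n" "sigma \<in> Hom m m"
    "phi = comp (up k n psi) sigma"
proof -
  obtain j where j: "j \<in> {1..m}" "fst phi j = Suc n" using assms(2) by auto
  then obtain k where m: "m = Suc k" by (cases m) auto
  define t where "t = (id(j := m, m := j) :: nat \<Rightarrow> nat)"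
  have tt: "t (t x) = x" for x using j by (auto simp: t_def)
  have tr: "t x \<in> {1..m} \<longleftrightarrow> x \<in> {1..m}" for x using j m by (auto simp: t_def)
  \<comment> \<open>All labels go into sigma, so that psi and its extension have trivial
    labels.\<close>
  define sigma where "sigma = ((\<lambda>x. if x \<in> {1..m} then t x else 0), snd phi)"
  have inj_t: "inj t" using tt by (metis injI)
  have s: "sigma \<in> Hom m m"
  proof -
    have "inj_on (fst sigma) {1..m}"
      by (rule inj_onI) (simp add: sigma_def inj_eq[OF inj_t])
    moreover have "fst sigma ` {1..m} \<subseteq> {1..m}" using tr by (simp add: sigma_def image_subset_iff)
    moreover have "snd phi x = 0" if "x \<notin> {1..m}" for x using that assms(1) unfolding Hom_iff by blast
    then have "fst sigma x = 0 \<and> snd sigma x = 0" if "x \<notin> {1..m}" for x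
      using that unfolding sigma_def by auto
    ultimately show ?thesis unfolding Hom_iff by blast
  qed
  define psi :: "'a fiarr" where "psi = ((\<lambda>x. if x \<in> {1..k} then fst phi (t x) else 0), \<lambda>x. 0)"
  have ph: "inj_on (fst phi) {1..m}" "fst phi ` {1..m} \<subseteq> {1..Suc n}" using assms(1) by (auto simp: Hom_iff)
  have ne: "fst phi (t x) \<noteq> Suc n" if "x \<in> {1..k}" for x
  proof
    assume "fst phi (t x) = Suc n"
    moreover have "t x \<in> {1..m}" using that tr[of x] m by auto
    ultimately have "t x = j" using j ph(1) by (metis inj_onD)
    then have "x = m" using tt[of x] j by (auto simp: t_def split: if_splits)
    then show False using that m by auto
  qed
  have rng: "fst phi (t x) \<in> {1..n}" if "x \<in> {1..k}" for x
  proof -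
    have "t x \<in> {1..m}" using that tr[of x] m by auto
    then have "fst phi (t x) \<in> {1..Suc n}" using ph(2) by blast
    then show ?thesis using ne[OF that] by auto
  qed
  have psi: "psi \<in> Hom k n"
  proof -
    have "inj_on (fst psi) {1..k}"
    proof (rule inj_onI)
      fix x y assume x: "x \<in> {1..k}" "y \<in> {1..k}" and "fst psi x = fst psi y"
      then have e: "fst phi (t x) = fst phi (t y)" by (simp add: psi_def)
      have "t x \<in> {1..m}" "t y \<in> {1..m}" using x tr m by auto
      then have "t x = t y" using e ph(1) by (meson inj_onD)
      then show "x = y" using inj_t by (meson injD)
    qed
    then show ?thesis using rng by (auto simp: Hom_iff psi_def)
  qed
  have "phi = comp (up k n psi) sigma"
  proof (intro prod_eqI ext)
    fix x
    show "fst phi x = fst (comp (up k n psi) sigma) x"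
    proof (cases "x \<in> {1..m}")
      case True
      show ?thesis
      proof (cases "x = j")
        case True then show ?thesis using j m by (auto simp: comp_def up_def sigma_def t_def psi_def)
      next
        case False
        then have "t x \<noteq> m" using tt[of x] by (auto simp: t_def split: if_splits)
        then have "t x \<in> {1..k}" using tr[of x] True m by auto
        then show ?thesis using True tt m by (auto simp: comp_def up_def sigma_def psi_def)
      qed
    next
      case False then show ?thesis using assms(1) by (auto simp: comp_def up_def sigma_def psi_def Hom_iff)
    qed
    show "snd phi x = snd (comp (up k n psi) sigma) x"
      by (simp add: comp_def up_def sigma_def psi_def)
  qed
  then show ?thesis using that m psi s by blast
qed

text \<open>A proper injection misses a point, to which m + 1 can be sent. Factoring through the
  standard inclusion in this way shows that an element killed by the standard inclusion is killed by
  every morphism to a higher degree.\<close>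

lemma Hom_extend:
  assumes "phi \<in> Hom m n" "m < n"
  obtains psi where "psi \<in> Hom (Suc m) n" "comp psi (idm m) = phi"
proof -
  have "card (fst phi ` {1..m}) \<le> m" using card_image_le[of "{1..m}" "fst phi"] by simp
  then have "\<not> {1..n} \<subseteq> fst phi ` {1..m}"
    using assms(2) card_mono[of "fst phi ` {1..m}" "{1..n}"] by auto
  then obtain y where y: "y \<in> {1..n}" "y \<notin> fst phi ` {1..m}" by blast
  have S: "{1..Suc m} = insert (Suc m) {1..m}" by auto
  define psi where "psi = ((fst phi)(Suc m := y), snd phi)"
  have "inj_on (fst phi) {1..m}" "fst phi ` {1..m} \<subseteq> {1..n}" using assms(1) by (auto simp: Hom_iff)
  then have "inj_on (fst psi) {1..Suc m}" "fst psi ` {1..Suc m} \<subseteq> {1..n}"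
    unfolding S psi_def using y by (auto intro!: inj_on_fun_updI)
  then have "psi \<in> Hom (Suc m) n"
    using assms(1) unfolding Hom_iff by (auto simp: psi_def)
  moreover have "comp psi (idm m) = phi"
    using assms(1) by (cases phi) (fastforce simp: comp_def idm_def psi_def fun_eq_iff Hom_def)
  ultimately show ?thesis by (rule that)
qed

subsection \<open>Modules and congruences\<close>

context
  fixes M :: "('k::comm_ring_1, 'a) kmod"
  assumes M: "is_kmod M"
begin

lemma km_zer [simp]: "zer M \<in> carr M"
  and km_pls [simp]: "x \<in> carr M \<Longrightarrow> y \<in> carr M \<Longrightarrow> pls M x y \<in> carr M"
  and km_sml [simp]: "x \<in> carr M \<Longrightarrow> sml M a x \<in> carr M"
  and km_zer_left [simp]: "x \<in> carr M \<Longrightarrow> pls M (zer M) x = x"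
  and km_neg_right [simp]: "x \<in> carr M \<Longrightarrow> pls M x (sml M (-1) x) = zer M"
  and km_sml_one [simp]: "x \<in> carr M \<Longrightarrow> sml M 1 x = x"
  and km_assoc: "x \<in> carr M \<Longrightarrow> y \<in> carr M \<Longrightarrow> z \<in> carr M \<Longrightarrow> pls M (pls M x y) z = pls M x (pls M y z)"
  and km_comm: "x \<in> carr M \<Longrightarrow> y \<in> carr M \<Longrightarrow> pls M x y = pls M y x"
  and km_sml_add: "x \<in> carr M \<Longrightarrow> sml M (a + b) x = pls M (sml M a x) (sml M b x)"
  and km_sml_pls: "x \<in> carr M \<Longrightarrow> y \<in> carr M \<Longrightarrow> sml M a (pls M x y) = pls M (sml M a x) (sml M a y)"
  and km_sml_sml: "x \<in> carr M \<Longrightarrow> sml M a (sml M b x) = sml M (a * b) x"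
  using M unfolding is_kmod_def by auto

lemma km_zer_right [simp]: "x \<in> carr M \<Longrightarrow> pls M x (zer M) = x"
  using km_comm[of x "zer M"] by simp

lemma km_neg_left [simp]: "x \<in> carr M \<Longrightarrow> pls M (sml M (-1) x) x = zer M"
  using km_comm[of x "sml M (-1) x"] by simp

lemma km_left_comm:
  "x \<in> carr M \<Longrightarrow> y \<in> carr M \<Longrightarrow> z \<in> carr M \<Longrightarrow> pls M x (pls M y z) = pls M y (pls M x z)"
  by (metis km_assoc km_comm)

lemmas km_ac = km_assoc km_comm km_left_comm

lemma km_neg_cancel [simp]:
  "x \<in> carr M \<Longrightarrow> y \<in> carr M \<Longrightarrow> pls M (sml M (-1) x) (pls M x y) = y"
  by (simp flip: km_assoc)

lemma km_sml_zero [simp]: "x \<in> carr M \<Longrightarrow> sml M 0 x = zer M"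
  using km_sml_add[of x 1 "-1"] by simp

lemma km_sml_zer [simp]: "sml M a (zer M) = zer M"
  using km_sml_sml[of "zer M" a 0] by simp

lemma ksub_carr: "ksub M (carr M)"
  by (simp add: ksub_def)

lemma ksub_zer: "ksub M {zer M}"
  by (simp add: ksub_def)

lemma is_kmod_restrict: "ksub M T \<Longrightarrow> is_kmod (M\<lparr>carr := T\<rparr>)"
  using M unfolding is_kmod_def ksub_def by (auto simp: subset_iff)

end

lemma ksubD:
  assumes "ksub M T"
  shows "x \<in> T \<Longrightarrow> x \<in> carr M" "zer M \<in> T" "x \<in> T \<Longrightarrow> y \<in> T \<Longrightarrow> pls M x y \<in> T" "x \<in> T \<Longrightarrow> sml M a x \<in> T"
  using assms by (auto simp: ksub_def)

lemma linD:
  assumes "lin M N f"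
  shows "x \<in> carr M \<Longrightarrow> f x \<in> carr N"
    "x \<in> carr M \<Longrightarrow> y \<in> carr M \<Longrightarrow> f (pls M x y) = pls N (f x) (f y)"
    "x \<in> carr M \<Longrightarrow> f (sml M a x) = sml N a (f x)"
  using assms by (auto simp: lin_def)

lemma lin_zer: "is_kmod M \<Longrightarrow> is_kmod N \<Longrightarrow> lin M N f \<Longrightarrow> f (zer M) = zer N"
  using linD(1)[of M N f "zer M"] linD(3)[of M N f "zer M" 0] by simp

lemma lin_comp: "lin M N f \<Longrightarrow> lin N L g \<Longrightarrow> lin M L (\<lambda>x. g (f x))"
  by (auto simp: lin_def image_subset_iff)

lemma ksub_vimage:
  assumes "is_kmod M" "is_kmod N" "lin M N f" "ksub N Q"
  shows "ksub M {x \<in> carr M. f x \<in> Q}"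
  using assms by (auto simp: ksub_def linD lin_zer)

lemma ksub_image:
  assumes "is_kmod M" "is_kmod N" "lin M N f" "ksub M P"
  shows "ksub N (f ` P)"
  unfolding ksub_def
proof (intro conjI ballI allI)
  show "zer N \<in> f ` P" using lin_zer[OF assms(1-3)] ksubD(2)[OF assms(4)] by (metis imageI)
  show "f ` P \<subseteq> carr N" using linD(1)[OF assms(3)] ksubD(1)[OF assms(4)] by auto
next
  fix x y assume "x \<in> f ` P" "y \<in> f ` P"
  then obtain u v where "x = f u" "y = f v" "u \<in> P" "v \<in> P" by auto
  then show "pls N x y \<in> f ` P"
    using linD(2)[OF assms(3), of u v] ksubD[OF assms(4)] by (metis imageI)
next
  fix a x assume "x \<in> f ` P"
  then obtain u where "x = f u" "u \<in> P" by auto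
  then show "sml N a x \<in> f ` P"
    using linD(3)[OF assms(3), of u a] ksubD[OF assms(4)] by (metis imageI)
qed

lemma kspan_ksub: "is_kmod M \<Longrightarrow> X \<subseteq> carr M \<Longrightarrow> ksub M (kspan M X)"
  using ksub_carr[of M] by (auto simp: kspan_def ksub_def)

lemma kspan_base: "x \<in> X \<Longrightarrow> x \<in> kspan M X"
  by (auto simp: kspan_def)

lemma kspan_min: "ksub M T \<Longrightarrow> X \<subseteq> T \<Longrightarrow> kspan M X \<subseteq> T"
  by (auto simp: kspan_def)

text \<open>Equality in M / P, expressed on representatives. Membership in the carrier is built in,
  so that congruences carry their own typing.\<close>

definition cg :: "('k, 'a) kmod \<Rightarrow> 'a set \<Rightarrow> 'a \<Rightarrow> 'a \<Rightarrow> bool" where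
  "cg M P x y \<longleftrightarrow> x \<in> carr M \<and> y \<in> carr M \<and> (\<exists>p\<in>P. x = pls M y p)"

lemma cg_carr: "cg M P x y \<Longrightarrow> x \<in> carr M" "cg M P x y \<Longrightarrow> y \<in> carr M"
  by (auto simp: cg_def)

lemma cg_mono: "cg M P x y \<Longrightarrow> P \<subseteq> Q \<Longrightarrow> cg M Q x y"
  by (auto simp: cg_def)

context
  fixes M :: "('k::comm_ring_1, 'a) kmod" and P :: "'a set"
  assumes M: "is_kmod M" and P: "ksub M P"
begin

lemma cg_refl [simp]: "x \<in> carr M \<Longrightarrow> cg M P x x"
  using M ksubD(2)[OF P] unfolding cg_def by (metis km_zer_right)

lemma cg_sym: "cg M P x y \<Longrightarrow> cg M P y x"
proof -
  assume "cg M P x y"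
  then obtain p where p: "p \<in> P" "x = pls M y p" and c: "x \<in> carr M" "y \<in> carr M" by (auto simp: cg_def)
  have pc: "p \<in> carr M" using ksubD(1)[OF P p(1)] .
  have "y = pls M x (sml M (-1) p)" unfolding p(2) using c pc M by (simp add: km_assoc)
  then show ?thesis using c ksubD(4)[OF P p(1)] unfolding cg_def by blast
qed

lemma cg_trans [trans]: "cg M P x y \<Longrightarrow> cg M P y z \<Longrightarrow> cg M P x z"
proof -
  assume "cg M P x y" "cg M P y z"
  then obtain p q where p: "p \<in> P" "q \<in> P" "x = pls M y p" "y = pls M z q"
    and c: "x \<in> carr M" "y \<in> carr M" "z \<in> carr M" by (auto simp: cg_def)
  have "x = pls M z (pls M q p)" using p c ksubD(1)[OF P] M by (simp add: km_assoc)
  then show ?thesis using c p ksubD(3)[OF P] unfolding cg_def by blast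
qed

lemma cg_pls: "cg M P x y \<Longrightarrow> cg M P z w \<Longrightarrow> cg M P (pls M x z) (pls M y w)"
proof -
  assume "cg M P x y" "cg M P z w"
  then obtain p q where p: "p \<in> P" "q \<in> P" "x = pls M y p" "z = pls M w q"
    and c: "x \<in> carr M" "y \<in> carr M" "z \<in> carr M" "w \<in> carr M" by (auto simp: cg_def)
  have "pls M x z = pls M (pls M y w) (pls M p q)"
    using p c ksubD(1)[OF P] M by (simp add: km_ac)
  moreover have "pls M p q \<in> P" using p ksubD(3)[OF P] by blast
  ultimately show ?thesis using c M unfolding cg_def by (metis km_pls)
qed

lemma cg_sml: "cg M P x y \<Longrightarrow> cg M P (sml M a x) (sml M a y)"
proof -
  assume "cg M P x y"
  then obtain p where p: "p \<in> P" "x = pls M y p" and c: "x \<in> carr M" "y \<in> carr M" by (auto simp: cg_def)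
  have "sml M a x = pls M (sml M a y) (sml M a p)"
    using p c ksubD(1)[OF P] by (simp add: km_sml_pls[OF M])
  then show ?thesis using c km_sml[OF M] ksubD(4)[OF P p(1)] unfolding cg_def by blast
qed

lemma cg_memD: "cg M P x y \<Longrightarrow> y \<in> P \<Longrightarrow> x \<in> P"
  using ksubD(3)[OF P] by (auto simp: cg_def)

lemma cg_mem: "cg M P x y \<Longrightarrow> x \<in> P \<longleftrightarrow> y \<in> P"
  using cg_sym cg_memD by blast

lemma cg_zer: "x \<in> P \<Longrightarrow> cg M P x (zer M)" "cg M P x (zer M) \<Longrightarrow> x \<in> P"
  using ksubD(1,2)[OF P] cg_mem[of x "zer M"] km_zer[OF M] km_zer_left[OF M]
  unfolding cg_def by metis+

lemma cg_pls_right: "p \<in> P \<Longrightarrow> x \<in> carr M \<Longrightarrow> cg M P (pls M x p) x"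
  using ksubD(1)[OF P] km_pls[OF M] unfolding cg_def by blast

lemma cg_diff:
  assumes "x \<in> carr M" "y \<in> carr M"
  shows "pls M x (sml M (-1) y) \<in> P \<longleftrightarrow> cg M P x y"
proof
  assume "pls M x (sml M (-1) y) \<in> P"
  moreover have "x = pls M y (pls M x (sml M (-1) y))" using assms M by (simp add: km_left_comm)
  ultimately show "cg M P x y" using assms unfolding cg_def by blast
next
  assume "cg M P x y"
  then have "cg M P (pls M x (sml M (-1) y)) (pls M y (sml M (-1) y))"
    by (rule cg_pls) (simp add: assms km_sml[OF M])
  then show "pls M x (sml M (-1) y) \<in> P" using assms cg_zer(2) by (simp add: km_neg_right[OF M])
qed

end

lemma lin_cg:
  assumes "lin M N f" "cg M P x y" "\<And>p. p \<in> P \<Longrightarrow> f p \<in> Q" "ksub M P"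
  shows "cg N Q (f x) (f y)"
proof -
  obtain p where p: "p \<in> P" "x = pls M y p" and c: "x \<in> carr M" "y \<in> carr M"
    using assms(2) by (auto simp: cg_def)
  have "f x = pls N (f y) (f p)"
    unfolding p(2) using linD(2)[OF assms(1) c(2) ksubD(1)[OF assms(4) p(1)]] .
  then show ?thesis using linD(1)[OF assms(1)] c assms(3)[OF p(1)] unfolding cg_def by blast
qed

text \<open>Apply the hypothesis on the kernel to the difference of x and y: a map of quotients with
  trivial kernel is injective.\<close>

lemma lin_cg_reflect:
  assumes "is_kmod M" "is_kmod N" "ksub M P" "ksub N Q" "lin M N f" "x \<in> carr M" "y \<in> carr M"
    and "cg N Q (f x) (f y)" "\<And>x. x \<in> carr M \<Longrightarrow> f x \<in> Q \<Longrightarrow> x \<in> P"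
  shows "cg M P x y"
proof -
  have "f (pls M x (sml M (-1) y)) \<in> Q"
    using assms(8) cg_diff[OF assms(2,4) linD(1)[OF assms(5,6)] linD(1)[OF assms(5,7)]]
    by (simp add: linD[OF assms(5)] assms(6,7) km_sml[OF assms(1)])
  then have "pls M x (sml M (-1) y) \<in> P"
    by (intro assms(9)) (simp_all add: km_pls[OF assms(1)] km_sml[OF assms(1)] assms(6,7))
  then show ?thesis using cg_diff[OF assms(1,3,6,7)] by simp
qed

subsection \<open>Modules modulo a submodule, and the derivative\<close>

abbreviation elts :: "('k, 'g, 'a) fimod \<Rightarrow> nat \<Rightarrow> 'a set" where
  "elts V n \<equiv> carr (deg V n)"

abbreviation eqv :: "('k, 'g, 'a) fimod \<Rightarrow> (nat \<Rightarrow> 'a set) \<Rightarrow> nat \<Rightarrow> 'a \<Rightarrow> 'a \<Rightarrow> bool" where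
  "eqv V P n \<equiv> cg (deg V n) (P n)"

abbreviation inc :: "('k, 'g::group_add, 'a) fimod \<Rightarrow> nat \<Rightarrow> 'a \<Rightarrow> 'a" where
  "inc V n \<equiv> fac V n (Suc n) (idm n)"

lemma fimodD:
  assumes "is_fimod V"
  shows "is_kmod (deg V n)"
    and "phi \<in> Hom n m \<Longrightarrow> lin (deg V n) (deg V m) (fac V n m phi)"
    and "phi \<in> Hom n m \<Longrightarrow> x \<in> elts V n \<Longrightarrow> fac V n m phi x \<in> elts V m"
    and "x \<in> elts V n \<Longrightarrow> fac V n n (idm n) x = x"
    and "phi \<in> Hom n m \<Longrightarrow> psi \<in> Hom m l \<Longrightarrow> x \<in> elts V n \<Longrightarrow>
           fac V m l psi (fac V n m phi x) = fac V n l (comp psi phi) x"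
  using assms linD(1)[of "deg V n" "deg V m" "fac V n m phi"] unfolding is_fimod_def by blast+

lemma sub_fimodD:
  assumes "sub_fimod V S"
  shows "ksub (deg V n) (S n)"
    and "phi \<in> Hom n m \<Longrightarrow> x \<in> S n \<Longrightarrow> fac V n m phi x \<in> S m"
    and "x \<in> S n \<Longrightarrow> x \<in> elts V n"
  using assms ksubD(1)[of "deg V n" "S n"] unfolding sub_fimod_def by blast+

lemma fhomD:
  assumes "fhom A B h"
  shows "lin (deg A n) (deg B n) (h n)"
    and "x \<in> elts A n \<Longrightarrow> h n x \<in> elts B n"
    and "phi \<in> Hom n m \<Longrightarrow> x \<in> elts A n \<Longrightarrow> h m (fac A n m phi x) = fac B n m phi (h n x)"
  using assms linD(1)[of "deg A n" "deg B n" "h n"] unfolding fhom_def by blast+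

lemma frestrict_simps [simp]:
  "elts (frestrict V S) n = S n" "zer (deg (frestrict V S) n) = zer (deg V n)"
  "pls (deg (frestrict V S) n) = pls (deg V n)" "sml (deg (frestrict V S) n) = sml (deg V n)"
  "fac (frestrict V S) = fac V"
  by (simp_all add: frestrict_def)

lemma frestrict_fimod:
  assumes "is_fimod V" "sub_fimod V S"
  shows "is_fimod (frestrict V S)"
proof -
  have "is_kmod (deg (frestrict V S) n)" for n
    using is_kmod_restrict[OF fimodD(1)[OF assms(1)] sub_fimodD(1)[OF assms(2)]]
    by (simp add: frestrict_def)
  moreover have "lin (deg (frestrict V S) n) (deg (frestrict V S) m) (fac V n m phi)"
    if "phi \<in> Hom n m" for n m phi
    using fimodD(2)[OF assms(1) that] sub_fimodD(2,3)[OF assms(2)] that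
    by (simp add: lin_def image_subset_iff)
  ultimately show ?thesis
    using fimodD(4,5)[OF assms(1)] sub_fimodD(3)[OF assms(2)] by (simp add: is_fimod_def)
qed

lemma cg_restrict: "S n \<subseteq> elts V n \<Longrightarrow>
    cg (deg (frestrict V S) n) P x y \<longleftrightarrow> x \<in> S n \<and> y \<in> S n \<and> cg (deg V n) P x y"
  by (auto simp: cg_def)

section \<open>The shift and the derivative of a pair\<close>

definition sh :: "('k, 'g::group_add, 'a) fimod \<Rightarrow> ('k, 'g, 'a) fimod" where
  "sh V = \<lparr>deg = (\<lambda>n. deg V (Suc n)), fac = (\<lambda>n m phi. fac V (Suc n) (Suc m) (up n m phi))\<rparr>"

lemma sh_simps [simp]:
  "deg (sh V) n = deg V (Suc n)" "fac (sh V) n m phi = fac V (Suc n) (Suc m) (up n m phi)"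
  by (simp_all add: sh_def)

lemma sh_fimod: "is_fimod V \<Longrightarrow> is_fimod (sh V)"
  unfolding is_fimod_def by (simp add: up_comp)

definition dP :: "('k, 'g::group_add, 'a) fimod \<Rightarrow> (nat \<Rightarrow> 'a set) \<Rightarrow> nat \<Rightarrow> 'a set" where
  "dP V P n = {x. \<exists>y\<in>elts V n. eqv V P (Suc n) x (inc V n y)}"

definition kvan :: "('k, 'g::group_add, 'a) fimod \<Rightarrow> (nat \<Rightarrow> 'a set) \<Rightarrow> nat \<Rightarrow> bool" where
  "kvan V P n \<longleftrightarrow> (\<forall>x\<in>elts V n. inc V n x \<in> P (Suc n) \<longrightarrow> x \<in> P n)"

lemma kvanD: "kvan V P n \<Longrightarrow> inc V n x \<in> P (Suc n) \<Longrightarrow> x \<in> elts V n \<Longrightarrow> x \<in> P n"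
  by (simp add: kvan_def)

text \<open>A pair \<open>(V, P)\<close> of a module and a submodule stands for the quotient \<open>V / P\<close>. In this way the
  derivative \<open>D V = coker (V \<rightarrow> \<Sigma> V)\<close>, which is \<open>(sh V, dP V P)\<close>, has the same element type as \<open>V\<close>
  and can be iterated; \<open>kvan\<close> says that the kernel of \<open>V \<rightarrow> \<Sigma> V\<close> vanishes in degree \<open>n\<close>.\<close>

locale smodule =
  fixes V :: "('k::comm_ring_1, 'g::group_add, 'a) fimod" and P :: "nat \<Rightarrow> 'a set"
  assumes fimod: "is_fimod V" and sub: "sub_fimod V P"
begin

lemmas km = fimodD(1)[OF fimod] and fac_lin = fimodD(2)[OF fimod]
  and fac_in [simp] = fimodD(3)[OF fimod] and fac_id [simp] = fimodD(4)[OF fimod]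
  and fac_comp = fimodD(5)[OF fimod]
lemmas ks = sub_fimodD(1)[OF sub] and P_fac = sub_fimodD(2)[OF sub] and P_carr = sub_fimodD(3)[OF sub]
lemmas c_refl [simp] = cg_refl[OF km ks] and c_sym = cg_sym[OF km ks]
  and c_trans [trans] = cg_trans[OF km ks] and c_pls = cg_pls[OF km ks]
  and c_mem = cg_mem[OF km ks] and c_memD = cg_memD[OF km ks] and c_zer = cg_zer[OF km ks] and c_diff = cg_diff[OF km ks]
  and c_sml = cg_sml[OF km ks]
lemmas k_zer [simp] = km_zer[OF km] and k_pls [simp] = km_pls[OF km] and k_sml [simp] = km_sml[OF km]

lemma inc_in [simp]: "x \<in> elts V n \<Longrightarrow> inc V n x \<in> elts V (Suc n)"
  by simp

lemma fac_cg: "phi \<in> Hom n m \<Longrightarrow> eqv V P n x y \<Longrightarrow> eqv V P m (fac V n m phi x) (fac V n m phi y)"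
  by (rule lin_cg[OF fac_lin _ P_fac ks])

lemma fac_up_inc:
  "phi \<in> Hom n m \<Longrightarrow> x \<in> elts V n \<Longrightarrow>
    fac V (Suc n) (Suc m) (up n m phi) (inc V n x) = inc V m (fac V n m phi x)"
  by (simp add: fac_comp)

lemma fac_up_inc2: 
  "x \<in> elts V n \<Longrightarrow>
    fac V (Suc n) (Suc (Suc n)) (up n (Suc n) (idm n)) (inc V n x) = inc V (Suc n) (inc V n x)"
  by (simp add: fac_comp)

lemma dP_iff: "x \<in> dP V P n \<longleftrightarrow> (\<exists>y\<in>elts V n. eqv V P (Suc n) x (inc V n y))"
  by (simp add: dP_def)

lemma dP_inc [simp]: "y \<in> elts V n \<Longrightarrow> inc V n y \<in> dP V P n"
  unfolding dP_iff by (metis c_refl inc_in)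

lemma P_dP: "x \<in> P (Suc n) \<Longrightarrow> x \<in> dP V P n"
  unfolding dP_iff using lin_zer[OF km km fac_lin] c_zer(1) k_zer idm_Hom by (metis le_SucI order_refl)

lemma dP_ksub: "ksub (deg V (Suc n)) (dP V P n)"
  unfolding ksub_def
proof (intro conjI ballI allI)
  show "dP V P n \<subseteq> elts V (Suc n)" by (auto simp: dP_iff cg_def)
  show "zer (deg V (Suc n)) \<in> dP V P n" by (rule P_dP) (rule ksubD(2)[OF ks])
next
  fix x y assume "x \<in> dP V P n" "y \<in> dP V P n"
  then obtain u v where u: "u \<in> elts V n" "v \<in> elts V n"
    "eqv V P (Suc n) x (inc V n u)" "eqv V P (Suc n) y (inc V n v)"
      unfolding dP_iff by blast
  have "pls (deg V (Suc n)) (inc V n u) (inc V n v) = inc V n (pls (deg V n) u v)"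
    using linD(2)[OF fac_lin[OF idm_Hom], of n "Suc n"] u by simp
  then show "pls (deg V (Suc n)) x y \<in> dP V P n"
    using c_pls[OF u(3,4)] u(1,2) unfolding dP_iff by (metis k_pls)
next
  fix a x assume "x \<in> dP V P n"
  then obtain u where u: "u \<in> elts V n" "eqv V P (Suc n) x (inc V n u)"
      unfolding dP_iff by blast
  have "sml (deg V (Suc n)) a (inc V n u) = inc V n (sml (deg V n) a u)"
    using linD(3)[OF fac_lin[OF idm_Hom], of n "Suc n"] u by simp
  then show "sml (deg V (Suc n)) a x \<in> dP V P n"
    using c_sml[OF u(2)] u(1) unfolding dP_iff by (metis k_sml)
qed

lemma dP_fac: "phi \<in> Hom n m \<Longrightarrow> x \<in> dP V P n \<Longrightarrow> fac V (Suc n) (Suc m) (up n m phi) x \<in> dP V P m"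
proof -
  assume phi: "phi \<in> Hom n m" and "x \<in> dP V P n"
  then obtain y where y: "y \<in> elts V n" "eqv V P (Suc n) x (inc V n y)"
      unfolding dP_iff by blast
  show ?thesis
    using fac_cg[OF up_Hom[OF phi] y(2)] fac_up_inc[OF phi y(1)] fac_in[OF phi y(1)]
    unfolding dP_iff by auto
qed

lemma D: "smodule (sh V) (dP V P)"
  by unfold_locales (use dP_ksub dP_fac in \<open>auto simp: sub_fimod_def intro: sh_fimod[OF fimod]\<close>)

lemma cg_dP_iff:
  assumes "x \<in> elts V (Suc n)" "y \<in> elts V (Suc n)"
  shows "cg (deg V (Suc n)) (dP V P n) x y \<longleftrightarrow>
    (\<exists>z\<in>elts V n. eqv V P (Suc n) x (pls (deg V (Suc n)) y (inc V n z)))"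
proof
  assume "cg (deg V (Suc n)) (dP V P n) x y"
  then obtain p z where z: "x = pls (deg V (Suc n)) y p" "z \<in> elts V n"
    "eqv V P (Suc n) p (inc V n z)"
    by (auto simp: cg_def[of _ "dP V P n"] dP_iff)
  then show "\<exists>z\<in>elts V n. eqv V P (Suc n) x (pls (deg V (Suc n)) y (inc V n z))"
    using c_pls[OF c_refl[OF assms(2)] z(3)] by auto
next
  assume "\<exists>z\<in>elts V n. eqv V P (Suc n) x (pls (deg V (Suc n)) y (inc V n z))"
  then obtain z where z: "z \<in> elts V n"
    "eqv V P (Suc n) x (pls (deg V (Suc n)) y (inc V n z))" by auto
  have "cg (deg V (Suc n)) (dP V P n) x (pls (deg V (Suc n)) y (inc V n z))"
    using z(2) P_dP by (blast intro: cg_mono)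
  moreover have "cg (deg V (Suc n)) (dP V P n) (pls (deg V (Suc n)) y (inc V n z)) y"
    using z(1) assms by (intro cg_pls_right[OF km dP_ksub]) auto
  ultimately show "cg (deg V (Suc n)) (dP V P n) x y"
    by (rule cg_trans[OF km dP_ksub])
qed

lemma kvan_cg:
  assumes "kvan V P n" "x \<in> elts V n" "y \<in> elts V n"
    "eqv V P (Suc n) (inc V n x) (inc V n y)"
  shows "eqv V P n x y"
  by (rule lin_cg_reflect[OF km km ks ks fac_lin assms(2,3,4)])
     (use assms(1) in \<open>auto simp: kvan_def\<close>)

end

text \<open>Coinduction takes "K D^j V = 0 for all j" one derivative at a time: closure results only
  have to show that their assumptions are inherited by derivatives, and \<open>sh\<close> and
  \<open>dP\<close> are never iterated explicitly.\<close>

coinductive acy :: "('k::comm_ring_1, 'g::group_add, 'a) fimod \<Rightarrow> (nat \<Rightarrow> 'a set) \<Rightarrow> bool" where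
  "(\<And>n. kvan V P n) \<Longrightarrow> acy (sh V) (dP V P) \<Longrightarrow> acy V P"

lemma acyD: "acy V P \<Longrightarrow> kvan V P n" "acy V P \<Longrightarrow> acy (sh V) (dP V P)"
  by (auto elim: acy.cases)

text \<open>The sequence 0 -> A/P -> B/Q -> C/R -> 0 on representatives. The equivalence
  \<open>inj\<close> says both that f is well defined on the quotients and that it is injective
  there; that g is well defined follows from \<open>ex\<close> with a = 0.\<close>

locale ses = A: smodule A P + B: smodule B Q + C: smodule C R
  for A :: "('k::comm_ring_1, 'g::group_add, 'a) fimod" and P
    and B :: "('k, 'g, 'b) fimod" and Q and C :: "('k, 'g, 'c) fimod" and R +
  fixes f :: "nat \<Rightarrow> 'a \<Rightarrow> 'b" and g :: "nat \<Rightarrow> 'b \<Rightarrow> 'c"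
  assumes f: "fhom A B f" and g: "fhom B C g"
    and inj: "a \<in> elts A n \<Longrightarrow> f n a \<in> Q n \<longleftrightarrow> a \<in> P n"
    and ex: "b \<in> elts B n \<Longrightarrow> g n b \<in> R n \<longleftrightarrow> (\<exists>a\<in>elts A n. eqv B Q n b (f n a))"
    and surj: "c \<in> elts C n \<Longrightarrow> \<exists>b\<in>elts B n. eqv C R n c (g n b)"
begin

lemmas f_lin = fhomD(1)[OF f] and f_in [simp] = fhomD(2)[OF f] and f_fac = fhomD(3)[OF f]
lemmas g_lin = fhomD(1)[OF g] and g_in [simp] = fhomD(2)[OF g] and g_fac = fhomD(3)[OF g]

lemma gf [simp]: "a \<in> elts A n \<Longrightarrow> g n (f n a) \<in> R n"
  using ex[of "f n a" n] B.c_refl[of "f n a" n] f_in by blast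

lemma gQ: "b \<in> Q n \<Longrightarrow> g n b \<in> R n"
  using ex[of b n] B.P_carr[of b n] B.c_zer(1)[of b n] lin_zer[OF A.km B.km f_lin, of n] A.k_zer[of n]
  by metis

lemma f_cg: "eqv A P n x y \<Longrightarrow> eqv B Q n (f n x) (f n y)"
  by (rule lin_cg[OF f_lin _ _ A.ks]) (use inj A.P_carr in auto)

lemma f_cgD: "x \<in> elts A n \<Longrightarrow> y \<in> elts A n \<Longrightarrow> eqv B Q n (f n x) (f n y) \<Longrightarrow>
    eqv A P n x y"
  by (rule lin_cg_reflect[OF A.km B.km A.ks B.ks f_lin]) (auto simp: inj)

lemma g_cg: "eqv B Q n x y \<Longrightarrow> eqv C R n (g n x) (g n y)"
  by (rule lin_cg[OF g_lin _ gQ B.ks])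

lemma f_inc [simp]: "a \<in> elts A n \<Longrightarrow> f (Suc n) (inc A n a) = inc B n (f n a)"
  by (simp add: f_fac)

lemma g_inc [simp]: "b \<in> elts B n \<Longrightarrow> g (Suc n) (inc B n b) = inc C n (g n b)"
  by (simp add: g_fac)

lemma exE:
  assumes "b \<in> elts B n" "g n b \<in> R n"
  obtains a where "a \<in> elts A n" "eqv B Q n b (f n a)"
  using ex assms by blast

lemma surjE:
  assumes "c \<in> elts C n"
  obtains b where "b \<in> elts B n" "eqv C R n c (g n b)"
  using surj assms by blast

lemma f_D: "fhom (sh A) (sh B) (\<lambda>n. f (Suc n))"
  using f_lin f_fac by (auto simp: fhom_def)

lemma g_D: "fhom (sh B) (sh C) (\<lambda>n. g (Suc n))"
  using g_lin g_fac by (auto simp: fhom_def)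

lemma f_dP: "a \<in> dP A P n \<Longrightarrow> f (Suc n) a \<in> dP B Q n"
  unfolding A.dP_iff B.dP_iff using f_cg by (metis f_in f_inc)

lemma g_dP: "b \<in> dP B Q n \<Longrightarrow> g (Suc n) b \<in> dP C R n"
  unfolding B.dP_iff C.dP_iff using g_cg by (metis g_in g_inc)

text \<open>Right exactness of the derivative at the middle term: if g b is the image of c under the
  standard inclusion, lift c to b'. Then b minus the image of b' is in the kernel of g and comes
  from A.\<close>

lemma g_dP_iff:
  assumes b: "b \<in> elts B (Suc n)"
  shows "g (Suc n) b \<in> dP C R n \<longleftrightarrow> (\<exists>a\<in>elts A (Suc n). cg (deg B (Suc n)) (dP B Q n) b (f (Suc n) a))"
proof
  assume "g (Suc n) b \<in> dP C R n"
  then obtain c where c: "c \<in> elts C n" "eqv C R (Suc n) (g (Suc n) b) (inc C n c)"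
      unfolding C.dP_iff by blast
  obtain b' where b': "b' \<in> elts B n" "eqv C R n c (g n b')" using surjE[OF c(1)] .
  have "eqv C R (Suc n) (g (Suc n) b) (g (Suc n) (inc B n b'))"
    using C.c_trans[OF c(2) C.fac_cg[OF _ b'(2)]] b'(1) by simp
  then have "g (Suc n) (pls (deg B (Suc n)) b (sml (deg B (Suc n)) (-1) (inc B n b'))) \<in> R (Suc n)"
    using C.c_diff b b'(1) by (simp add: linD[OF g_lin])
  then obtain a where a: "a \<in> elts A (Suc n)"
    "eqv B Q (Suc n) (pls (deg B (Suc n)) b (sml (deg B (Suc n)) (-1) (inc B n b'))) (f (Suc n) a)"
    by (rule exE[rotated]) (use b b'(1) in auto)
  have "eqv B Q (Suc n) b (pls (deg B (Suc n)) (f (Suc n) a) (inc B n b'))"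
    using B.c_pls[OF a(2) B.c_refl[OF B.inc_in[OF b'(1)]]] b b'(1) km_assoc[OF B.km] km_neg_left[OF B.km]
      km_zer_right[OF B.km] by simp
  then show "\<exists>a\<in>elts A (Suc n). cg (deg B (Suc n)) (dP B Q n) b (f (Suc n) a)"
    using a(1) b b'(1) B.cg_dP_iff[of b n "f (Suc n) a"] by auto
next
  assume "\<exists>a\<in>elts A (Suc n). cg (deg B (Suc n)) (dP B Q n) b (f (Suc n) a)"
  then obtain a where a: "a \<in> elts A (Suc n)" "cg (deg B (Suc n)) (dP B Q n) b (f (Suc n) a)" by auto
  have "cg (deg C (Suc n)) (dP C R n) (g (Suc n) b) (g (Suc n) (f (Suc n) a))"
    by (rule lin_cg[OF g_lin a(2) g_dP B.dP_ksub])
  then show "g (Suc n) b \<in> dP C R n"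
    using cg_memD[OF C.km C.dP_ksub] C.P_dP[OF gf[OF a(1)]] by blast
qed

lemma D_surj:
  "c \<in> elts C (Suc n) \<Longrightarrow> \<exists>b\<in>elts B (Suc n). cg (deg C (Suc n)) (dP C R n) c (g (Suc n) b)"
  using surj[of c "Suc n"] cg_mono[of _ "R (Suc n)" _ _ "dP C R n"] C.P_dP by blast

text \<open>The kernel of \<open>D A \<rightarrow> D B\<close> is the image of \<open>ker (C \<rightarrow> \<Sigma> C)\<close>, on which all proper injections act by zero.\<close>

lemma conn_K:
  assumes "a \<in> elts A (Suc n)" "b \<in> elts B n" "eqv B Q (Suc n) (f (Suc n) a) (inc B n b)"
  shows "inc C n (g n b) \<in> R (Suc n)"
  using C.c_mem[OF g_cg[OF assms(3)]] gf[OF assms(1)] assms(2) by simp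

text \<open>Injectivity of the connecting map, which sends the class of \<open>a\<close> in the
  kernel of DA -> DB to the class of \<open>g n b\<close>.\<close>

lemma conn_P:
  assumes a: "a \<in> elts A (Suc n)" and b: "b \<in> elts B n"
    "eqv B Q (Suc n) (f (Suc n) a) (inc B n b)" and "g n b \<in> R n"
  shows "a \<in> dP A P n"
proof -
  obtain a' where a': "a' \<in> elts A n" "eqv B Q n b (f n a')"
    using exE[OF b(1) assms(4)] .
  have "eqv B Q (Suc n) (f (Suc n) a) (f (Suc n) (inc A n a'))"
    using B.c_trans[OF b(2) B.fac_cg[OF _ a'(2)]] a'(1) by simp
  then have "eqv A P (Suc n) a (inc A n a')"
    using f_cgD a a'(1) by simp
  then show ?thesis using a'(1) unfolding A.dP_iff by blast
qed

text \<open>By \<open>Hom_extend\<close>, phi factors through the standard inclusion, which kills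
  the class of g b; so phi kills it too. This class is the value of the connecting map, and
  \<open>conn_P\<close> carries the vanishing back to a.\<close>

lemma conn_zero:
  assumes a: "a \<in> elts A (Suc m)" "f (Suc m) a \<in> dP B Q m" and phi: "phi \<in> Hom m n" "m < n"
  shows "fac A (Suc m) (Suc n) (up m n phi) a \<in> dP A P n"
proof -
  obtain b where b: "b \<in> elts B m" "eqv B Q (Suc m) (f (Suc m) a) (inc B m b)"
    using a(2) unfolding B.dP_iff by blast
  obtain psi where psi: "psi \<in> Hom (Suc m) n" "comp psi (idm m) = phi"
    using Hom_extend[OF phi] .
  have "fac C (Suc m) n psi (inc C m (g m b)) \<in> R n"
    using C.P_fac[OF psi(1) conn_K[OF a(1) b]] .
  then have g: "g n (fac B m n phi b) \<in> R n"
    using psi phi b(1) C.fac_comp[OF idm_Hom psi(1), of m "g m b"] by (simp add: g_fac)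
  have u: "up m n phi \<in> Hom (Suc m) (Suc n)" using phi by simp
  have "eqv B Q (Suc n) (f (Suc n) (fac A (Suc m) (Suc n) (up m n phi) a)) (inc B n (fac B m n phi b))"
    using B.fac_cg[OF u b(2)] unfolding f_fac[OF u a(1)] B.fac_up_inc[OF phi(1) b(1)] .
  then show ?thesis using conn_P g A.fac_in[OF u a(1)] B.fac_in[OF phi(1) b(1)] by blast
qed

text \<open>Exactness of K B -> K C -> DA -> DB at K C: with K B = 0 and DA -> DB injective in this
  degree, nothing is left for K C.\<close>

lemma conn_kvan:
  assumes "kvan B Q n"
    and "\<And>a. a \<in> elts A (Suc n) \<Longrightarrow> f (Suc n) a \<in> dP B Q n \<Longrightarrow> a \<in> dP A P n"
  shows "kvan C R n"
  unfolding kvan_def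
proof (intro ballI impI)
  fix c assume c: "c \<in> elts C n" "inc C n c \<in> R (Suc n)"
  obtain b where b: "b \<in> elts B n" "eqv C R n c (g n b)" using surjE[OF c(1)] .
  have "g (Suc n) (inc B n b) \<in> R (Suc n)"
    using C.fac_cg[OF _ b(2), of "idm n" "Suc n"] c(2) C.c_mem b(1) by simp
  then obtain a where a: "a \<in> elts A (Suc n)" "eqv B Q (Suc n) (inc B n b) (f (Suc n) a)"
    using exE[OF B.inc_in[OF b(1)]] by blast
  have "f (Suc n) a \<in> dP B Q n" using B.c_sym[OF a(2)] b(1) unfolding B.dP_iff by blast
  then have "a \<in> dP A P n" using assms(2) a(1) by blast
  then obtain a' where a': "a' \<in> elts A n" "eqv A P (Suc n) a (inc A n a')"
    unfolding A.dP_iff by blast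
  have "eqv B Q (Suc n) (inc B n b) (inc B n (f n a'))"
    using B.c_trans[OF a(2) f_cg[OF a'(2)]] a'(1) by simp
  then have "eqv B Q n b (f n a')" using B.kvan_cg[OF assms(1)] b(1) a'(1) by simp
  then have "g n b \<in> R n" using ex a'(1) b(1) by blast
  then show "c \<in> R n" using b(2) C.c_mem by blast
qed

lemma kvan_right:
  assumes "kvan B Q n" "kvan (sh A) (dP A P) n"
  shows "kvan C R n"
proof (rule conn_kvan[OF assms(1)])
  fix a assume a: "a \<in> elts A (Suc n)" "f (Suc n) a \<in> dP B Q n"
  then have "inc (sh A) n a \<in> dP A P (Suc n)" using conn_zero[of a n "idm n" "Suc n"] by simp
  then show "a \<in> dP A P n" using kvanD[OF assms(2)] a(1) by simp
qed

lemma D_ses: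
  assumes K: "\<And>n. kvan C R n"
  shows "ses (sh A) (dP A P) (sh B) (dP B Q) (sh C) (dP C R) (\<lambda>n. f (Suc n)) (\<lambda>n. g (Suc n))"
proof (intro ses.intro ses_axioms.intro)
  show "smodule (sh A) (dP A P)" "smodule (sh B) (dP B Q)" "smodule (sh C) (dP C R)"
    by (rule A.D, rule B.D, rule C.D)
  show "fhom (sh A) (sh B) (\<lambda>n. f (Suc n))" "fhom (sh B) (sh C) (\<lambda>n. g (Suc n))" by (rule f_D, rule g_D)
next
  fix a n assume "a \<in> elts (sh A) n"
  then have a: "a \<in> elts A (Suc n)" by simp
  show "f (Suc n) a \<in> dP B Q n \<longleftrightarrow> a \<in> dP A P n"
  proof
    assume "f (Suc n) a \<in> dP B Q n"
    then obtain b where b: "b \<in> elts B n" "eqv B Q (Suc n) (f (Suc n) a) (inc B n b)"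
      unfolding B.dP_iff by blast
    then show "a \<in> dP A P n" using conn_P[OF a _ b(2)] conn_K[OF a _ b(2)] kvanD[OF K] g_in by blast
  qed (rule f_dP)
next
  fix b n assume "b \<in> elts (sh B) n"
  then show "g (Suc n) b \<in> dP C R n \<longleftrightarrow>
      (\<exists>a\<in>elts (sh A) n. eqv (sh B) (dP B Q) n b (f (Suc n) a))"
    unfolding sh_simps by (rule g_dP_iff)
next
  fix c n assume "c \<in> elts (sh C) n"
  then show "\<exists>b\<in>elts (sh B) n. eqv (sh C) (dP C R) n c (g (Suc n) b)"
    unfolding sh_simps by (rule D_surj)
qed

lemma kvan_left: "kvan B Q n \<Longrightarrow> kvan A P n"
  unfolding kvan_def using inj by (metis A.inc_in f_inc f_in)

lemma kvan_mid:
  assumes "kvan A P n" "kvan C R n"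
  shows "kvan B Q n"
  unfolding kvan_def
proof (intro ballI impI)
  fix b assume b: "b \<in> elts B n" "inc B n b \<in> Q (Suc n)"
  have "inc C n (g n b) \<in> R (Suc n)" using gQ[OF b(2)] b(1) by simp
  then have "g n b \<in> R n" using kvanD[OF assms(2)] b(1) g_in by blast
  then obtain a where a: "a \<in> elts A n" "eqv B Q n b (f n a)" using exE[OF b(1)] by blast
  have "eqv B Q (Suc n) (inc B n b) (f (Suc n) (inc A n a))"
    using B.fac_cg[OF _ a(2)] a(1) by simp
  then have "inc A n a \<in> P (Suc n)" using b(2) B.c_mem inj a(1) A.inc_in by blast
  then have "a \<in> P n" using a(1) by (rule kvanD[OF assms(1)])
  then show "b \<in> Q n" using a B.c_mem inj by blast
qed

end

text \<open>The relation for the coinduction is the existence of a short exact sequence whose other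
  two terms are acyclic. Since K C = 0, it passes to derivatives by \<open>D_ses\<close>.\<close>

lemma acy_left:
  assumes "ses A P B Q C R f g" "acy B Q" "acy C R"
  shows "acy A P"
  using assms
proof (coinduction arbitrary: A P B Q C R f g)
  case acy
  then interpret ses A P B Q C R f g by simp
  have "kvan A P n" for n using kvan_left acyD(1)[OF acy(2)] by blast
  moreover have "ses (sh A) (dP A P) (sh B) (dP B Q) (sh C) (dP C R) (\<lambda>n. f (Suc n)) (\<lambda>n. g (Suc n))"
    using acyD(1)[OF acy(3)] by (rule D_ses)
  ultimately show ?case
    using acyD(2)[OF acy(2)] acyD(2)[OF acy(3)]
    by (intro exI conjI allI disjI1) (rule refl | assumption)+
qed

lemma acy_mid:
  assumes "ses A P B Q C R f g" "acy A P" "acy C R"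
  shows "acy B Q"
  using assms
proof (coinduction arbitrary: A P B Q C R f g)
  case acy
  then interpret ses A P B Q C R f g by simp
  have "kvan B Q n" for n using kvan_mid acyD(1)[OF acy(2)] acyD(1)[OF acy(3)] by blast
  moreover have "ses (sh A) (dP A P) (sh B) (dP B Q) (sh C) (dP C R) (\<lambda>n. f (Suc n)) (\<lambda>n. g (Suc n))"
    using acyD(1)[OF acy(3)] by (rule D_ses)
  ultimately show ?case
    using acyD(2)[OF acy(2)] acyD(2)[OF acy(3)]
    by (intro exI conjI allI disjI1) (rule refl | assumption)+
qed

text \<open>K C = 0 is not given here. It is obtained from torsion-freeness of the left term one
  derivative further, K D A = 0.\<close>

lemma acy_right:
  assumes "ses A P B Q C R f g" "acy A P" "acy B Q"
  shows "acy C R"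
  using assms
proof (coinduction arbitrary: A P B Q C R f g)
  case acy
  then interpret ses A P B Q C R f g by simp
  have K: "kvan C R n" for n
    using kvan_right acyD(1)[OF acyD(2)[OF acy(2)]] acyD(1)[OF acy(3)] by blast
  then have "ses (sh A) (dP A P) (sh B) (dP B Q) (sh C) (dP C R) (\<lambda>n. f (Suc n)) (\<lambda>n. g (Suc n))"
    by (rule D_ses)
  with K show ?case
    using acyD(2)[OF acy(2)] acyD(2)[OF acy(3)]
    by (intro exI conjI allI disjI1) (rule refl | assumption)+
qed

subsection \<open>Elements coming from lower degrees\<close>

text \<open>\<open>elts V n\<close> modulo \<open>lt V P n\<close> is H_0(V / P) in degree
  n.\<close>

definition lt :: "('k::comm_ring_1, 'g::group_add, 'a) fimod \<Rightarrow> (nat \<Rightarrow> 'a set) \<Rightarrow> nat \<Rightarrow> 'a set" where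
  "lt V P n = kspan (deg V n) (P n \<union> (\<Union>m\<in>{..<n}. \<Union>phi\<in>Hom m n. fac V m n phi ` elts V m))"

context smodule
begin

lemma lt_ksub: "ksub (deg V n) (lt V P n)"
  unfolding lt_def by (rule kspan_ksub[OF km]) (use P_carr in auto)

lemma lt_P: "x \<in> P n \<Longrightarrow> x \<in> lt V P n"
  unfolding lt_def by (auto intro: kspan_base)

lemma lt_gen: "phi \<in> Hom m n \<Longrightarrow> m < n \<Longrightarrow> x \<in> elts V m \<Longrightarrow> fac V m n phi x \<in> lt V P n"
  unfolding lt_def by (rule kspan_base) blast

lemma lt_min:
  assumes "ksub (deg V n) T" "P n \<subseteq> T"
    "\<And>m phi x. phi \<in> Hom m n \<Longrightarrow> m < n \<Longrightarrow> x \<in> elts V m \<Longrightarrow> fac V m n phi x \<in> T"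
  shows "lt V P n \<subseteq> T"
  unfolding lt_def by (rule kspan_min) (use assms in auto)

lemma lt_0: "lt V P 0 = P 0"
  using lt_min[OF ks, of 0] lt_P[of _ 0] by auto

lemma lt_carr: "x \<in> lt V P n \<Longrightarrow> x \<in> elts V n"
  using ksubD(1)[OF lt_ksub] .

lemma lt_cg: "eqv V P n x y \<Longrightarrow> x \<in> lt V P n \<longleftrightarrow> y \<in> lt V P n"
  using cg_mem[OF km lt_ksub] cg_mono lt_P by (metis subsetI)

text \<open>A morphism into [n+1] either hits the new point, and then it is a shifted morphism after
  a permutation of the source, or it factors through the standard inclusion, whose image is divided
  out in the derivative. So H_0(D V) in degree n is H_0(V) in degree n + 1.\<close>

lemma lt_D: "lt (sh V) (dP V P) n = lt V P (Suc n)"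
proof
  interpret D: smodule "sh V" "dP V P" by (rule D)
  show "lt (sh V) (dP V P) n \<subseteq> lt V P (Suc n)"
  proof (rule D.lt_min)
    show "ksub (deg (sh V) n) (lt V P (Suc n))" using lt_ksub by simp
    show "dP V P n \<subseteq> lt V P (Suc n)"
    proof
      fix x assume "x \<in> dP V P n"
      then obtain y where "y \<in> elts V n" "eqv V P (Suc n) x (inc V n y)"
        unfolding dP_iff by blast
      then show "x \<in> lt V P (Suc n)" using lt_cg lt_gen[OF idm_Hom, of n "Suc n"] by simp
    qed
    show "fac (sh V) m n phi x \<in> lt V P (Suc n)"
      if "phi \<in> Hom m n" "m < n" "x \<in> elts (sh V) m" for m phi x
      using that by (simp add: lt_gen)
  qed
  show "lt V P (Suc n) \<subseteq> lt (sh V) (dP V P) n"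
  proof (rule lt_min)
    show "ksub (deg V (Suc n)) (lt (sh V) (dP V P) n)" using D.lt_ksub by simp
    show "P (Suc n) \<subseteq> lt (sh V) (dP V P) n" using P_dP D.lt_P by blast
    fix m x and phi :: "'g fiarr" assume h: "phi \<in> Hom m (Suc n)" "m < Suc n" "x \<in> elts V m"
    show "fac V m (Suc n) phi x \<in> lt (sh V) (dP V P) n"
    proof (cases "Suc n \<in> fst phi ` {1..m}")
      case True
      from Hom_hit[OF h(1) True] obtain k psi sigma where k: "m = Suc k" "psi \<in> Hom k n" "sigma \<in> Hom m m"
        "phi = comp (up k n psi) sigma" by metis
      have "fac V m (Suc n) phi x = fac (sh V) k n psi (fac V m m sigma x)"
        unfolding k(4) using k(1,2,3) h(3) fac_comp[of sigma m m "up k n psi" "Suc n" x] by simp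
      then show ?thesis using D.lt_gen[OF k(2)] h k by simp
    next
      case False
      have p: "phi \<in> Hom m n" by (rule Hom_avoid[OF h(1) False])
      have "fac V m (Suc n) phi x = inc V n (fac V m n phi x)"
        using fac_comp[OF p, of "idm n" "Suc n" x] p h(3) comp_idm_left[OF p order_refl] by simp
      then show ?thesis using D.lt_P dP_inc[of "fac V m n phi x" n] p h(3) by simp
    qed
  qed
qed

end

section \<open>Surjections, their kernels and their effect on H_0\<close>

locale ssurj = B: smodule B Q + C: smodule C R
  for B :: "('k::comm_ring_1, 'g::group_add, 'b) fimod" and Q
    and C :: "('k, 'g, 'c) fimod" and R +
  fixes g :: "nat \<Rightarrow> 'b \<Rightarrow> 'c"
  assumes g: "fhom B C g"
    and gQ: "b \<in> Q n \<Longrightarrow> g n b \<in> R n"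
    and surj: "c \<in> elts C n \<Longrightarrow> \<exists>b\<in>elts B n. eqv C R n c (g n b)"

definition pre :: "('k, 'g::group_add, 'b) fimod \<Rightarrow> (nat \<Rightarrow> 'b \<Rightarrow> 'c) \<Rightarrow> (nat \<Rightarrow> 'c set) \<Rightarrow> nat \<Rightarrow> 'b set" where
  "pre B g R n = {b \<in> elts B n. g n b \<in> R n}"

lemma pre_sub_fimod:
  assumes "is_fimod B" "is_fimod C" "fhom B C g" "sub_fimod C R"
  shows "sub_fimod B (pre B g R)"
proof -
  have "ksub (deg B n) (pre B g R n)" for n
    unfolding pre_def
    by (rule ksub_vimage[OF fimodD(1)[OF assms(1)] fimodD(1)[OF assms(2)] fhomD(1)[OF assms(3)] sub_fimodD(1)[OF assms(4)]])
  then show ?thesis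
    using fimodD(3)[OF assms(1)] fhomD(3)[OF assms(3)] sub_fimodD(2)[OF assms(4)]
    by (auto simp: sub_fimod_def pre_def)
qed

lemma smodule_restrict:
  assumes "smodule V P" "sub_fimod V S" "\<And>n. P n \<subseteq> S n"
  shows "smodule (frestrict V S) P"
proof -
  interpret smodule V P by fact
  show ?thesis
    by unfold_locales
      (use assms(3) P_fac ksubD[OF ks] in \<open>auto simp: sub_fimod_def ksub_def intro: frestrict_fimod[OF fimod assms(2)]\<close>)
qed

context ssurj
begin

lemmas g_lin = fhomD(1)[OF g] and g_in [simp] = fhomD(2)[OF g] and g_fac = fhomD(3)[OF g]

lemma g_cg: "eqv B Q n x y \<Longrightarrow> eqv C R n (g n x) (g n y)"
  by (rule lin_cg[OF g_lin _ gQ B.ks])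

lemma ker_ses: "ses (frestrict B (pre B g R)) Q B Q C R (\<lambda>n x. x) g"
proof (intro ses.intro ses_axioms.intro)
  have sub: "sub_fimod B (pre B g R)"
    by (rule pre_sub_fimod[OF B.fimod C.fimod g C.sub])
  show "smodule (frestrict B (pre B g R)) Q"
    by (rule smodule_restrict[OF B.smodule_axioms sub]) (use B.P_carr gQ in \<open>auto simp: pre_def\<close>)
  show "smodule B Q" "smodule C R" by unfold_locales
  show "fhom (frestrict B (pre B g R)) B (\<lambda>n x. x)"
    by (auto simp: fhom_def lin_def pre_def)
  show "fhom B C g" by (rule g)
next
  fix b n assume b: "b \<in> elts B n"
  show "g n b \<in> R n \<longleftrightarrow> (\<exists>a\<in>elts (frestrict B (pre B g R)) n. eqv B Q n b a)"
    using b g_cg C.c_mem B.c_refl[OF b] by (fastforce simp: pre_def)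
qed (use surj in auto)

lemma g_lt: "b \<in> lt B Q n \<Longrightarrow> g n b \<in> lt C R n"
proof -
  have "lt B Q n \<subseteq> {b \<in> elts B n. g n b \<in> lt C R n}"
    by (rule B.lt_min[OF ksub_vimage[OF B.km C.km g_lin C.lt_ksub]])
      (use B.P_carr C.lt_P gQ C.lt_gen in \<open>auto simp: g_fac\<close>)
  then show "b \<in> lt B Q n \<Longrightarrow> g n b \<in> lt C R n" by auto
qed

text \<open>The image of an element under a morphism from lower degree is lifted by lifting the
  element; the elements that lift in this way form a submodule.\<close>

lemma lt_lift: "c \<in> lt C R n \<Longrightarrow> \<exists>b\<in>lt B Q n. eqv C R n c (g n b)"
proof -
  let ?T = "{c. \<exists>b\<in>lt B Q n. eqv C R n c (g n b)}"
  have "lt C R n \<subseteq> ?T"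
  proof (rule C.lt_min)
    have zer: "g n (zer (deg B n)) = zer (deg C n)" using lin_zer[OF B.km C.km g_lin] .
    show "R n \<subseteq> ?T" using C.c_zer(1) zer ksubD(2)[OF B.lt_ksub] by force
    show "ksub (deg C n) ?T"
      unfolding ksub_def
    proof (intro conjI ballI allI)
      show "?T \<subseteq> elts C n" by (auto simp: cg_def)
      show "zer (deg C n) \<in> ?T" using C.c_refl[of "zer (deg C n)" n] zer ksubD(2)[OF B.lt_ksub] C.k_zer by force
    next
      fix x y assume "x \<in> ?T" "y \<in> ?T"
      then obtain u v where u: "u \<in> lt B Q n" "v \<in> lt B Q n" "eqv C R n x (g n u)" "eqv C R n y (g n v)"
        by blast
      then have "eqv C R n (pls (deg C n) x y) (g n (pls (deg B n) u v))"
        using C.c_pls[OF u(3,4)] linD(2)[OF g_lin B.lt_carr[OF u(1)] B.lt_carr[OF u(2)]] by simp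
      then show "pls (deg C n) x y \<in> ?T" using ksubD(3)[OF B.lt_ksub u(1,2)] by blast
    next
      fix a x assume "x \<in> ?T"
      then obtain u where u: "u \<in> lt B Q n" "eqv C R n x (g n u)" by blast
      then have "eqv C R n (sml (deg C n) a x) (g n (sml (deg B n) a u))"
        using C.c_sml[OF u(2)] linD(3)[OF g_lin B.lt_carr[OF u(1)]] by simp
      then show "sml (deg C n) a x \<in> ?T" using ksubD(4)[OF B.lt_ksub u(1)] by blast
    qed
    fix m x and phi :: "'g fiarr" assume h: "phi \<in> Hom m n" "m < n" "x \<in> elts C m"
    obtain b where b: "b \<in> elts B m" "eqv C R m x (g m b)" using surj[OF h(3)] by blast
    have "eqv C R n (fac C m n phi x) (g n (fac B m n phi b))"
      using C.fac_cg[OF h(1) b(2)] g_fac[OF h(1) b(1)] by simp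
    then show "fac C m n phi x \<in> ?T" using B.lt_gen[OF h(1,2) b(1)] by blast
  qed
  then show "c \<in> lt C R n \<Longrightarrow> \<exists>b\<in>lt B Q n. eqv C R n c (g n b)" by blast
qed

end

lemma acy_trivial:
  assumes "smodule V P" "\<And>n. elts V n \<subseteq> P n"
  shows "acy V P"
  using assms
proof (coinduction arbitrary: V P)
  case acy
  then interpret smodule V P by simp
  have "\<And>n. kvan V P n" using acy(2) by (auto simp: kvan_def)
  moreover have "\<And>n. elts (sh V) n \<subseteq> dP V P n" using acy(2) P_dP by auto
  ultimately show ?case using D by (intro exI conjI allI disjI1) (rule refl | assumption | blast)+
qed

text \<open>An isomorphism is a surjection with zero kernel, so invariance is an instance of two out
  of three.\<close>

lemma (in ssurj) acy_iso:
  assumes "\<And>n b. b \<in> elts B n \<Longrightarrow> g n b \<in> R n \<Longrightarrow> b \<in> Q n"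
  shows "acy B Q \<longleftrightarrow> acy C R"
proof -
  have "acy (frestrict B (pre B g R)) Q"
    by (rule acy_trivial[OF ses.axioms(1)[OF ker_ses]]) (use assms in \<open>auto simp: pre_def\<close>)
  then show ?thesis using acy_mid[OF ker_ses] acy_right[OF ker_ses] by blast
qed

text \<open>Injectivity of \<open>H_0(A) \<rightarrow> H_0(B)\<close> in degree \<open>n\<close> when \<open>B / A\<close> is derivative acyclic: \<open>H_0\<close> in
  degree \<open>n\<close> is the degree 0 part of the \<open>n\<close>-th derivative, and derivatives preserve exactness here.\<close>
lemma acy_H0_inj:
  assumes "ses A P B Q C R f g" "acy C R" "a \<in> elts A n" "f n a \<in> lt B Q n"
  shows "a \<in> lt A P n"
  using assms
proof (induction n arbitrary: A P B Q C R f g)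
  case 0
  then interpret ses A P B Q C R f g by simp
  show ?case using 0 inj A.lt_0 B.lt_0 by simp
next
  case (Suc n)
  then interpret ses A P B Q C R f g by simp
  have "a \<in> lt (sh A) (dP A P) n"
    using Suc.prems B.lt_D by (intro Suc.IH[OF D_ses]) (auto dest: acyD)
  then show ?case using A.lt_D by simp
qed

section \<open>The two short exact sequences cut out of a right exact derived sequence\<close>

context ses
begin

lemma is_ssurj: "ssurj B Q C R g"
  by unfold_locales (use g gQ surj in auto)

lemma D_ssurj: "ssurj (sh B) (dP B Q) (sh C) (dP C R) (\<lambda>n. g (Suc n))"
proof (intro ssurj.intro ssurj_axioms.intro)
  show "smodule (sh B) (dP B Q)" "smodule (sh C) (dP C R)" by (rule B.D, rule C.D)
  show "fhom (sh B) (sh C) (\<lambda>n. g (Suc n))" by (rule g_D)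
qed (unfold sh_simps, (rule g_dP, assumption), (rule D_surj, assumption))

text \<open>As \<open>D\<close> is right exact, this is also the image of \<open>D A \<rightarrow> D B\<close>.\<close>
abbreviation "I \<equiv> frestrict (sh B) (pre (sh B) (\<lambda>n. g (Suc n)) (dP C R))"

lemma I_ses: "ses I (dP B Q) (sh B) (dP B Q) (sh C) (dP C R) (\<lambda>n x. x) (\<lambda>n. g (Suc n))"
  by (rule ssurj.ker_ses[OF D_ssurj])

lemma I_iff: "b \<in> elts I n \<longleftrightarrow> b \<in> elts B (Suc n) \<and> g (Suc n) b \<in> dP C R n"
  by (simp add: pre_def)

lemma I_cg: "cg (deg I n) S x y \<longleftrightarrow> x \<in> elts I n \<and> y \<in> elts I n \<and> cg (deg B (Suc n)) S x y"
  by (subst cg_restrict) (auto simp: pre_def)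

lemma f_I: "a \<in> elts A (Suc n) \<Longrightarrow> f (Suc n) a \<in> elts I n"
  unfolding I_iff using C.P_dP by auto

lemma I_ssurj: "ssurj (sh A) (dP A P) I (dP B Q) (\<lambda>n. f (Suc n))"
proof (intro ssurj.intro ssurj_axioms.intro)
  show "smodule (sh A) (dP A P)" "smodule I (dP B Q)"
    by (rule A.D, rule ses.axioms(1)[OF I_ses])
  have "lin (deg A (Suc n)) (deg I n) (f (Suc n))" for n
    using f_I f_lin[of "Suc n"] unfolding lin_def by auto
  then show "fhom (sh A) I (\<lambda>n. f (Suc n))" using f_fac by (simp add: fhom_def)
next
  fix n c assume c: "c \<in> elts I n"
  then obtain a where "a \<in> elts A (Suc n)" "cg (deg B (Suc n)) (dP B Q n) c (f (Suc n) a)"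
    using g_dP_iff unfolding I_iff by blast
  then show "\<exists>a\<in>elts (sh A) n. eqv I (dP B Q) n c (f (Suc n) a)"
    using I_cg c f_I by auto
qed (use f_dP in auto)

text \<open>The kernel of DA -> DB, taken as the kernel of DA -> I. By the connecting map it embeds
  into K C.\<close>

abbreviation "T \<equiv> frestrict (sh A) (pre (sh A) (\<lambda>n. f (Suc n)) (dP B Q))"

lemma T_ses: "ses T (dP A P) (sh A) (dP A P) I (dP B Q) (\<lambda>n x. x) (\<lambda>n. f (Suc n))"
  by (rule ssurj.ker_ses[OF I_ssurj])

lemma T_iff: "a \<in> elts T n \<longleftrightarrow> a \<in> elts A (Suc n) \<and> f (Suc n) a \<in> dP B Q n"
  by (simp add: pre_def)

text \<open>By \<open>conn_zero\<close> all proper injections act on T by zero, so H_0(T) =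
  T.\<close>

lemma T_lt: "a \<in> lt T (dP A P) n \<Longrightarrow> a \<in> dP A P n"
proof -
  interpret T: smodule T "dP A P" by (rule ses.axioms(1)[OF T_ses])
  have "lt T (dP A P) n \<subseteq> dP A P n"
    by (rule T.lt_min[OF T.ks order_refl]) (use conn_zero T_iff in auto)
  then show "a \<in> lt T (dP A P) n \<Longrightarrow> a \<in> dP A P n" by blast
qed

text \<open>The connecting map is injective on T, so T vanishes in every degree where K C
  does.\<close>

lemma T_bound:
  assumes "kvan C R n" "a \<in> elts T n"
  shows "a \<in> dP A P n"
proof -
  have a: "a \<in> elts A (Suc n)" "f (Suc n) a \<in> dP B Q n" using assms(2) unfolding T_iff by auto
  then obtain b where b: "b \<in> elts B n" "eqv B Q (Suc n) (f (Suc n) a) (inc B n b)"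
    unfolding B.dP_iff by blast
  show ?thesis using conn_P[OF a(1) b] conn_K[OF a(1) b] kvanD[OF assms(1)] b(1) by simp
qed

end

subsection \<open>Eventually derivative acyclic modules\<close>

text \<open>In terms of derivatives: \<open>D^a V\<close> is derivative acyclic for some \<open>a\<close>; for \<open>bev\<close>, moreover
  \<open>K D^j V\<close> is bounded for every \<open>j\<close>.\<close>

inductive ev :: "('k::comm_ring_1, 'g::group_add, 'a) fimod \<Rightarrow> (nat \<Rightarrow> 'a set) \<Rightarrow> bool" where
  ev_acy: "acy V P \<Longrightarrow> ev V P"
| ev_D: "ev (sh V) (dP V P) \<Longrightarrow> ev V P"

inductive bev :: "('k::comm_ring_1, 'g::group_add, 'a) fimod \<Rightarrow> (nat \<Rightarrow> 'a set) \<Rightarrow> bool" where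
  bev_acy: "acy V P \<Longrightarrow> bev V P"
| bev_D: "(\<And>n. n \<ge> N \<Longrightarrow> kvan V P n) \<Longrightarrow> bev (sh V) (dP V P) \<Longrightarrow> bev V P"

lemma bev_ev: "bev V P \<Longrightarrow> ev V P"
  by (induction rule: bev.induct) (auto intro: ev.intros)

lemma bevD:
  assumes "bev V P"
  shows "bev (sh V) (dP V P)" "\<exists>N. \<forall>n\<ge>N. kvan V P n"
proof -
  have "bev (sh V) (dP V P) \<and> (\<exists>N. \<forall>n\<ge>N. kvan V P n)"
    using assms
  proof cases
    case bev_acy
    then show ?thesis using acyD[OF bev_acy] bev.bev_acy by blast
  next
    case (bev_D N)
    then show ?thesis by blast
  qed
  then show "bev (sh V) (dP V P)" "\<exists>N. \<forall>n\<ge>N. kvan V P n" by blast+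
qed

text \<open>The injectivity hypothesis is H_1(V) = 0, as X is acyclic. It is inherited by 0 -> I ->
  DX -> DV -> 0, so the induction gives that DV, and with it I, is acyclic. What remains is K V = 0,
  that is T = 0, and acyclicity of I makes H_0(T) -> H_0(DZ) injective.\<close>

lemma acy_if_H0_inj:
  fixes Z X :: "('k::comm_ring_1, 'g::group_add, 'b) fimod"
  assumes "ev V R" "ses Z P X Q V R f g" "acy X Q"
    and "\<And>n z. z \<in> elts Z n \<Longrightarrow> f n z \<in> lt X Q n \<Longrightarrow> z \<in> lt Z P n"
  shows "acy V R"
  using assms
proof (induction arbitrary: Z P X Q f g rule: ev.induct)
  case (ev_D V R)
  then interpret ses Z P X Q V R f g by simp
  interpret I: ses I "dP X Q" "sh X" "dP X Q" "sh V" "dP V R" "\<lambda>n x. x" "\<lambda>n. g (Suc n)" by (rule I_ses)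
  interpret IS: ssurj "sh Z" "dP Z P" I "dP X Q" "\<lambda>n. f (Suc n)" by (rule I_ssurj)
  \<comment> \<open>Injectivity of H_0(I) -> H_0(DX): lift the element along DZ -> I and use the
    hypothesis on Z one degree higher, where \<open>lt_D\<close> identifies the two groups
    H_0.\<close>
  have hv: "x \<in> lt I (dP X Q) n" if x: "x \<in> elts I n" "x \<in> lt (sh X) (dP X Q) n" for n x
  proof -
    obtain a where a: "a \<in> elts (sh Z) n" "eqv I (dP X Q) n x (f (Suc n) a)"
      using IS.surj[OF x(1)] by blast
    then have "eqv (sh X) (dP X Q) n x (f (Suc n) a)" unfolding I_cg by simp
    then have "f (Suc n) a \<in> lt X Q (Suc n)" using I.B.lt_cg x(2) B.lt_D by metis
    then have "a \<in> lt (sh Z) (dP Z P) n" using ev_D.prems(3) a(1) A.lt_D by simp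
    then have "f (Suc n) a \<in> lt I (dP X Q) n" by (rule IS.g_lt)
    then show ?thesis using I.A.lt_cg[OF a(2)] by simp
  qed
  have D: "acy (sh V) (dP V R)"
    using ev_D.IH[OF I_ses acyD(2)[OF ev_D.prems(2)]] hv by blast
  have I: "acy I (dP X Q)" by (rule acy_left[OF I_ses acyD(2)[OF ev_D.prems(2)] D])
  have "kvan V R n" for n
  proof (rule conn_kvan[OF acyD(1)[OF ev_D.prems(2)]])
    fix a assume a: "a \<in> elts Z (Suc n)" "f (Suc n) a \<in> dP X Q n"
    then have "f (Suc n) a \<in> lt X Q (Suc n)" using I.B.lt_P B.lt_D by metis
    then have "a \<in> lt (sh Z) (dP Z P) n" using ev_D.prems(3) a(1) A.lt_D by simp
    \<comment> \<open>The class of a in H_0(DZ) is zero because its image in DX is; so a is zero in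
      H_0(T) = T.\<close>
    then show "a \<in> dP Z P n" using acy_H0_inj[OF T_ses I] T_lt a unfolding T_iff by blast
  qed
  then show ?case using D by (rule acy.intros)
qed

definition bnd :: "nat \<Rightarrow> ('k, 'g::group_add, 'a) fimod \<Rightarrow> (nat \<Rightarrow> 'a set) \<Rightarrow> bool" where
  "bnd N V P \<longleftrightarrow> (\<forall>n\<ge>N. elts V n \<subseteq> P n)"

context ses
begin

text \<open>I is a quotient of DA, whose degree n is built from degree n + 1 of A; this lowers the
  bound by one.\<close>

lemma I_bnd:
  assumes "bnd N A P"
  shows "bnd (N - 1) I (dP B Q)"
  unfolding bnd_def
proof (intro allI impI subsetI)
  interpret IS: ssurj "sh A" "dP A P" I "dP B Q" "\<lambda>n. f (Suc n)" by (rule I_ssurj)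
  fix n b assume n: "N - 1 \<le> n" and b: "b \<in> elts I n"
  then obtain a where a: "a \<in> elts A (Suc n)" "eqv I (dP B Q) n b (f (Suc n) a)"
    using IS.surj[OF b] by auto
  have "N \<le> Suc n" using n by simp
  then have "a \<in> dP A P n" using assms a(1) by (intro A.P_dP) (auto simp: bnd_def)
  then have "f (Suc n) a \<in> dP B Q n" by (rule f_dP)
  then show "b \<in> dP B Q n" using IS.C.c_mem[OF a(2)] by simp
qed

lemma kvan_mid_bnd:
  assumes "bnd N A P" "\<exists>M. \<forall>n\<ge>M. kvan C R n"
  shows "\<exists>M. \<forall>n\<ge>M. kvan B Q n"
proof -
  obtain M where M: "\<And>n. n \<ge> M \<Longrightarrow> kvan C R n" using assms(2) by blast
  have "kvan A P n" if "n \<ge> N" for n using assms(1) that by (auto simp: bnd_def kvan_def)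
  then have "\<forall>n\<ge>max M N. kvan B Q n" using kvan_mid M by simp
  then show ?thesis by blast
qed

end

text \<open>At N = 0 the bound cannot drop any further, since the subtraction in
  \<open>I_bnd\<close> is truncated. This case is therefore an induction on \<open>bev\<close> for
  the right term.\<close>

lemma bev_mid_0:
  fixes A B :: "('k::comm_ring_1, 'g::group_add, 'b) fimod"
  assumes "bev C R" "ses A P B Q C R f g" "bnd 0 A P"
  shows "bev B Q"
  using assms
proof (induction arbitrary: A P B Q f g rule: bev.induct)
  case (bev_acy C R)
  then interpret ses A P B Q C R f g by simp
  have "acy A P" by (rule acy_trivial[OF A.smodule_axioms]) (use bev_acy in \<open>auto simp: bnd_def\<close>)
  then show ?case using acy_mid bev_acy bev.bev_acy by blast
next
  case (bev_D N C R)
  then interpret ses A P B Q C R f g by simp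
  have "bev (sh B) (dP B Q)" using bev_D.IH[OF I_ses] I_bnd[OF bev_D.prems(2)] by simp
  then show ?case using kvan_mid_bnd[OF bev_D.prems(2)] bev_D.hyps(1) bev.bev_D by metis
qed

text \<open>D need not preserve the sequence, but passing to I in place of DA lowers the bound on
  the left term, until that term is zero.\<close>

lemma bev_mid:
  fixes A B :: "('k::comm_ring_1, 'g::group_add, 'b) fimod"
  assumes "bev C R" "ses A P B Q C R f g" "bnd N A P"
  shows "bev B Q"
  using assms
proof (induction N arbitrary: A P B Q C R f g)
  case 0 then show ?case using bev_mid_0 by blast
next
  case (Suc N)
  then interpret ses A P B Q C R f g by simp
  have "bnd N I (dP B Q)" using I_bnd[OF Suc.prems(3)] by simp
  then have "bev (sh B) (dP B Q)" by (rule Suc.IH[OF bevD(1)[OF Suc.prems(1)] I_ses])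
  then show ?case using kvan_mid_bnd[OF Suc.prems(3)] bevD(2)[OF Suc.prems(1)] bev.bev_D by metis
qed

text \<open>By induction I is of the required kind, and T is bounded because K V is. Hence DZ is an
  extension of I by a bounded module, and \<open>bev_mid\<close> applies; K Z = 0 since Z embeds
  into F.\<close>

lemma bev_left:
  fixes Z F :: "('k::comm_ring_1, 'g::group_add, 'b) fimod"
  assumes "bev V R" "ses Z P F Q V R f g" "acy F Q"
  shows "bev Z P"
  using assms
proof (induction arbitrary: Z P F Q f g rule: bev.induct)
  case (bev_acy V R)
  then show ?case using acy_left bev.bev_acy by blast
next
  case (bev_D N V R)
  then interpret ses Z P F Q V R f g by simp
  have "bev I (dP F Q)" by (rule bev_D.IH[OF I_ses acyD(2)[OF bev_D.prems(2)]])
  moreover have "bnd N T (dP Z P)" using T_bound bev_D.hyps(1) unfolding bnd_def by blast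
  ultimately have "bev (sh Z) (dP Z P)" using bev_mid[OF _ T_ses] by blast
  then show ?case using kvan_left acyD(1)[OF bev_D.prems(2)] bev.bev_D by blast
qed

text \<open>Asymptotic version of \<open>acy_H0_inj\<close>. In large degrees T vanishes, so DA -> I
  is injective there, and the induction hypothesis treats I -> DB.\<close>

lemma bev_H0_inj:
  fixes A B :: "('k::comm_ring_1, 'g::group_add, 'b) fimod"
  assumes "bev C R" "ses A P B Q C R f g"
  shows "\<exists>N. \<forall>n\<ge>N. \<forall>a\<in>elts A n. f n a \<in> lt B Q n \<longrightarrow> a \<in> lt A P n"
  using assms
proof (induction arbitrary: A P B Q f g rule: bev.induct)
  case (bev_acy C R)
  then show ?case using acy_H0_inj[OF bev_acy(2,1)] by blast
next
  case (bev_D M C R)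
  then interpret ses A P B Q C R f g by simp
  interpret I: ses I "dP B Q" "sh B" "dP B Q" "sh C" "dP C R" "\<lambda>n x. x" "\<lambda>n. g (Suc n)" by (rule I_ses)
  interpret IS: ssurj "sh A" "dP A P" I "dP B Q" "\<lambda>n. f (Suc n)" by (rule I_ssurj)
  obtain N where N: "n \<ge> N \<Longrightarrow> a \<in> elts I n \<Longrightarrow> a \<in> lt (sh B) (dP B Q) n \<Longrightarrow> a \<in> lt I (dP B Q) n" for n a
    using bev_D.IH[OF I_ses] by blast
  have "a \<in> lt A P (Suc n)" if n: "n \<ge> max N M" and a: "a \<in> elts A (Suc n)" "f (Suc n) a \<in> lt B Q (Suc n)" for n a
  proof -
    have "f (Suc n) a \<in> lt I (dP B Q) n" using N f_I a n B.lt_D by simp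
    then obtain a' where a': "a' \<in> lt (sh A) (dP A P) n" "eqv I (dP B Q) n (f (Suc n) a) (f (Suc n) a')"
      using IS.lt_lift by blast
    have c: "a' \<in> elts (sh A) n" using IS.B.lt_carr[OF a'(1)] .
    \<comment> \<open>The difference of a and a' lies in T, which is zero in degree n because K C
      is.\<close>
    have "eqv (sh A) (dP A P) n a a'"
    proof (rule lin_cg_reflect[OF IS.B.km I.A.km IS.B.ks I.A.ks IS.g_lin _ c a'(2)])
      show "a \<in> elts (sh A) n" using a by simp
      fix x assume "x \<in> elts (sh A) n" "f (Suc n) x \<in> dP B Q n"
      then have "x \<in> elts T n" unfolding T_iff by simp
      then show "x \<in> dP A P n" using T_bound bev_D.hyps(1) n by simp
    qed
    then show ?thesis using IS.B.lt_cg a'(1) A.lt_D by simp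
  qed
  then have "\<forall>n\<ge>Suc (max N M). \<forall>a\<in>elts A n. f n a \<in> lt B Q n \<longrightarrow> a \<in> lt A P n"
    by (metis Suc_le_D Suc_le_mono)
  then show ?case by blast
qed

text \<open>Generation in degree at most r, read off from H_0; in this form it passes to quotients
  and to derivatives.\<close>

definition gen_le :: "nat \<Rightarrow> ('k::comm_ring_1, 'g::group_add, 'a) fimod \<Rightarrow> (nat \<Rightarrow> 'a set) \<Rightarrow> bool" where
  "gen_le r V P \<longleftrightarrow> (\<forall>n>r. elts V n \<subseteq> lt V P n)"

text \<open>I is a quotient of DZ and so again generated in degree at most r; by induction DV
  satisfies \<open>bev\<close>, and so does I by \<open>bev_left\<close>. Then H_0(T) -> H_0(DZ) is
  injective in large degrees, where its target is zero. As H_0(T) = T, T vanishes in large degrees,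
  and with it K V.\<close>

lemma bev_if_presented:
  fixes Z M :: "('k::comm_ring_1, 'g::group_add, 'b) fimod"
  assumes "ev V R" "ses Z P M Q V R f g" "acy M Q" "gen_le r Z P"
  shows "bev V R"
  using assms
proof (induction arbitrary: Z P M Q f g rule: ev.induct)
  case (ev_acy V R)
  then show ?case using bev_acy by blast
next
  case (ev_D V R)
  then interpret ses Z P M Q V R f g by simp
  interpret IS: ssurj "sh Z" "dP Z P" I "dP M Q" "\<lambda>n. f (Suc n)" by (rule I_ssurj)
  interpret T: ses T "dP Z P" "sh Z" "dP Z P" I "dP M Q" "\<lambda>n x. x" "\<lambda>n. f (Suc n)" by (rule T_ses)
  have gD: "a \<in> lt (sh Z) (dP Z P) n" if "n > r" "a \<in> elts Z (Suc n)" for n a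
    using ev_D.prems(3) that A.lt_D unfolding gen_le_def by (metis less_SucI subsetD)
  have "gen_le r I (dP M Q)"
    unfolding gen_le_def
  proof (intro allI impI subsetI)
    fix n x assume n: "r < n" and x: "x \<in> elts I n"
    obtain a where a: "a \<in> elts (sh Z) n" "eqv I (dP M Q) n x (f (Suc n) a)"
      using IS.surj[OF x] by blast
    then show "x \<in> lt I (dP M Q) n" using IS.g_lt[OF gD[OF n]] IS.C.lt_cg[OF a(2)] by simp
  qed
  then have D: "bev (sh V) (dP V R)" by (rule ev_D.IH[OF I_ses acyD(2)[OF ev_D.prems(2)]])
  then have "bev I (dP M Q)" by (rule bev_left[OF _ I_ses acyD(2)[OF ev_D.prems(2)]])
  then obtain N where N: "n \<ge> N \<Longrightarrow> a \<in> elts T n \<Longrightarrow> a \<in> lt (sh Z) (dP Z P) n \<Longrightarrow> a \<in> lt T (dP Z P) n" for n a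
    using bev_H0_inj[OF _ T_ses] by blast
  have "kvan V R n" if n: "n \<ge> max N (Suc r)" for n
  proof (rule conn_kvan[OF acyD(1)[OF ev_D.prems(2)]])
    fix a assume "a \<in> elts Z (Suc n)" "f (Suc n) a \<in> dP M Q n"
    then show "a \<in> dP Z P n" using N gD n T_lt unfolding T_iff by (metis Suc_le_eq max.bounded_iff)
  qed
  then show ?case using D by (rule bev_D)
qed

text \<open>The bound is n \<ge> d instead of n > r, so that each derivative lowers d by one and d =
  0 means V / P = 0.\<close>

lemma ev_if_gen_ge:
  assumes "smodule V P" "\<And>n. n \<ge> d \<Longrightarrow> elts V n \<subseteq> lt V P n"
  shows "ev V P"
  using assms
proof (induction d arbitrary: V P)
  case 0
  then interpret smodule V P by simp
  have "elts V n \<subseteq> P n" for n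
  proof (induction n rule: less_induct)
    case (less n)
    have "lt V P n \<subseteq> P n" by (rule lt_min[OF ks order_refl]) (use less P_fac in blast)
    then show ?case using 0(2) by blast
  qed
  then show ?case using acy_trivial[OF smodule_axioms] ev_acy by blast
next
  case (Suc d)
  then interpret smodule V P by simp
  have "ev (sh V) (dP V P)" by (rule Suc.IH[OF D]) (use Suc.prems(2) lt_D in auto)
  then show ?case by (rule ev_D)
qed

lemma ev_if_gen_le: "smodule V P \<Longrightarrow> gen_le r V P \<Longrightarrow> ev V P"
  by (rule ev_if_gen_ge[of V P "Suc r"]) (auto simp: gen_le_def)

subsection \<open>Free modules and quotients\<close>

lemma freek_simps [simp]:
  "carr (freek X) = {c. finite {p. c p \<noteq> 0} \<and> {p. c p \<noteq> 0} \<subseteq> X}"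
  "zer (freek X) = (\<lambda>_. 0)" "pls (freek X) = (\<lambda>c c' p. c p + c' p)" "sml (freek X) = (\<lambda>a c p. a * c p)"
  by (simp_all add: freek_def)

lemma finite_supp_add: 
  fixes c c' :: "'x \<Rightarrow> 'k::comm_ring_1"
  assumes "finite {p. c p \<noteq> 0}" "finite {p. c' p \<noteq> 0}"
  shows "finite {p. c p + c' p \<noteq> 0}"
  by (rule finite_subset[of _ "{p. c p \<noteq> 0} \<union> {p. c' p \<noteq> 0}"]) (use assms in auto)

lemma finite_supp_mult: 
  fixes c :: "'x \<Rightarrow> 'k::comm_ring_1"
  assumes "finite {p. c p \<noteq> 0}"
  shows "finite {p. a * c p \<noteq> 0}"
  by (rule finite_subset[OF _ assms]) auto

lemma freek_kmod: "is_kmod (freek X :: ('k::comm_ring_1, 'x \<Rightarrow> 'k) kmod)"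
  unfolding is_kmod_def
proof (intro conjI allI ballI)
  fix x y :: "'x \<Rightarrow> 'k" assume "x \<in> carr (freek X)" "y \<in> carr (freek X)"
  moreover from this have "{p. x p + y p \<noteq> 0} \<subseteq> X" by (auto simp: subset_iff) (metis add_0)
  ultimately show "pls (freek X) x y \<in> carr (freek X)" using finite_supp_add[of x y] by simp
next
  fix a and x :: "'x \<Rightarrow> 'k" assume "x \<in> carr (freek X)"
  moreover from this have "{p. a * x p \<noteq> 0} \<subseteq> X" by (auto simp: subset_iff) (metis mult_zero_right)
  ultimately show "sml (freek X) a x \<in> carr (freek X)" using finite_supp_mult[of x] by simp
qed (auto simp: algebra_simps)

lemma ind_carr [simp]: "p \<in> X \<Longrightarrow> (ind p :: 'x \<Rightarrow> 'k::comm_ring_1) \<in> carr (freek X)"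
proof -
  assume "p \<in> X"
  moreover have "{q. (ind p q :: 'k) \<noteq> 0} \<subseteq> {p}" by (auto simp: ind_def)
  ultimately show ?thesis using finite_subset by fastforce
qed

lemma freek_span:
  assumes "ksub (freek X :: ('k::comm_ring_1, 'x \<Rightarrow> 'k) kmod) T" "\<And>p. p \<in> X \<Longrightarrow> ind p \<in> T"
    and "c \<in> carr (freek X)"
  shows "c \<in> T"
proof -
  have "\<forall>c. {p. c p \<noteq> 0} = S \<longrightarrow> c \<in> T" if "finite S" "S \<subseteq> X" for S
    using that
  proof (induction S)
    case empty
    have "(\<lambda>_. 0) \<in> T" using ksubD(2)[OF assms(1)] by simp
    then show ?case by (auto simp: fun_eq_iff[symmetric])
  next
    case (insert p S)
    show ?case
    proof (intro allI impI)
      fix c :: "'x \<Rightarrow> 'k" assume c: "{p. c p \<noteq> 0} = insert p S"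
      have "{q. (c(p := 0)) q \<noteq> 0} = S" using c insert.hyps(2) by auto
      then have "c(p := 0) \<in> T" using insert by blast
      moreover have "sml (freek X) (c p) (ind p) \<in> T"
        using ksubD(4)[OF assms(1)] assms(2) insert.prems by blast
      ultimately have "pls (freek X) (c(p := 0)) (sml (freek X) (c p) (ind p)) \<in> T"
        by (rule ksubD(3)[OF assms(1)])
      moreover have "pls (freek X) (c(p := 0)) (sml (freek X) (c p) (ind p)) = c"
        by (auto simp: ind_def fun_eq_iff)
      ultimately show "c \<in> T" by simp
    qed
  qed
  then show ?thesis using assms(3) by auto
qed

lemma lin_eq_free:
  assumes "is_kmod N" "lin (freek X :: ('k::comm_ring_1, 'x \<Rightarrow> 'k) kmod) N L" "lin (freek X) N L'"
    and "\<And>p. p \<in> X \<Longrightarrow> L (ind p) = L' (ind p)" "c \<in> carr (freek X)"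
  shows "L c = L' c"
proof -
  have "ksub (freek X) {c \<in> carr (freek X). L c = L' c}"
    unfolding ksub_def
    using lin_zer[OF freek_kmod assms(1,2)] lin_zer[OF freek_kmod assms(1,3)]
      linD(2,3)[OF assms(2)] linD(2,3)[OF assms(3)]
      km_pls[OF freek_kmod, of _ X] km_sml[OF freek_kmod, of _ X] km_zer[OF freek_kmod, of X]
    by (auto simp del: freek_simps)
  then show ?thesis using freek_span[of X "{c \<in> carr (freek X). L c = L' c}" c] assms(4,5) by (simp del: freek_simps)
qed

lemma freek_lift:
  assumes M: "is_kmod M" and u: "\<And>p. p \<in> X \<Longrightarrow> u p \<in> carr M"
  obtains L where "lin (freek X :: ('k::comm_ring_1, 'x \<Rightarrow> 'k) kmod) M L" "\<And>p. p \<in> X \<Longrightarrow> L (ind p) = u p"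
proof -
  \<comment> \<open>A module here has an explicit carrier, so the linear extension is a finite sum
    in its additive monoid, written as \<open>finprod\<close>.\<close>
  define G where "G = \<lparr>carrier = carr M, mult = pls M, one = zer M\<rparr>"
  interpret G: comm_monoid G
    by (rule comm_monoidI) (auto simp: G_def M km_assoc[OF M] intro: km_comm[OF M])
  have G: "carrier G = carr M" "mult G = pls M" "one G = zer M" by (simp_all add: G_def)
  define t where "t = (\<lambda>(c :: 'x \<Rightarrow> 'k) p. sml M (c p) (u p))"
  define L where "L = (\<lambda>c. finprod G (t c) {p. c p \<noteq> 0})"
  have tin: "t c \<in> A \<rightarrow> carrier G" if "A \<subseteq> X" for c A
    using that u M by (auto simp: t_def G)
  have L: "L c = finprod G (t c) A" if "finite A" "{p. c p \<noteq> 0} \<subseteq> A" "A \<subseteq> X" for c A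
    unfolding L_def
  proof (rule G.finprod_mono_neutral_cong_left[OF that(1,2)])
    show "\<And>i. i \<in> A - {p. c p \<noteq> 0} \<Longrightarrow> t c i = \<one>\<^bsub>G\<^esub>" using u that(3) M by (auto simp: t_def G)
  qed (use tin[OF that(3)] in auto)
  have "lin (freek X) M L"
    unfolding lin_def
  proof (intro conjI ballI allI)
    show "L ` carr (freek X) \<subseteq> carr M"
      using G.finprod_closed[OF tin] by (auto simp: L_def G)
  next
    fix x y :: "'x \<Rightarrow> 'k" assume x: "x \<in> carr (freek X)" and y: "y \<in> carr (freek X)"
    let ?A = "{p. x p \<noteq> 0} \<union> {p. y p \<noteq> 0}"
    have A: "finite ?A" "?A \<subseteq> X" using x y by auto
    have "L (pls (freek X) x y) = finprod G (t (pls (freek X) x y)) ?A" by (rule L[OF A(1) _ A(2)]) auto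
    also have "\<dots> = finprod G (\<lambda>p. mult G (t x p) (t y p)) ?A"
      using A(2) u tin[OF A(2)] M by (intro G.finprod_cong') (auto simp: t_def G km_sml_add[OF M])
    also have "\<dots> = pls M (finprod G (t x) ?A) (finprod G (t y) ?A)"
      using G.finprod_multf[OF tin[OF A(2)] tin[OF A(2)]] by (simp add: G)
    also have "\<dots> = pls M (L x) (L y)" using L[OF A(1) _ A(2), of x] L[OF A(1) _ A(2), of y] by simp
    finally show "L (pls (freek X) x y) = pls M (L x) (L y)" .
  next
    fix a and x :: "'x \<Rightarrow> 'k" assume x: "x \<in> carr (freek X)"
    let ?A = "{p. x p \<noteq> 0}"
    have A: "finite ?A" "?A \<subseteq> X" using x by auto
    have "finprod G (t (sml (freek X) a x)) B = sml M a (finprod G (t x) B)" if "finite B" "B \<subseteq> X" for B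
      using that
    proof (induction B)
      case empty then show ?case using M by (simp add: G)
    next
      case (insert p B)
      have "t c p \<in> carrier G" for c using tin[of "{p}" c] insert.prems by auto
      moreover have "t c \<in> B \<rightarrow> carrier G" for c using tin insert.prems by auto
      ultimately show ?case
        using insert M u G.finprod_closed[of "t x" B]
        by (simp add: G km_sml_pls[OF M]) (simp add: t_def km_sml_sml[OF M])
    qed
    moreover have "L (sml (freek X) a x) = finprod G (t (sml (freek X) a x)) ?A" by (rule L[OF A(1) _ A(2)]) auto
    ultimately show "L (sml (freek X) a x) = sml M a (L x)" using A by (simp add: L_def)
  qed
  moreover have "L (ind p) = u p" if "p \<in> X" for p
  proof -
    have "L (ind p) = finprod G (t (ind p)) {p}" by (rule L) (use that in \<open>auto simp: ind_def\<close>)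
    also have "\<dots> = u p" using that u tin[of "{p}" "ind p"] M by (auto simp: t_def G ind_def)
    finally show ?thesis .
  qed
  ultimately show ?thesis by (rule that)
qed

section \<open>Cosets, quotients and transport of the module axioms\<close>

context
  fixes M :: "('k::comm_ring_1, 'a) kmod" and S :: "'a set"
  assumes M: "is_kmod M" and S: "ksub M S"
begin

lemma kcoset_eq: "x \<in> carr M \<Longrightarrow> kcoset M S x = {y. cg M S y x}"
  using ksubD(1)[OF S] by (auto simp: kcoset_def cg_def M)

lemma kcoset_eq_iff: "x \<in> carr M \<Longrightarrow> y \<in> carr M \<Longrightarrow> kcoset M S x = kcoset M S y \<longleftrightarrow> cg M S x y"
proof
  assume "x \<in> carr M" "y \<in> carr M" "kcoset M S x = kcoset M S y"
  then show "cg M S x y" using cg_refl[OF M S, of x] by (simp add: kcoset_eq set_eq_iff)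
next
  assume "x \<in> carr M" "y \<in> carr M" "cg M S x y"
  then show "kcoset M S x = kcoset M S y"
    using cg_sym[OF M S \<open>cg M S x y\<close>] cg_trans[OF M S] unfolding kcoset_eq[OF \<open>x \<in> carr M\<close>] kcoset_eq[OF \<open>y \<in> carr M\<close>]
    by blast
qed

text \<open>Makes the choices by \<open>SOME\<close> in \<open>kquot\<close>, \<open>fquot\<close>
  and \<open>MW\<close> harmless: the chosen representative is congruent to any given one.\<close>

lemma kcoset_some: "x \<in> carr M \<Longrightarrow> cg M S (SOME y. y \<in> kcoset M S x) x"
  using someI[of "\<lambda>y. y \<in> kcoset M S x" x] cg_refl[OF M S, of x] by (simp add: kcoset_eq)

lemma kquot_pls: "x \<in> carr M \<Longrightarrow> y \<in> carr M \<Longrightarrow>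
    pls (kquot M S) (kcoset M S x) (kcoset M S y) = kcoset M S (pls M x y)"
  using cg_pls[OF M S kcoset_some kcoset_some, of x y] km_pls[OF M]
  by (simp add: kquot_def kcoset_eq_iff cg_carr)

lemma kquot_sml: "x \<in> carr M \<Longrightarrow> sml (kquot M S) a (kcoset M S x) = kcoset M S (sml M a x)"
  using cg_sml[OF M S kcoset_some, of x a] km_sml[OF M]
  by (simp add: kquot_def kcoset_eq_iff cg_carr)

lemma kquot_carr: "carr (kquot M S) = kcoset M S ` carr M" and kquot_zer: "zer (kquot M S) = kcoset M S (zer M)"
  by (simp_all add: kquot_def)

lemma kcoset_zer_iff: "x \<in> carr M \<Longrightarrow> kcoset M S x = zer (kquot M S) \<longleftrightarrow> x \<in> S"
  using cg_zer[OF M S, of x] km_zer[OF M] by (auto simp: kquot_zer kcoset_eq_iff)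

end

text \<open>All axioms are equations, hence pass to the image of maps that commute with the
  operations. For \<open>fquot\<close> and \<open>MW\<close>, whose operations choose
  representatives, only compatibility with the coset maps has to be checked.\<close>

lemma fimod_image:
  assumes B: "is_fimod B" and carr: "\<And>n. elts C n = h n ` elts B n"
    and zer: "\<And>n. zer (deg C n) = h n (zer (deg B n))"
    and pls: "\<And>n x y. x \<in> elts B n \<Longrightarrow> y \<in> elts B n \<Longrightarrow> pls (deg C n) (h n x) (h n y) = h n (pls (deg B n) x y)"
    and sml: "\<And>n a x. x \<in> elts B n \<Longrightarrow> sml (deg C n) a (h n x) = h n (sml (deg B n) a x)"
    and fac: "\<And>n m phi x. phi \<in> Hom n m \<Longrightarrow> x \<in> elts B n \<Longrightarrow> fac C n m phi (h n x) = h m (fac B n m phi x)"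
  shows "is_fimod C" "fhom B C h"
proof -
  note K = fimodD(1)[OF B]
  have "is_kmod (deg C n)" for n
    unfolding is_kmod_def carr zer ball_simps
    by (intro conjI ballI allI)
      (simp_all add: pls sml K km_ac[OF K] km_sml_add[OF K] km_sml_pls[OF K] km_sml_sml[OF K])
  moreover have "lin (deg C n) (deg C m) (fac C n m phi)" if "phi \<in> Hom n m" for n m phi
    using fimodD(2)[OF B that] fimodD(1)[OF B] unfolding lin_def carr
    by (auto simp: pls sml fac that image_subset_iff)
  ultimately show "is_fimod C"
    using fimodD(3-5)[OF B] unfolding is_fimod_def carr by (simp add: fac)
  show "fhom B C h"
    unfolding fhom_def lin_def carr by (simp add: pls sml fac)
qed

context smodule
begin

lemma fquot_fimod: "is_fimod (fquot V P)" and fquot_fhom: "fhom V (fquot V P) (\<lambda>n. kcoset (deg V n) (P n))"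
proof -
  have "fac (fquot V P) n m phi (kcoset (deg V n) (P n) x) = kcoset (deg V m) (P m) (fac V n m phi x)"
    if "phi \<in> Hom n m" "x \<in> elts V n" for n m phi x
    using fac_cg[OF that(1) kcoset_some[OF km ks that(2)]] that
    by (simp add: fquot_def kcoset_eq_iff[OF km ks] cg_carr(1)[OF kcoset_some[OF km ks]])
  then show "is_fimod (fquot V P)" "fhom V (fquot V P) (\<lambda>n. kcoset (deg V n) (P n))"
    using kquot_pls[OF km ks] kquot_sml[OF km ks]
    by (auto intro!: fimod_image[OF fimod, where h="\<lambda>n. kcoset (deg V n) (P n)"] simp: fquot_def kquot_carr[OF km ks] kquot_zer[OF km ks])
qed

end

text \<open>The zero submodule; the pair \<open>(V, zr V)\<close> stands for V itself.\<close>

definition zr :: "('k, 'g::group_add, 'a) fimod \<Rightarrow> nat \<Rightarrow> 'a set" where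
  "zr V n = {zer (deg V n)}"

lemma zr_smodule: "is_fimod V \<Longrightarrow> smodule V (zr V)"
  by unfold_locales
    (auto simp: sub_fimod_def zr_def ksub_zer fimodD(1) lin_zer[OF fimodD(1) fimodD(1) fimodD(2)])

lemma cg_zr [simp]: "is_fimod V \<Longrightarrow> eqv V (zr V) n x y \<longleftrightarrow> x \<in> elts V n \<and> x = y"
  by (auto simp: cg_def zr_def km_zer_right[OF fimodD(1)])

lemma ssurj_zr:
  assumes "smodule B Q" "is_fimod C" "fhom B C g" "\<And>n. g n ` elts B n = elts C n"
    "\<And>n b. b \<in> Q n \<Longrightarrow> g n b = zer (deg C n)"
  shows "ssurj B Q C (zr C) g"
proof -
  interpret B: smodule B Q by fact
  interpret C: smodule C "zr C" by (rule zr_smodule) fact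
  have "\<exists>b\<in>elts B n. eqv C (zr C) n c (g n b)" if "c \<in> elts C n" for c n
    using that assms(4)[of n, symmetric] assms(2) by auto
  then show ?thesis
    by unfold_locales (use assms(3,5) in \<open>auto simp: zr_def\<close>)
qed

context smodule
begin

lemma fquot_ssurj: "ssurj V P (fquot V P) (zr (fquot V P)) (\<lambda>n. kcoset (deg V n) (P n))"
  by (rule ssurj_zr[OF smodule_axioms fquot_fimod fquot_fhom])
    (use kcoset_zer_iff[OF km ks] P_carr in \<open>auto simp: fquot_def kquot_carr[OF km ks]\<close>)

text \<open>Passage between a pair and the actual quotient, whose elements are cosets.\<close>

lemma fquot_acy: "acy (fquot V P) (zr (fquot V P)) \<longleftrightarrow> acy V P"
proof -
  interpret q: ssurj V P "fquot V P" "zr (fquot V P)" "\<lambda>n. kcoset (deg V n) (P n)" by (rule fquot_ssurj)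
  show ?thesis
    using q.acy_iso kcoset_zer_iff[OF km ks] by (simp add: zr_def fquot_def)
qed

end

lemma fiso_acy:
  assumes "is_fimod A" "is_fimod B" "fiso A B h"
  shows "acy A (zr A) \<longleftrightarrow> acy B (zr B)"
proof -
  have h: "fhom A B h" "\<And>n. bij_betw (h n) (elts A n) (elts B n)"
    using assms(3) by (auto simp: fiso_def)
  have z: "h n (zer (deg A n)) = zer (deg B n)" for n
    using lin_zer[OF fimodD(1)[OF assms(1)] fimodD(1)[OF assms(2)] fhomD(1)[OF h(1)]] .
  interpret ssurj A "zr A" B "zr B" h
    by (rule ssurj_zr[OF zr_smodule[OF assms(1)] assms(2) h(1)])
      (use h(2) z in \<open>auto simp: bij_betw_def zr_def\<close>)
  show ?thesis
  proof (rule acy_iso)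
    fix n b assume b: "b \<in> elts A n" "h n b \<in> zr B n"
    then have "h n b = h n (zer (deg A n))" using z by (simp add: zr_def)
    then show "b \<in> zr A n" using b(1) h(2)[of n] B.k_zer by (auto simp: bij_betw_def inj_on_def zr_def)
  qed
qed

subsection \<open>The modules \<open>freefi I d\<close>\<close>

abbreviation keys :: "'i set \<Rightarrow> ('i \<Rightarrow> nat) \<Rightarrow> nat \<Rightarrow> ('i \<times> ('g::group_add) fiarr) set" where
  "keys I d n \<equiv> Sigma I (\<lambda>i. Hom (d i) n)"

lemma freefi_simps [simp]:
  "deg (freefi I d) n = freek (keys I d n)" "fac (freefi I d) n m phi = push phi"
  by (simp_all add: freefi_def)

lemma freek_supp: "c \<in> carr (freek X) \<Longrightarrow> p \<notin> X \<Longrightarrow> c p = 0"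
  by auto

text \<open>By \<open>comp_inj\<close> the sum that defines \<open>push\<close> has at most one
  term.\<close>

lemma push_comp:
  fixes c :: "'i \<times> ('g::group_add) fiarr \<Rightarrow> 'k::comm_ring_1"
  assumes "c \<in> carr (freek (keys I d n))" "phi \<in> Hom n m" "psi \<in> Hom (d i) n"
  shows "push phi c (i, comp phi psi) = c (i, psi)"
proof -
  have "psi' = psi" if "c (i, psi') \<noteq> 0" "comp phi psi' = comp phi psi" for psi'
  proof -
    have "(i, psi') \<in> keys I d n" using that(1) freek_supp[OF assms(1)] by blast
    then show ?thesis using comp_inj[OF assms(2) _ assms(3) that(2)] by blast
  qed
  then have "{psi'. c (i, psi') \<noteq> 0 \<and> comp phi psi' = comp phi psi} = (if c (i, psi) = 0 then {} else {psi})"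
    by auto
  then show ?thesis by (simp add: push_def)
qed

lemma push_notin:
  fixes c :: "'i \<times> ('g::group_add) fiarr \<Rightarrow> 'k::comm_ring_1"
  assumes "c \<in> carr (freek (keys I d n))" "\<not> (i \<in> I \<and> (\<exists>psi\<in>Hom (d i) n. chi = comp phi psi))"
  shows "push phi c (i, chi) = 0"
proof -
  have "{psi'. c (i, psi') \<noteq> 0 \<and> comp phi psi' = chi} = {}"
    using assms(2) freek_supp[OF assms(1)] by blast
  then show ?thesis unfolding push_def prod.case by (simp only: sum.empty)
qed

text \<open>Which entry of c is read does not depend on c, in contrast to the index set in the
  definition of \<open>push\<close>; linearity can then be seen entry by entry.\<close>

lemma push_eval:
  fixes c :: "'i \<times> ('g::group_add) fiarr \<Rightarrow> 'k::comm_ring_1"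
  assumes "phi \<in> Hom n m" "c \<in> carr (freek (keys I d n))"
  shows "push phi c (i, chi) = (if i \<in> I \<and> (\<exists>psi\<in>Hom (d i) n. chi = comp phi psi)
     then c (i, SOME psi. psi \<in> Hom (d i) n \<and> chi = comp phi psi) else 0)"
proof (cases "i \<in> I \<and> (\<exists>psi\<in>Hom (d i) n. chi = comp phi psi)")
  case True
  then obtain psi where psi: "psi \<in> Hom (d i) n" "chi = comp phi psi" by blast
  then have "(SOME psi. psi \<in> Hom (d i) n \<and> chi = comp phi psi) = psi"
    using comp_inj[OF assms(1)] by (intro some_equality) blast+
  then show ?thesis using push_comp[OF assms(2,1) psi(1)] psi(2) unfolding if_P[OF True] by simp
next
  case False
  then show ?thesis using push_notin[OF assms(2) False] by (simp only: if_False)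
qed

lemma push_ind:
  assumes "phi \<in> Hom n m" "i \<in> I" "psi \<in> Hom (d i) n"
  shows "push phi (ind (i, psi) :: 'i \<times> ('g::group_add) fiarr \<Rightarrow> 'k::comm_ring_1) = ind (i, comp phi psi)"
proof
  fix p :: "'i \<times> 'g fiarr"
  obtain j chi where p: "p = (j, chi)" by (cases p)
  have c: "(ind (i, psi) :: 'i \<times> 'g fiarr \<Rightarrow> 'k) \<in> carr (freek (keys I d n))"
    using assms(2,3) by (intro ind_carr) auto
  show "push phi (ind (i, psi)) p = (ind (i, comp phi psi) p :: 'k)"
  proof (cases "j \<in> I \<and> (\<exists>psi'\<in>Hom (d j) n. chi = comp phi psi')")
    case True
    then obtain psi' where psi': "psi' \<in> Hom (d j) n" "chi = comp phi psi'" by blast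
    then show ?thesis
      unfolding p psi'(2) push_comp[OF c assms(1) psi'(1)] using assms(3) comp_inj[OF assms(1) psi'(1)]
      by (auto simp: ind_def)
  next
    case False
    then show ?thesis unfolding p push_notin[OF c False] using assms(2,3) by (auto simp: ind_def)
  qed
qed

lemma push_lin:
  assumes phi: "phi \<in> Hom n m"
  shows "lin (freek (keys I d n) :: ('k::comm_ring_1, 'i \<times> ('g::group_add) fiarr \<Rightarrow> 'k) kmod) (freek (keys I d m)) (push phi)"
  unfolding lin_def
proof (intro conjI ballI allI image_subsetI)
  let ?F = "\<lambda>n. freek (keys I d n) :: ('k, 'i \<times> 'g fiarr \<Rightarrow> 'k) kmod"
  {
    fix c assume c: "c \<in> carr (?F n)"
    have "p \<in> (\<lambda>(i, psi). (i, comp phi psi)) ` {p. c p \<noteq> 0} \<and> p \<in> keys I d m" if "push phi c p \<noteq> 0" for p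
    proof -
      obtain j chi where p: "p = (j, chi)" by (cases p)
      have "j \<in> I \<and> (\<exists>psi\<in>Hom (d j) n. chi = comp phi psi)" using that push_notin[OF c] p by blast
      then obtain psi where psi: "j \<in> I" "psi \<in> Hom (d j) n" "chi = comp phi psi" by blast
      then have "c (j, psi) \<noteq> 0" using that push_comp[OF c phi psi(2)] p by simp
      then show ?thesis using psi comp_Hom[OF psi(2) phi] p by force
    qed
    then have "{p. push phi c p \<noteq> 0} \<subseteq> (\<lambda>(i, psi). (i, comp phi psi)) ` {p. c p \<noteq> 0}"
      "{p. push phi c p \<noteq> 0} \<subseteq> keys I d m" by blast+
    then show "push phi c \<in> carr (?F m)" using c finite_subset[OF _ finite_imageI] by auto
  }
  {
    fix c c' assume c: "c \<in> carr (?F n)" "c' \<in> carr (?F n)"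
    have s: "pls (?F n) c c' \<in> carr (?F n)" using c km_pls[OF freek_kmod] by blast
    show "push phi (pls (?F n) c c') = pls (?F m) (push phi c) (push phi c')"
    proof
      fix p :: "'i \<times> 'g fiarr"
      obtain j chi where p: "p = (j, chi)" by (cases p)
      show "push phi (pls (?F n) c c') p = pls (?F m) (push phi c) (push phi c') p"
        unfolding p push_eval[OF phi s] by (auto simp: push_eval[OF phi c(1)] push_eval[OF phi c(2)])
    qed
  }
  {
    fix a c assume c: "c \<in> carr (?F n)"
    have s: "sml (?F n) a c \<in> carr (?F n)" using c km_sml[OF freek_kmod] by blast
    show "push phi (sml (?F n) a c) = sml (?F m) a (push phi c)"
    proof
      fix p :: "'i \<times> 'g fiarr"
      obtain j chi where p: "p = (j, chi)" by (cases p)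
      show "push phi (sml (?F n) a c) p = sml (?F m) a (push phi c) p"
        unfolding p push_eval[OF phi s] by (auto simp: push_eval[OF phi c])
    qed
  }
qed

lemma push_idm:
  fixes c :: "'i \<times> ('g::group_add) fiarr \<Rightarrow> 'k::comm_ring_1"
  assumes c: "c \<in> carr (freek (keys I d n))"
  shows "push (idm n) c = c"
proof
  fix p :: "'i \<times> 'g fiarr"
  obtain j chi where p: "p = (j, chi)" by (cases p)
  show "push (idm n) c p = c p"
  proof (cases "p \<in> keys I d n")
    case True
    then have chi: "j \<in> I" "chi \<in> Hom (d j) n" using p by auto
    show ?thesis using push_comp[OF c idm_Hom[OF order_refl] chi(2)] chi(2) p by simp
  next
    case False
    moreover have "\<not> (j \<in> I \<and> (\<exists>psi\<in>Hom (d j) n. chi = comp (idm n) psi))" using False p by auto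
    ultimately show ?thesis using push_notin[OF c, of j chi "idm n"] freek_supp[OF c, of p] p by (simp only: not_False_eq_True)
  qed
qed

lemma freefi_fimod: "is_fimod (freefi I d :: ('k::comm_ring_1, 'g::group_add, 'i \<times> 'g fiarr \<Rightarrow> 'k) fimod)"
proof -
  let ?F = "\<lambda>n. freek (keys I d n) :: ('k, 'i \<times> 'g fiarr \<Rightarrow> 'k) kmod"
  have "push psi (push phi c) = push (comp psi phi) c"
    if h: "phi \<in> Hom n m" "psi \<in> Hom m l" and c: "c \<in> carr (?F n)"
    for n m l c and phi psi :: "'g fiarr"
  proof (rule lin_eq_free[OF freek_kmod _ _ _ c])
    show "lin (?F n) (?F l) (\<lambda>c. push psi (push phi c))"
      by (rule lin_comp[OF push_lin[OF h(1)] push_lin[OF h(2)]])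
    show "lin (?F n) (?F l) (push (comp psi phi))" by (rule push_lin) (use h in simp)
    fix p :: "'i \<times> 'g fiarr" assume "p \<in> keys I d n"
    then obtain i chi where p: "p = (i, chi)" "i \<in> I" "chi \<in> Hom (d i) n" by blast
    show "push psi (push phi (ind p)) = push (comp psi phi) (ind p)"
      unfolding p(1) push_ind[where d=d, OF h(1) p(2,3)] push_ind[where d=d, OF h(2) p(2) comp_Hom[OF p(3) h(1)]]
        push_ind[where d=d, OF comp_Hom[OF h] p(2,3)] by (simp only: comp_assoc)
  qed
  then show ?thesis
    using freek_kmod push_lin push_idm unfolding is_fimod_def by (auto simp del: freek_simps)
qed

text \<open>Yoneda for sums of modules M(n): a map is determined by the images x i of the
  identities.\<close>

lemma freefi_hom:
  fixes V :: "('k::comm_ring_1, 'g::group_add, 'a) fimod" and I :: "'i set"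
  assumes V: "is_fimod V" and x: "\<And>i. i \<in> I \<Longrightarrow> x i \<in> elts V (d i)"
  obtains h where "fhom (freefi I d) V h"
    "\<And>n i phi. i \<in> I \<Longrightarrow> phi \<in> Hom (d i) n \<Longrightarrow> h n (ind (i, phi)) = fac V (d i) n phi (x i)"
proof -
  let ?F = "\<lambda>n. freek (keys I d n) :: ('k, 'i \<times> 'g fiarr \<Rightarrow> 'k) kmod"
  let ?u = "\<lambda>n (i, phi). fac V (d i) n phi (x i)"
  have "\<exists>L. lin (?F n) (deg V n) L \<and> (\<forall>p\<in>keys I d n. L (ind p) = ?u n p)" for n
  proof -
    have "?u n p \<in> elts V n" if "p \<in> keys I d n" for p
    proof -
      obtain i phi where "p = (i, phi)" "i \<in> I" "phi \<in> Hom (d i) n" using \<open>p \<in> keys I d n\<close> by blast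
      then show ?thesis using fimodD(3)[OF V _ x] by simp
    qed
    then obtain L where "lin (?F n) (deg V n) L" "\<And>p. p \<in> keys I d n \<Longrightarrow> L (ind p) = ?u n p"
      by (rule freek_lift[OF fimodD(1)[OF V]]) blast+
    then show ?thesis by blast
  qed
  then have "\<forall>n. \<exists>L. lin (?F n) (deg V n) L \<and> (\<forall>p\<in>keys I d n. L (ind p) = ?u n p)" ..
  from choice[OF this] obtain h where "\<forall>n. lin (?F n) (deg V n) (h n) \<and> (\<forall>p\<in>keys I d n. h n (ind p) = ?u n p)" ..
  then have h: "\<And>n. lin (?F n) (deg V n) (h n)" "\<And>n p. p \<in> keys I d n \<Longrightarrow> h n (ind p) = ?u n p"
    by blast+
  have "h m (push phi c) = fac V n m phi (h n c)"
    if phi: "phi \<in> Hom n m" and c: "c \<in> carr (?F n)" for n m c and phi :: "'g fiarr"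
  proof (rule lin_eq_free[OF fimodD(1)[OF V] _ _ _ c])
    show "lin (?F n) (deg V m) (\<lambda>c. h m (push phi c))" by (rule lin_comp[OF push_lin[OF phi] h(1)])
    show "lin (?F n) (deg V m) (\<lambda>c. fac V n m phi (h n c))" by (rule lin_comp[OF h(1) fimodD(2)[OF V phi]])
    fix p :: "'i \<times> 'g fiarr" assume "p \<in> keys I d n"
    then obtain i psi where p: "p = (i, psi)" "i \<in> I" "psi \<in> Hom (d i) n" by auto
    show "h m (push phi (ind p)) = fac V n m phi (h n (ind p))"
      unfolding p(1) push_ind[where d=d, OF phi p(2,3)]
      using h(2)[of "(i, psi)" n] h(2)[of "(i, comp phi psi)" m] p(2,3) phi fimodD(5)[OF V p(3) phi x[OF p(2)]] by simp
  qed
  then have "fhom (freefi I d) V h" using h(1) by (simp add: fhom_def del: freek_simps)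
  then show ?thesis by (rule that) (use h(2) in force)
qed

subsection \<open>A criterion for derivative acyclicity\<close>

text \<open>The operator \<open>p m T\<close> plays the role of the action of the partial identity of \<open>T \<inter> {1..m}\<close> in
  an FI#-module.\<close>
locale sharp = smodule V P for V :: "('k::comm_ring_1, 'g::group_add, 'a) fimod" and P +
  fixes p :: "nat \<Rightarrow> nat set \<Rightarrow> 'a \<Rightarrow> 'a"
  assumes p_lin: "lin (deg V m) (deg V m) (p m T)"
    and p_P: "x \<in> P m \<Longrightarrow> p m T x \<in> P m"
    and p_fac: "phi \<in> Hom n m \<Longrightarrow> x \<in> elts V n \<Longrightarrow> p m T (fac V n m phi x) = fac V n m phi (p n (fst phi -` T) x)"
    and p_cong: "x \<in> elts V m \<Longrightarrow> T \<inter> {1..m} = T' \<inter> {1..m} \<Longrightarrow> p m T x = p m T' x"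
    and p_id: "x \<in> elts V m \<Longrightarrow> {1..m} \<subseteq> T \<Longrightarrow> p m T x = x"
    and p_inc: "x \<in> elts V (Suc m) \<Longrightarrow> \<exists>z\<in>elts V m. eqv V P (Suc m) (p (Suc m) {1..m} x) (inc V m z)"
    and kvan: "kvan V P m"
begin

lemma p_in [simp]: "x \<in> elts V m \<Longrightarrow> p m T x \<in> elts V m"
  using linD(1)[OF p_lin] .

lemma p_cg: "eqv V P m x y \<Longrightarrow> eqv V P m (p m T x) (p m T y)"
  by (rule lin_cg[OF p_lin _ p_P ks])

lemma inc_vimage: "T \<inter> {1..m} = (fst (idm m :: 'g fiarr) -` T) \<inter> {1..m}"
  by (auto simp: idm_def)

lemma p_fac_inc: "x \<in> elts V m \<Longrightarrow> p (Suc m) T (inc V m x) = inc V m (p m T x)"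
  using p_fac[of "idm m" m "Suc m" x T] p_cong[of x m T "fst (idm m :: 'g fiarr) -` T"] inc_vimage[of T m] by simp

abbreviation (input) "tau m \<equiv> (swap_top m :: 'g fiarr)"

lemma tau_tau [simp]: "x \<in> elts V (Suc (Suc m)) \<Longrightarrow>
    fac V (Suc (Suc m)) (Suc (Suc m)) (tau m) (fac V (Suc (Suc m)) (Suc (Suc m)) (tau m) x) = x"
  using fac_comp[of "tau m" "Suc (Suc m)" "Suc (Suc m)" "tau m" "Suc (Suc m)" x] by simp

lemma tau_inc: "x \<in> elts V (Suc m) \<Longrightarrow>
    fac V (Suc (Suc m)) (Suc (Suc m)) (tau m) (inc V (Suc m) x) = fac V (Suc m) (Suc (Suc m)) (up m (Suc m) (idm m)) x"
  using fac_comp[of "idm (Suc m)" "Suc m" "Suc (Suc m)" "tau m" "Suc (Suc m)" x] by (simp add: swap_top_inc)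

lemma tau_vimage: "(fst (tau m) -` (insert (Suc (Suc m)) {1..m})) \<inter> {1..Suc (Suc m)} = {1..Suc m} \<inter> {1..Suc (Suc m)}"
  by (auto simp: swap_top_def idm_def split: if_splits)

lemma up_vimage:
  assumes "phi \<in> Hom n m"
  shows "(fst (up n m phi) -` (insert (Suc m) T)) \<inter> {1..Suc n} = insert (Suc n) (fst phi -` T) \<inter> {1..Suc n}"
proof (rule Set.set_eqI)
  fix x have "fst phi x \<noteq> Suc m" using Hom_le[OF assms, of x] by auto
  then show "x \<in> (fst (up n m phi) -` (insert (Suc m) T)) \<inter> {1..Suc n} \<longleftrightarrow> x \<in> insert (Suc n) (fst phi -` T) \<inter> {1..Suc n}"
    by (auto simp: up_def)
qed

lemma eq_arg_trans: "a = f b \<Longrightarrow> b = c \<Longrightarrow> a = f c"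
  by (rule subst)

text \<open>The operators of the derivative always keep the added point, hence
  \<open>insert (Suc m) T\<close>. Its standard inclusion omits a different point than that of V,
  and \<open>swap_top\<close> mediates in the last two axioms.\<close>

lemma sharp_D: "sharp (sh V) (dP V P) (\<lambda>m T. p (Suc m) (insert (Suc m) T))"
proof (intro sharp.intro sharp_axioms.intro)
  show "smodule (sh V) (dP V P)" by (rule D)
next
  fix m T show "lin (deg (sh V) m) (deg (sh V) m) (p (Suc m) (insert (Suc m) T))" using p_lin by simp
next
  fix x m T assume "x \<in> dP V P m"
  then obtain y where y: "y \<in> elts V m" "eqv V P (Suc m) x (inc V m y)" unfolding dP_iff by blast
  show "p (Suc m) (insert (Suc m) T) x \<in> dP V P m"
    using p_cg[OF y(2), of "insert (Suc m) T"] p_fac_inc[OF y(1)] p_in[OF y(1)] unfolding dP_iff by metis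
next
  fix x n m T and phi :: "'g fiarr" assume h: "phi \<in> Hom n m" "x \<in> elts (sh V) n"
  then have x: "x \<in> elts V (Suc n)" by simp
  show "p (Suc m) (insert (Suc m) T) (fac (sh V) n m phi x) = fac (sh V) n m phi (p (Suc n) (insert (Suc n) (fst phi -` T)) x)"
    using p_fac[OF up_Hom[OF h(1)] x, of "insert (Suc m) T"] p_cong[OF x up_vimage[OF h(1), of T]]
    unfolding sh_simps by (rule eq_arg_trans)
next
  fix x m and T T' :: "nat set" assume h: "x \<in> elts (sh V) m" "T \<inter> {1..m} = T' \<inter> {1..m}"
  have S: "{1..Suc m} = insert (Suc m) {1..m}" by auto
  have "insert (Suc m) T \<inter> {1..Suc m} = insert (Suc m) T' \<inter> {1..Suc m}" using h(2) unfolding S by blast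
  then show "p (Suc m) (insert (Suc m) T) x = p (Suc m) (insert (Suc m) T') x" using h(1) by (intro p_cong) simp_all
next
  fix x m and T :: "nat set" assume h: "x \<in> elts (sh V) m" "{1..m} \<subseteq> T"
  have S: "{1..Suc m} = insert (Suc m) {1..m}" by auto
  have "{1..Suc m} \<subseteq> insert (Suc m) T" using h(2) unfolding S by blast
  then show "p (Suc m) (insert (Suc m) T) x = x" using p_id h(1) by simp
next
  fix x m assume "x \<in> elts (sh V) (Suc m)"
  then have x: "x \<in> elts V (Suc (Suc m))" by simp
  let ?t = "fac V (Suc (Suc m)) (Suc (Suc m)) (tau m)"
  have tx: "?t x \<in> elts V (Suc (Suc m))" using x by simp
  obtain z where z: "z \<in> elts V (Suc m)"
    "eqv V P (Suc (Suc m)) (p (Suc (Suc m)) {1..Suc m} (?t x)) (inc V (Suc m) z)"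
    using p_inc[OF tx] by blast
  \<comment> \<open>The set here omits m + 1. The transposition turns it into the set that omits m +
    2, to which \<open>p_inc\<close> for V applies.\<close>
  have "p (Suc (Suc m)) (insert (Suc (Suc m)) {1..m}) x = p (Suc (Suc m)) (insert (Suc (Suc m)) {1..m}) (?t (?t x))"
    using x by simp
  also have "\<dots> = ?t (p (Suc (Suc m)) {1..Suc m} (?t x))"
    using p_fac[OF swap_top_Hom tx] p_cong[OF tx tau_vimage] by (rule eq_arg_trans)
  finally have "eqv V P (Suc (Suc m)) (p (Suc (Suc m)) (insert (Suc (Suc m)) {1..m}) x)
      (fac V (Suc m) (Suc (Suc m)) (up m (Suc m) (idm m)) z)"
    using fac_cg[OF swap_top_Hom z(2)] tau_inc[OF z(1)] by simp
  then have "cg (deg V (Suc (Suc m))) (dP V P (Suc m)) (p (Suc (Suc m)) (insert (Suc (Suc m)) {1..m}) x)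
      (fac V (Suc m) (Suc (Suc m)) (up m (Suc m) (idm m)) z)"
    by (rule cg_mono) (auto intro: P_dP)
  then show "\<exists>z\<in>elts (sh V) m. eqv (sh V) (dP V P) (Suc m)
      (p (Suc (Suc m)) (insert (Suc (Suc m)) {1..m}) x) (inc (sh V) m z)"
    using z(1) unfolding sh_simps by blast
next
  fix m
  show "kvan (sh V) (dP V P) m"
    unfolding kvan_def
  proof (intro ballI impI)
    let ?t = "fac V (Suc (Suc m)) (Suc (Suc m)) (tau m)"
    let ?T = "insert (Suc (Suc m)) {1..m}"
    let ?u = "up m (Suc m) (idm m) :: 'g fiarr"
    fix x assume "x \<in> elts (sh V) m" and ix: "inc (sh V) m x \<in> dP V P (Suc m)"
    then have x: "x \<in> elts V (Suc m)" by simp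
    have u: "?u \<in> Hom (Suc m) (Suc (Suc m))" by simp
    have ix: "fac V (Suc m) (Suc (Suc m)) ?u x \<in> dP V P (Suc m)" using ix by simp
    obtain y where y: "y \<in> elts V (Suc m)"
      "eqv V P (Suc (Suc m)) (fac V (Suc m) (Suc (Suc m)) ?u x) (inc V (Suc m) y)"
      using ix unfolding dP_iff by blast
    obtain z where z: "z \<in> elts V m" "eqv V P (Suc m) (p (Suc m) {1..m} y) (inc V m z)"
      using p_inc[OF y(1)] by blast
    \<comment> \<open>Apply the operator of \<open>?T\<close>, which omits m + 1, to the congruence
      for y. It fixes the left hand side, because \<open>?u\<close> takes its values in
      \<open>?T\<close>, and on the right it replaces y by an element coming from degree m.\<close>
    have "p (Suc (Suc m)) ?T (fac V (Suc m) (Suc (Suc m)) ?u x) = fac V (Suc m) (Suc (Suc m)) ?u x"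
      using p_fac[OF u x, of ?T] p_id[OF x, of "fst ?u -` ?T"]
      by (auto simp: up_def idm_def subset_iff)
    moreover have "p (Suc (Suc m)) ?T (inc V (Suc m) y) = inc V (Suc m) (p (Suc m) {1..m} y)"
      using p_fac_inc[OF y(1), of ?T] p_cong[OF y(1), of ?T "{1..m}"] by auto
    ultimately have "eqv V P (Suc (Suc m)) (fac V (Suc m) (Suc (Suc m)) ?u x) (inc V (Suc m) (p (Suc m) {1..m} y))"
      using p_cg[OF y(2), of ?T] by simp
    also have "eqv V P (Suc (Suc m)) (inc V (Suc m) (p (Suc m) {1..m} y)) (inc V (Suc m) (inc V m z))"
      using fac_cg[OF _ z(2), of "idm (Suc m)"] by simp
    also have "inc V (Suc m) (inc V m z) = fac V (Suc m) (Suc (Suc m)) ?u (inc V m z)"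
      using fac_up_inc2[OF z(1)] by simp
    \<comment> \<open>The transposition turns \<open>?u\<close> into the standard inclusion, so that
      K V = 0 can be used.\<close>
    finally have "eqv V P (Suc (Suc m)) (?t (fac V (Suc m) (Suc (Suc m)) ?u x)) (?t (fac V (Suc m) (Suc (Suc m)) ?u (inc V m z)))"
      by (rule fac_cg[OF swap_top_Hom])
    then have "eqv V P (Suc (Suc m)) (inc V (Suc m) x) (inc V (Suc m) (inc V m z))"
      unfolding tau_inc[OF x, symmetric] tau_inc[OF inc_in[OF z(1)], symmetric]
      by (simp only: tau_tau[OF inc_in[OF x]] tau_tau[OF inc_in[OF inc_in[OF z(1)]]])
    then have "eqv V P (Suc m) x (inc V m z)" by (rule kvan_cg[OF kvan x inc_in[OF z(1)]])
    then show "x \<in> dP V P m" using z(1) unfolding dP_iff by blast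
  qed
qed

end

lemma sharp_acy: "sharp V P p \<Longrightarrow> acy V P"
proof (coinduction arbitrary: V P p)
  case acy
  then interpret sharp V P p .
  show ?case using kvan sharp_D by (intro exI conjI allI disjI1) (rule refl | assumption)+
qed

subsection \<open>Relatively projective modules are derivative acyclic\<close>

definition restr :: "nat set \<Rightarrow> ('i \<times> ('g::group_add) fiarr \<Rightarrow> 'k::comm_ring_1) \<Rightarrow> 'i \<times> 'g fiarr \<Rightarrow> 'k" where
  "restr T c = (\<lambda>(i, phi). if range (fst phi) \<subseteq> insert 0 T then c (i, phi) else 0)"

lemma Hom_range: 
  assumes "phi \<in> Hom n m"
  shows "range (fst phi) \<subseteq> insert 0 T \<longleftrightarrow> fst phi ` {1..n} \<subseteq> T"
proof
  assume h: "range (fst phi) \<subseteq> insert 0 T"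
  show "fst phi ` {1..n} \<subseteq> T"
  proof
    fix y assume "y \<in> fst phi ` {1..n}"
    then obtain x where x: "y = fst phi x" "x \<in> {1..n}" by blast
    then have "y \<noteq> 0" using Hom_in[OF assms x(2)] by auto
    then show "y \<in> T" using subsetD[OF h rangeI[of "fst phi" x]] x(1) by simp
  qed
next
  assume h: "fst phi ` {1..n} \<subseteq> T"
  show "range (fst phi) \<subseteq> insert 0 T"
  proof
    fix y assume "y \<in> range (fst phi)"
    then obtain x where x: "y = fst phi x" by blast
    show "y \<in> insert 0 T"
    proof (cases "x \<in> {1..n}")
      case True
      then show ?thesis using subsetD[OF h imageI[OF True]] x by simp
    next
      case False
      then show ?thesis using assms x unfolding Hom_iff by simp
    qed
  qed
qed

lemma restr_ind: "restr T (ind (i, phi)) = (if range (fst phi) \<subseteq> insert 0 T then ind (i, phi) else (\<lambda>_. 0))"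
  by (auto simp: restr_def ind_def fun_eq_iff)

lemma restr_carr:
  assumes "c \<in> carr (freek X)"
  shows "restr T c \<in> carr (freek X)"
proof -
  have "{p. restr T c p \<noteq> 0} \<subseteq> {p. c p \<noteq> 0}" by (auto simp: restr_def split: if_splits)
  then show ?thesis using assms finite_subset by (simp, blast)
qed

lemma restr_linear:
  "restr T (pls (freek X) c c') = pls (freek Y) (restr T c) (restr T c')"
  "restr T (sml (freek X) a c) = sml (freek Y) a (restr T c)"
  by (auto simp: restr_def)

lemma restr_lin: "lin (freek X) (freek X) (restr T)"
  unfolding lin_def using restr_carr restr_linear by (intro conjI ballI allI image_subsetI) blast+

lemma restr_keys:
  assumes "c \<in> carr (freek (keys I d (Suc m)))"
  shows "restr {1..m} c \<in> carr (freek (keys I d m))"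
proof -
  have "p \<in> keys I d m" if p: "restr {1..m} c p \<noteq> 0" for p
  proof -
    obtain i phi where ip: "p = (i, phi)" by (cases p)
    have r: "range (fst phi) \<subseteq> insert 0 {1..m}" "c (i, phi) \<noteq> 0" using p ip by (auto simp: restr_def split: if_splits)
    then have "(i, phi) \<in> keys I d (Suc m)" using freek_supp[OF assms] by blast
    then have i: "i \<in> I" "phi \<in> Hom (d i) (Suc m)" by auto
    have "fst phi x \<noteq> Suc m" for x using subsetD[OF r(1) rangeI[of "fst phi" x]] by auto
    then have "Suc m \<notin> fst phi ` {1..d i}" by (metis imageE)
    then show ?thesis using Hom_avoid[OF i(2)] i(1) ip by simp
  qed
  then show ?thesis using restr_carr[OF assms, of "{1..m}"] by auto
qed

lemma restr_lin_keys: "lin (freek (keys I d (Suc m))) (freek (keys I d m)) (restr {1..m})"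
  unfolding lin_def using restr_keys restr_linear by (intro conjI ballI allI image_subsetI) blast+

lemma restr_cong:
  assumes "c \<in> carr (freek (keys I d m))" "T \<inter> {1..m} = T' \<inter> {1..m}"
  shows "restr T c = restr T' c"
proof
  fix p show "restr T c p = restr T' c p"
  proof (cases "p \<in> keys I d m")
    case True
    then obtain i phi where p: "p = (i, phi)" "i \<in> I" "phi \<in> Hom (d i) m" by blast
    have "fst phi ` {1..d i} \<subseteq> {1..m}" using Hom_in[OF p(3)] by blast
    then have "fst phi ` {1..d i} \<subseteq> T \<longleftrightarrow> fst phi ` {1..d i} \<subseteq> T'" using assms(2) by blast
    then show ?thesis unfolding p(1) restr_def by (simp add: Hom_range[OF p(3)])
  next
    case False
    then show ?thesis using freek_supp[OF assms(1) False] by (cases p) (simp add: restr_def)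
  qed
qed

lemma restr_id:
  assumes "c \<in> carr (freek (keys I d m))" "{1..m} \<subseteq> T"
  shows "restr T c = c"
proof -
  have "restr UNIV c = c" by (auto simp: restr_def)
  then show ?thesis using restr_cong[OF assms(1), of T UNIV] assms(2) by auto
qed

lemma restr_push:
  fixes c :: "'i \<times> ('g::group_add) fiarr \<Rightarrow> 'k::comm_ring_1"
  assumes phi: "phi \<in> Hom n m" and c: "c \<in> carr (freek (keys I d n))"
  shows "restr T (push phi c) = push phi (restr (fst phi -` T) c)"
proof (rule lin_eq_free[OF freek_kmod _ _ _ c])
  let ?F = "\<lambda>n. freek (keys I d n) :: ('k, 'i \<times> 'g fiarr \<Rightarrow> 'k) kmod"
  show "lin (?F n) (?F m) (\<lambda>c. restr T (push phi c))" by (rule lin_comp[OF push_lin[OF phi] restr_lin])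
  show "lin (?F n) (?F m) (\<lambda>c. push phi (restr (fst phi -` T) c))" by (rule lin_comp[OF restr_lin push_lin[OF phi]])
  fix p :: "'i \<times> 'g fiarr" assume "p \<in> keys I d n"
  then obtain i psi where p: "p = (i, psi)" "i \<in> I" "psi \<in> Hom (d i) n" by blast
  have "fst (comp phi psi) ` {1..d i} \<subseteq> T \<longleftrightarrow> fst psi ` {1..d i} \<subseteq> fst phi -` T"
    by (auto simp: comp_def)
  then have iff: "range (fst (comp phi psi)) \<subseteq> insert 0 T \<longleftrightarrow> range (fst psi) \<subseteq> insert 0 (fst phi -` T)"
    using Hom_range[OF p(3)] Hom_range[OF comp_Hom[OF p(3) phi]] by simp
  have "push phi (zer (?F n)) = zer (?F m)" by (rule lin_zer[OF freek_kmod freek_kmod push_lin[OF phi]])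
  then have "push phi (\<lambda>_::'i \<times> 'g fiarr. 0 :: 'k) = (\<lambda>_. 0)" by simp
  then show "restr T (push phi (ind p :: _ \<Rightarrow> 'k)) = push phi (restr (fst phi -` T) (ind p))"
    unfolding p(1) push_ind[where d=d, OF phi p(2,3)] restr_ind iff
    by (simp add: push_ind[where d=d, OF phi p(2,3)])
qed

lemma freefi_acy: "acy (freefi I d :: ('k::comm_ring_1, 'g::group_add, 'i \<times> 'g fiarr \<Rightarrow> 'k) fimod) (zr (freefi I d))"
proof -
  let ?V = "freefi I d :: ('k::comm_ring_1, 'g::group_add, 'i \<times> 'g fiarr \<Rightarrow> 'k) fimod"
  interpret smodule ?V "zr ?V" by (rule zr_smodule[OF freefi_fimod])
  have "sharp ?V (zr ?V) (\<lambda>m. restr)"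
  proof unfold_locales
    fix m T show "lin (deg ?V m) (deg ?V m) (restr T)" unfolding freefi_simps by (rule restr_lin)
  next
    fix x m T assume "x \<in> zr ?V m"
    then show "restr T x \<in> zr ?V m" by (auto simp: zr_def restr_def fun_eq_iff)
  next
    fix x n m T and phi :: "'g fiarr" assume "phi \<in> Hom n m" "x \<in> elts ?V n"
    then show "restr T (fac ?V n m phi x) = fac ?V n m phi (restr (fst phi -` T) x)"
      unfolding freefi_simps by (rule restr_push)
  next
    fix x m and T T' :: "nat set" assume "x \<in> elts ?V m" "T \<inter> {1..m} = T' \<inter> {1..m}"
    then show "restr T x = restr T' x" unfolding freefi_simps by (rule restr_cong)
  next
    fix x m and T :: "nat set" assume "x \<in> elts ?V m" "{1..m} \<subseteq> T"
    then show "restr T x = x" unfolding freefi_simps by (rule restr_id)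
  next
    fix x m assume x: "x \<in> elts ?V (Suc m)"
    have r: "restr {1..m} x \<in> elts ?V m" using restr_keys x unfolding freefi_simps .
    \<comment> \<open>A morphism into [m] is, as a pair of functions, also a morphism into [m+1]; so
      the standard inclusion acts as the identity on coefficient functions.\<close>
    moreover have "inc ?V m (restr {1..m} x) = restr {1..m} x" using push_idm r unfolding freefi_simps .
    ultimately show "\<exists>z\<in>elts ?V m. eqv ?V (zr ?V) (Suc m) (restr {1..m} x) (inc ?V m z)"
      using linD(1)[OF restr_lin] x c_refl unfolding freefi_simps by metis
  next
    fix m show "kvan ?V (zr ?V) m"
      unfolding kvan_def
    proof (intro ballI impI)
      fix x assume x: "x \<in> elts ?V m" "inc ?V m x \<in> zr ?V (Suc m)"
      have "push (idm m) x = x" using push_idm x(1) unfolding freefi_simps .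
      then show "x \<in> zr ?V m" using x(2) by (simp add: zr_def)
    qed
  qed
  then show ?thesis by (rule sharp_acy)
qed

section \<open>The modules \<open>MW W\<close> as quotients of products of free modules\<close>

lemma kprod_kmod:
  assumes "\<And>n. is_kmod (M n)"
  shows "is_kmod \<lparr>carr = {x. \<forall>n. x n \<in> carr (M n)}, zer = (\<lambda>n. zer (M n)),
    pls = (\<lambda>x y n. pls (M n) (x n) (y n)), sml = (\<lambda>a x n. sml (M n) a (x n))\<rparr>"
  unfolding is_kmod_def
  by (auto simp: assms km_assoc[OF assms] km_sml_add[OF assms] km_sml_pls[OF assms] km_sml_sml[OF assms]
      intro: km_comm[OF assms])

lemma tfree_eq: "tfree W n m = freek (keys (carr (bdeg W n)) (\<lambda>_. n) m)"
  by (simp add: tfree_def)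

lemma tfree_kmod: "is_kmod (tfree W n m)"
  unfolding tfree_eq by (rule freek_kmod)

locale fbmodule =
  fixes W :: "('k::comm_ring_1, 'g::group_add, 'w) fbmod"
  assumes fb: "is_fbmod W"
begin

lemma b_kmod: "is_kmod (bdeg W n)"
  and b_lin: "s \<in> Hom n n \<Longrightarrow> lin (bdeg W n) (bdeg W n) (bac W n s)"
  using fb unfolding is_fbmod_def by blast+

lemma b_in [simp]: "s \<in> Hom n n \<Longrightarrow> w \<in> carr (bdeg W n) \<Longrightarrow> bac W n s w \<in> carr (bdeg W n)"
  using linD(1)[OF b_lin] .

lemmas [simp] = km_pls[OF b_kmod] km_sml[OF b_kmod] km_zer[OF b_kmod]

lemma ind_tfree [simp]: "w \<in> carr (bdeg W n) \<Longrightarrow> phi \<in> Hom n m \<Longrightarrow> ind (w, phi) \<in> carr (tfree W n m)"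
  unfolding tfree_def by (rule ind_carr) simp

text \<open>The tensor relations as pairs to be identified. To descend to the tensor product, a
  linear map only has to respect these three kinds of pairs.\<close>

inductive trel :: "nat \<Rightarrow> nat \<Rightarrow> ('w \<times> 'g fiarr \<Rightarrow> 'k) \<Rightarrow> ('w \<times> 'g fiarr \<Rightarrow> 'k) \<Rightarrow> bool" for n m where
  trel_pls: "w \<in> carr (bdeg W n) \<Longrightarrow> w' \<in> carr (bdeg W n) \<Longrightarrow> phi \<in> Hom n m \<Longrightarrow>
    trel n m (ind (pls (bdeg W n) w w', phi)) (pls (tfree W n m) (ind (w, phi)) (ind (w', phi)))"
| trel_sml: "w \<in> carr (bdeg W n) \<Longrightarrow> phi \<in> Hom n m \<Longrightarrow>
    trel n m (ind (sml (bdeg W n) a w, phi)) (sml (tfree W n m) a (ind (w, phi)))"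
| trel_act: "s \<in> Hom n n \<Longrightarrow> w \<in> carr (bdeg W n) \<Longrightarrow> phi \<in> Hom n m \<Longrightarrow>
    trel n m (ind (bac W n s w, phi)) (ind (w, comp phi s))"

lemma trel_carr: "trel n m x y \<Longrightarrow> x \<in> carr (tfree W n m)" "trel n m x y \<Longrightarrow> y \<in> carr (tfree W n m)"
  by (induction rule: trel.induct) (simp_all add: km_pls[OF tfree_kmod] km_sml[OF tfree_kmod])

lemma rels_eq: "rels W n m = {pls (tfree W n m) x (sml (tfree W n m) (-1) y) | x y. trel n m x y}"
proof (intro equalityI subsetI)
  fix r assume "r \<in> rels W n m"
  then consider w w' phi where "r = (\<lambda>q. ind (pls (bdeg W n) w w', phi) q - ind (w, phi) q - ind (w', phi) q)"
      "w \<in> carr (bdeg W n)" "w' \<in> carr (bdeg W n)" "phi \<in> Hom n m"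
    | a w phi where "r = (\<lambda>q. ind (sml (bdeg W n) a w, phi) q - a * ind (w, phi) q)"
      "w \<in> carr (bdeg W n)" "phi \<in> Hom n m"
    | s w phi where "r = (\<lambda>q. ind (bac W n s w, phi) q - ind (w, comp phi s) q)"
      "s \<in> Hom n n" "w \<in> carr (bdeg W n)" "phi \<in> Hom n m"
    unfolding rels_def by blast
  then show "r \<in> {pls (tfree W n m) x (sml (tfree W n m) (-1) y) | x y. trel n m x y}"
  proof cases
    case 1
    then have "r = pls (tfree W n m) (ind (pls (bdeg W n) w w', phi)) (sml (tfree W n m) (-1) (pls (tfree W n m) (ind (w, phi)) (ind (w', phi))))"
      by (simp add: tfree_def fun_eq_iff algebra_simps)
    then show ?thesis using trel_pls[OF 1(2-4)] by blast
  next
    case 2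
    then have "r = pls (tfree W n m) (ind (sml (bdeg W n) a w, phi)) (sml (tfree W n m) (-1) (sml (tfree W n m) a (ind (w, phi))))"
      by (simp add: tfree_def fun_eq_iff algebra_simps)
    then show ?thesis using trel_sml[OF 2(2-3)] by blast
  next
    case 3
    then have "r = pls (tfree W n m) (ind (bac W n s w, phi)) (sml (tfree W n m) (-1) (ind (w, comp phi s)))"
      by (simp add: tfree_def fun_eq_iff algebra_simps)
    then show ?thesis using trel_act[OF 3(2-4)] by blast
  qed
next
  fix r assume "r \<in> {pls (tfree W n m) x (sml (tfree W n m) (-1) y) | x y. trel n m x y}"
  then obtain x y where r: "r = pls (tfree W n m) x (sml (tfree W n m) (-1) y)" "trel n m x y" by blast
  from r(2) show "r \<in> rels W n m"
  proof cases
    case (trel_pls w w' phi)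
    have "r = (\<lambda>q. ind (pls (bdeg W n) w w', phi) q - ind (w, phi) q - ind (w', phi) q)"
      unfolding r(1) trel_pls(1,2) by (simp add: tfree_def fun_eq_iff algebra_simps)
    then show ?thesis unfolding rels_def using trel_pls(3-5) by blast
  next
    case (trel_sml w phi a)
    have "r = (\<lambda>q. ind (sml (bdeg W n) a w, phi) q - a * ind (w, phi) q)"
      unfolding r(1) trel_sml(1,2) by (simp add: tfree_def fun_eq_iff algebra_simps)
    then show ?thesis unfolding rels_def using trel_sml(3-4) by blast
  next
    case (trel_act s w phi)
    have "r = (\<lambda>q. ind (bac W n s w, phi) q - ind (w, comp phi s) q)"
      unfolding r(1) trel_act(1,2) by (simp add: tfree_def fun_eq_iff algebra_simps)
    then show ?thesis unfolding rels_def using trel_act(3-5) by blast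
  qed
qed

lemma tsub_ksub: "ksub (tfree W n m) (tsub W n m)"
  unfolding tsub_def rels_eq
  by (rule kspan_ksub[OF tfree_kmod]) (use trel_carr km_pls[OF tfree_kmod] km_sml[OF tfree_kmod] in blast)

lemma trel_cg:
  assumes "trel n m x y"
  shows "cg (tfree W n m) (tsub W n m) x y"
proof -
  have "pls (tfree W n m) x (sml (tfree W n m) (-1) y) \<in> tsub W n m"
    unfolding tsub_def rels_eq using assms by (blast intro: kspan_base)
  then show ?thesis
    using cg_diff[OF tfree_kmod tsub_ksub trel_carr(1)[OF assms] trel_carr(2)[OF assms]] by simp
qed

lemma tsub_lift:
  assumes N: "is_kmod N" "ksub N S" and L: "lin (tfree W n m) N L"
    and rel: "\<And>x y. trel n m x y \<Longrightarrow> cg N S (L x) (L y)" and c: "c \<in> tsub W n m"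
  shows "L c \<in> S"
proof -
  have "tsub W n m \<subseteq> {c \<in> carr (tfree W n m). L c \<in> S}"
    unfolding tsub_def
  proof (rule kspan_min[OF ksub_vimage[OF tfree_kmod N(1) L N(2)]], rule subsetI)
    fix r assume "r \<in> rels W n m"
    then obtain x y where r: "r = pls (tfree W n m) x (sml (tfree W n m) (-1) y)" "trel n m x y"
      unfolding rels_eq by blast
    note xy = trel_carr[OF r(2)]
    have "L r = pls N (L x) (sml N (-1) (L y))"
      unfolding r(1) using linD[OF L] xy km_sml[OF tfree_kmod] by metis
    then have "L r \<in> S" using cg_diff[OF N linD(1)[OF L xy(1)] linD(1)[OF L xy(2)]] rel[OF r(2)] by simp
    then show "r \<in> {c \<in> carr (tfree W n m). L c \<in> S}"
      using xy km_pls[OF tfree_kmod] km_sml[OF tfree_kmod] r(1) by blast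
  qed
  then show ?thesis using c by blast
qed

lemma push_tfree:
  assumes "psi \<in> Hom m l"
  shows "lin (tfree W n m) (tfree W n l) (push psi)"
    "phi \<in> Hom n m \<Longrightarrow> w \<in> carr (bdeg W n) \<Longrightarrow> push psi (ind (w, phi)) = (ind (w, comp psi phi) :: _ \<Rightarrow> 'k)"
  unfolding tfree_eq
  by (rule push_lin[OF assms], rule push_ind[OF assms, of w "carr (bdeg W n)" phi "\<lambda>_. n"])

lemma push_tsub:
  assumes psi: "psi \<in> Hom m l" and c: "c \<in> tsub W n m"
  shows "push psi c \<in> tsub W n l"
proof (rule tsub_lift[OF tfree_kmod tsub_ksub push_tfree(1)[OF psi] _ c])
  fix x y assume "trel n m x y"
  then have "trel n l (push psi x) (push psi y)"
  proof cases
    case (trel_pls w w' phi)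
    then show ?thesis using trel.trel_pls[of w n w' "comp psi phi" l] psi
      by (simp add: linD(2)[OF push_tfree(1)[OF psi]] push_tfree(2)[OF psi])
  next
    case (trel_sml w phi a)
    then show ?thesis using trel.trel_sml[of w n "comp psi phi" l a] psi
      by (simp add: linD(3)[OF push_tfree(1)[OF psi]] push_tfree(2)[OF psi])
  next
    case (trel_act s w phi)
    then show ?thesis using trel.trel_act[of s n w "comp psi phi" l] psi
        push_tfree(2)[OF psi comp_Hom[OF trel_act(3,5)] trel_act(4)]
      by (simp add: push_tfree(2)[OF psi] comp_assoc)
  qed
  then show "cg (tfree W n l) (tsub W n l) (push psi x) (push psi y)" by (rule trel_cg)
qed

text \<open>Both sides of a tensor relation involve morphisms with the same image, so they survive
  the restriction together. The target degree l is free in order to cover restriction inside one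
  degree as well as the retraction from degree m + 1 to degree m.\<close>

lemma restr_trel:
  assumes N: "lin (tfree W n m) (tfree W n l) (restr T)" and rel: "trel n m x y"
  shows "cg (tfree W n l) (tsub W n l) (restr T x) (restr T y)"
proof -
  have z: "cg (tfree W n l) (tsub W n l) (\<lambda>_. 0) (\<lambda>_. 0)"
    using cg_refl[OF tfree_kmod tsub_ksub km_zer[OF tfree_kmod, of W n l]] by (simp add: tfree_def)
  have Z: "pls (tfree W n l) (\<lambda>_. 0) (\<lambda>_. 0) = (\<lambda>_. 0)" "sml (tfree W n l) a (\<lambda>_. 0) = (\<lambda>_. 0)" for a
    by (simp_all add: tfree_def)
  \<comment> \<open>A morphism that survives the restriction takes its values in [l]: evaluate N at
    a basis element with this morphism.\<close>
  have l: "phi \<in> Hom n l" if "restr T (ind (zer (bdeg W n), phi) :: _ \<Rightarrow> 'k) \<noteq> (\<lambda>_. 0)" "phi \<in> Hom n m" for phi :: "'g fiarr"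
  proof -
    have "restr T (ind (zer (bdeg W n), phi) :: _ \<Rightarrow> 'k) = ind (zer (bdeg W n), phi)"
      using that(1) by (auto simp: restr_ind split: if_splits)
    then have "(ind (zer (bdeg W n), phi) :: _ \<Rightarrow> 'k) \<in> carr (tfree W n l)"
      using linD(1)[OF N ind_tfree[OF _ that(2)], of "zer (bdeg W n)"] by simp
    then have "(zer (bdeg W n), phi) \<in> carr (bdeg W n) \<times> Hom n l"
      unfolding tfree_def using freek_supp[of "ind (zer (bdeg W n), phi)" _ "(zer (bdeg W n), phi)"]
      by (metis ind_def one_neq_zero)
    then show ?thesis by simp
  qed
  have ind0: "(ind p :: _ \<Rightarrow> 'k) \<noteq> (\<lambda>_. 0)" for p :: "'w \<times> 'g fiarr"
  proof
    assume "(ind p :: _ \<Rightarrow> 'k) = (\<lambda>_. 0)"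
    then have "(ind p :: _ \<Rightarrow> 'k) p = 0" by simp
    then show False by (simp add: ind_def)
  qed
  show ?thesis
    using rel
  proof cases
    case (trel_pls w w' phi)
    show ?thesis
    proof (cases "range (fst phi) \<subseteq> insert 0 T")
      case True
      then show ?thesis using trel_pls l[of phi] trel_cg[OF trel.trel_pls, of w n w' phi l] ind0
        by (simp add: linD(2)[OF N] restr_ind)
    next
      case False
      then show ?thesis using trel_pls z Z by (simp add: linD(2)[OF N] restr_ind)
    qed
  next
    case (trel_sml w phi a)
    show ?thesis
    proof (cases "range (fst phi) \<subseteq> insert 0 T")
      case True
      then show ?thesis using trel_sml l[of phi] trel_cg[OF trel.trel_sml, of w n phi l a] ind0
        by (simp add: linD(3)[OF N] restr_ind)
    next
      case False
      then show ?thesis using trel_sml z Z by (simp add: linD(3)[OF N] restr_ind)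
    qed
  next
    case (trel_act s w phi)
    \<comment> \<open>s permutes its domain, so phi and \<open>comp phi s\<close> have the same
      image.\<close>
    have "fst s ` {1..n} = {1..n}"
      using trel_act(3) endo_inj_surj[of "{1..n}" "fst s"] by (auto simp: Hom_iff)
    moreover have "fst (comp phi s) ` {1..n} = fst phi ` fst s ` {1..n}" by (auto simp: comp_def)
    ultimately have "fst (comp phi s) ` {1..n} = fst phi ` {1..n}" by metis
    then have iff: "range (fst (comp phi s)) \<subseteq> insert 0 T \<longleftrightarrow> range (fst phi) \<subseteq> insert 0 T"
      using Hom_range[OF trel_act(5)] Hom_range[OF comp_Hom[OF trel_act(3,5)]] by simp
    show ?thesis
    proof (cases "range (fst phi) \<subseteq> insert 0 T")
      case True
      then show ?thesis using trel_act l[of phi] trel_cg[OF trel.trel_act, of s n w phi l] ind0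
        by (simp add: iff restr_ind)
    next
      case False
      then show ?thesis using trel_act z by (simp add: iff restr_ind)
    qed
  qed
qed

text \<open>\<open>MW W\<close> before the tensor relations are divided out. The FI#-structure is
  then given on functions instead of cosets, with the relations collected in
  \<open>TP\<close>.\<close>

definition TW :: "('k, 'g, nat \<Rightarrow> 'w \<times> 'g fiarr \<Rightarrow> 'k) fimod" where
  "TW = \<lparr>deg = (\<lambda>m. \<lparr>carr = {x. \<forall>n. x n \<in> carr (tfree W n m)}, zer = (\<lambda>n. zer (tfree W n m)),
      pls = (\<lambda>x y n. pls (tfree W n m) (x n) (y n)), sml = (\<lambda>a x n. sml (tfree W n m) a (x n))\<rparr>),
    fac = (\<lambda>m l psi x n. push psi (x n))\<rparr>"

definition TP :: "nat \<Rightarrow> (nat \<Rightarrow> 'w \<times> 'g fiarr \<Rightarrow> 'k) set" where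
  "TP m = {x. \<forall>n. x n \<in> tsub W n m}"

lemma TW_simps [simp]:
  "elts TW m = {x. \<forall>n. x n \<in> carr (tfree W n m)}" "zer (deg TW m) = (\<lambda>n. zer (tfree W n m))"
  "pls (deg TW m) = (\<lambda>x y n. pls (tfree W n m) (x n) (y n))" "sml (deg TW m) = (\<lambda>a x n. sml (tfree W n m) a (x n))"
  "fac TW m l psi = (\<lambda>x n. push psi (x n))"
  by (simp_all add: TW_def)

lemma TW_smodule: "smodule TW TP"
proof unfold_locales
  have F: "is_fimod (freefi (carr (bdeg W n)) (\<lambda>_. n) :: ('k, 'g, 'w \<times> 'g fiarr \<Rightarrow> 'k) fimod)" for n
    by (rule freefi_fimod)
  have "is_kmod (deg TW m)" for m
    unfolding TW_def fimod.select_convs by (rule kprod_kmod[OF tfree_kmod])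
  moreover have "lin (deg TW m) (deg TW l) (fac TW m l psi)" if "psi \<in> Hom m l" for m l psi
    using linD[OF push_tfree(1)[OF that]] unfolding lin_def by auto
  moreover have "fac TW m m (idm m) x = x" if "x \<in> elts TW m" for x m
  proof
    fix n show "fac TW m m (idm m) x n = x n"
      using that push_idm[where I="carr (bdeg W n)" and d="\<lambda>_. n" and c="x n"] unfolding TW_simps tfree_eq by blast
  qed
  moreover have "fac TW l k psi (fac TW m l phi x) = fac TW m k (comp psi phi) x"
    if "phi \<in> Hom m l" "psi \<in> Hom l k" "x \<in> elts TW m" for phi psi :: "'g fiarr" and x m l k
  proof
    fix n show "fac TW l k psi (fac TW m l phi x) n = fac TW m k (comp psi phi) x n"
      using fimodD(5)[OF F[of n] that(1,2), of "x n"] that(3) unfolding TW_simps tfree_eq freefi_simps by blast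
  qed
  ultimately show "is_fimod TW" unfolding is_fimod_def by blast
  have "ksub (deg TW m) (TP m)" for m
    using ksubD[OF tsub_ksub] unfolding ksub_def TP_def by auto
  then show "sub_fimod TW TP" using push_tsub by (auto simp: sub_fimod_def TP_def)
qed

lemma TW_acy: "acy TW TP"
proof -
  interpret smodule TW TP by (rule TW_smodule)
  have rl: "lin (tfree W n m) (tfree W n m) (restr T)" for n m T
    unfolding tfree_eq by (rule restr_lin)
  have rlk: "lin (tfree W n (Suc m)) (tfree W n m) (restr {1..m})" for n m
    unfolding tfree_eq by (rule restr_lin_keys)
  have rt: "restr T c \<in> tsub W n m" if "c \<in> tsub W n m" for T c n m
    by (rule tsub_lift[OF tfree_kmod tsub_ksub rl restr_trel[OF rl] that])
  \<comment> \<open>Restriction to {1..m} retracts degree m + 1 onto degree m and respects the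
    relations. Hence the standard inclusion is injective modulo relations.\<close>
  have rtk: "restr {1..m} c \<in> tsub W n m" if "c \<in> tsub W n (Suc m)" for c n m
    by (rule tsub_lift[OF tfree_kmod tsub_ksub rlk restr_trel[OF rlk] that])
  have pid: "push (idm m) c = c" if "c \<in> carr (tfree W n m)" for c n m
    using that push_idm[where I="carr (bdeg W n)" and d="\<lambda>_. n"] unfolding tfree_eq by blast
  have rid: "restr T c = c" if "c \<in> carr (tfree W n m)" "{1..m} \<subseteq> T" for c n m T
    using that restr_id[where I="carr (bdeg W n)" and d="\<lambda>_. n"] unfolding tfree_eq by blast
  have "sharp TW TP (\<lambda>m T x n. restr T (x n))"
  proof unfold_locales
    fix m T show "lin (deg TW m) (deg TW m) (\<lambda>x n. restr T (x n))"
      using linD[OF rl] unfolding lin_def by auto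
  next
    fix x m T assume "x \<in> TP m"
    then show "(\<lambda>n. restr T (x n)) \<in> TP m" using rt by (simp add: TP_def)
  next
    fix x n m T and phi :: "'g fiarr" assume "phi \<in> Hom n m" "x \<in> elts TW n"
    then show "(\<lambda>k. restr T (fac TW n m phi x k)) = fac TW n m phi (\<lambda>k. restr (fst phi -` T) (x k))"
      using restr_push[where I="carr (bdeg W k)" and d="\<lambda>_. k" for k] unfolding TW_simps tfree_eq by blast
  next
    fix x m and T T' :: "nat set" assume "x \<in> elts TW m" "T \<inter> {1..m} = T' \<inter> {1..m}"
    then show "(\<lambda>n. restr T (x n)) = (\<lambda>n. restr T' (x n))"
      using restr_cong[where I="carr (bdeg W n)" and d="\<lambda>_. n" for n] unfolding TW_simps tfree_eq by blast
  next
    fix x m and T :: "nat set" assume x: "x \<in> elts TW m" "{1..m} \<subseteq> T"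
    show "(\<lambda>n. restr T (x n)) = x"
    proof
      fix n show "restr T (x n) = x n" by (rule rid[of _ n m]) (use x in auto)
    qed
  next
    fix x m assume x: "x \<in> elts TW (Suc m)"
    let ?z = "\<lambda>n. restr {1..m} (x n)"
    have z: "?z \<in> elts TW m" using x linD(1)[OF rlk] by simp
    have i: "inc TW m ?z = ?z"
    proof
      fix n show "inc TW m ?z n = ?z n"
        unfolding TW_simps(5) by (rule pid[of _ n]) (use z in simp)
    qed
    have "eqv TW TP (Suc m) ?z (inc TW m ?z)"
      unfolding i by (rule c_refl) (use x linD(1)[OF rl] in simp)
    then show "\<exists>z\<in>elts TW m. eqv TW TP (Suc m) ?z (inc TW m z)" using z by blast
  next
    fix m show "kvan TW TP m"
      unfolding kvan_def
    proof (intro ballI impI)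
      fix x assume x: "x \<in> elts TW m" "inc TW m x \<in> TP (Suc m)"
      show "x \<in> TP m"
        unfolding TP_def
      proof (intro CollectI allI)
        fix n
        have c: "x n \<in> carr (tfree W n m)" using x(1) by simp
        have "inc TW m x n \<in> tsub W n (Suc m)" using x(2) unfolding TP_def by blast
        then have "x n \<in> tsub W n (Suc m)" unfolding TW_simps(5) pid[OF c] .
        then show "x n \<in> tsub W n m" using rtk rid[OF c order_refl] by metis
      qed
    qed
  qed
  then show ?thesis by (rule sharp_acy)
qed

abbreviation toMW :: "nat \<Rightarrow> (nat \<Rightarrow> 'w \<times> 'g fiarr \<Rightarrow> 'k) \<Rightarrow> nat \<Rightarrow> ('w \<times> 'g fiarr \<Rightarrow> 'k) set" where
  "toMW m x \<equiv> (\<lambda>n. kcoset (tfree W n m) (tsub W n m) (x n))"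

lemma MW_carr: "elts (MW W) m = toMW m ` elts TW m"
proof (intro equalityI subsetI)
  fix X assume "X \<in> elts (MW W) m"
  then have "\<forall>n. \<exists>c. c \<in> carr (tfree W n m) \<and> X n = kcoset (tfree W n m) (tsub W n m) c"
    by (auto simp: MW_def tens_def kquot_def)
  from choice[OF this] obtain x where "\<forall>n. x n \<in> carr (tfree W n m) \<and> X n = kcoset (tfree W n m) (tsub W n m) (x n)" ..
  then show "X \<in> toMW m ` elts TW m" by (intro image_eqI[of _ _ x]) auto
qed (auto simp: MW_def tens_def kquot_def)

lemma MW_fimod: "is_fimod (MW W)" and MW_fhom: "fhom TW (MW W) toMW"
proof -
  interpret smodule TW TP by (rule TW_smodule)
  have fac: "fac (MW W) n m phi (toMW n x) = toMW m (fac TW n m phi x)"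
    if phi: "phi \<in> Hom n m" and x: "x \<in> elts TW n" for n m x and phi :: "'g fiarr"
  proof
    fix k
    have c: "x k \<in> carr (tfree W k n)" using x by simp
    let ?y = "SOME c. c \<in> kcoset (tfree W k n) (tsub W k n) (x k)"
    have "cg (tfree W k n) (tsub W k n) ?y (x k)" by (rule kcoset_some[OF tfree_kmod tsub_ksub c])
    then have e: "cg (tfree W k m) (tsub W k m) (push phi ?y) (push phi (x k))"
      by (rule lin_cg[OF push_tfree(1)[OF phi] _ push_tsub[OF phi] tsub_ksub])
    show "fac (MW W) n m phi (toMW n x) k = toMW m (fac TW n m phi x) k"
      using e kcoset_eq_iff[OF tfree_kmod tsub_ksub cg_carr(1)[OF e] cg_carr(2)[OF e]] by (simp add: MW_def)
  qed
  have z: "zer (deg (MW W) n) = toMW n (zer (deg TW n))" for n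
    by (simp add: MW_def tens_def kquot_def)
  have p: "pls (deg (MW W) n) (toMW n x) (toMW n y) = toMW n (pls (deg TW n) x y)"
    if "x \<in> elts TW n" "y \<in> elts TW n" for n x y
    using that kquot_pls[OF tfree_kmod tsub_ksub] by (simp add: MW_def tens_def)
  have s: "sml (deg (MW W) n) a (toMW n x) = toMW n (sml (deg TW n) a x)"
    if "x \<in> elts TW n" for n a x
    using that kquot_sml[OF tfree_kmod tsub_ksub] by (simp add: MW_def tens_def)
  show "is_fimod (MW W)"
    by (rule fimod_image(1)[where h=toMW and B=TW, OF fimod MW_carr z]) (fact p s fac)+
  show "fhom TW (MW W) toMW"
    by (rule fimod_image(2)[where h=toMW and B=TW, OF fimod MW_carr z]) (fact p s fac)+
qed

lemma toMW_zer_iff: "x \<in> elts TW m \<Longrightarrow> toMW m x = zer (deg (MW W) m) \<longleftrightarrow> x \<in> TP m"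
  using kcoset_zer_iff[OF tfree_kmod tsub_ksub] by (simp add: MW_def tens_def TP_def fun_eq_iff)

lemma MW_ssurj: "ssurj TW TP (MW W) (zr (MW W)) toMW"
proof (rule ssurj_zr[OF TW_smodule MW_fimod MW_fhom MW_carr[symmetric]])
  interpret smodule TW TP by (rule TW_smodule)
  show "toMW n b = zer (deg (MW W) n)" if "b \<in> TP n" for n b
    using that toMW_zer_iff P_carr by blast
qed

lemma MW_acy: "acy (MW W) (zr (MW W))"
proof -
  interpret q: ssurj TW TP "MW W" "zr (MW W)" toMW by (rule MW_ssurj)
  show ?thesis using q.acy_iso toMW_zer_iff TW_acy unfolding zr_def by blast
qed

end

lemma relproj_acy:
  assumes "is_fimod V" "relproj V"
  shows "acy V (zr V)"
proof -
  obtain W :: "('a, 'b, 'c) fbmod" and h where W: "is_fbmod W" "fiso (MW W) V h"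
    using assms(2) unfolding relproj_def by blast
  interpret fbmodule W by unfold_locales (rule W)
  show ?thesis using fiso_acy[OF MW_fimod assms(1) W(2)] MW_acy by blast
qed

subsection \<open>Filtrations\<close>

text \<open>Send p x to g x. In this form of the isomorphism theorem both targets may consist of
  cosets of different kinds; it identifies \<open>MW W\<close> with V / S, and V with its quotient
  by zero.\<close>

lemma fiso_kernel:
  assumes "is_fimod B" "is_fimod C" "is_fimod C'" "fhom B C p" "fhom B C' g"
    and psurj: "\<And>n. p n ` elts B n = elts C n" and gsurj: "\<And>n. g n ` elts B n = elts C' n"
    and ker: "\<And>n x. x \<in> elts B n \<Longrightarrow> p n x = zer (deg C n) \<longleftrightarrow> g n x = zer (deg C' n)"
  obtains h where "fiso C C' h"
proof -
  interpret B: smodule B "zr B" by (rule zr_smodule) fact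
  interpret C: smodule C "zr C" by (rule zr_smodule) fact
  interpret C': smodule C' "zr C'" by (rule zr_smodule) fact
  define h where "h = (\<lambda>n c. g n (SOME x. x \<in> elts B n \<and> p n x = c))"
  note pl = fhomD(1)[OF assms(4)] and gl = fhomD(1)[OF assms(5)]
  have eq: "p n x = p n y \<longleftrightarrow> g n x = g n y" if xy: "x \<in> elts B n" "y \<in> elts B n" for n x y
  proof -
    let ?d = "pls (deg B n) x (sml (deg B n) (-1) y)"
    have "p n x = p n y \<longleftrightarrow> p n ?d \<in> zr C n"
      using C.c_diff[of "p n x" n "p n y"] assms(2) linD[OF pl] xy by simp
    moreover have "g n x = g n y \<longleftrightarrow> g n ?d \<in> zr C' n"
      using C'.c_diff[of "g n x" n "g n y"] assms(3) linD[OF gl] xy by simp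
    ultimately show ?thesis using ker[of ?d n] xy by (simp add: zr_def)
  qed
  have h: "h n (p n x) = g n x" if x: "x \<in> elts B n" for n x
  proof -
    let ?y = "SOME y. y \<in> elts B n \<and> p n y = p n x"
    have "?y \<in> elts B n \<and> p n ?y = p n x" by (rule someI[of _ x]) (use x in simp)
    then show ?thesis using eq[of ?y n x] x by (simp add: h_def)
  qed
  have ex: "\<exists>x\<in>elts B n. c = p n x" if "c \<in> elts C n" for n c
    using that psurj[of n] by blast
  have "fhom C C' h"
    unfolding fhom_def lin_def
  proof (intro conjI allI ballI image_subsetI)
    fix n c assume "c \<in> elts C n"
    then show "h n c \<in> elts C' n" using ex h fhomD(2)[OF assms(5)] by metis
  next
    fix n c d assume "c \<in> elts C n" "d \<in> elts C n"
    then obtain x y where x: "x \<in> elts B n" "c = p n x" and y: "y \<in> elts B n" "d = p n y"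
      using ex by blast
    show "h n (pls (deg C n) c d) = pls (deg C' n) (h n c) (h n d)"
      using h[OF B.k_pls[OF x(1) y(1)]] linD(2)[OF pl x(1) y(1)] linD(2)[OF gl x(1) y(1)] h x y by simp
  next
    fix n a c assume "c \<in> elts C n"
    then obtain x where x: "x \<in> elts B n" "c = p n x" using ex by blast
    show "h n (sml (deg C n) a c) = sml (deg C' n) a (h n c)"
      using h[OF B.k_sml[OF x(1)], of a] linD(3)[OF pl x(1), of a] linD(3)[OF gl x(1), of a] h x by simp
  next
    fix n m c and phi :: "'b fiarr" assume phi: "phi \<in> Hom n m" and "c \<in> elts C n"
    then obtain x where x: "x \<in> elts B n" "c = p n x" using ex by blast
    show "h m (fac C n m phi c) = fac C' n m phi (h n c)"
      using h[OF B.fac_in[OF phi x(1)]] fhomD(3)[OF assms(4) phi x(1)] fhomD(3)[OF assms(5) phi x(1)] h x by simp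
  qed
  moreover have "bij_betw (h n) (elts C n) (elts C' n)" for n
    unfolding bij_betw_def inj_on_def psurj[symmetric] gsurj[symmetric] using h eq by (auto simp: image_iff)
  ultimately have "fiso C C' h" by (simp add: fiso_def)
  then show ?thesis by (rule that)
qed

lemma kcoset_carr_update [simp]: "kcoset (M\<lparr>carr := T\<rparr>) S = kcoset M S"
  by (simp add: kcoset_def fun_eq_iff)

lemma frestrict_frestrict [simp]: "frestrict (frestrict V S) S' = frestrict V S'"
  by (simp add: frestrict_def)

lemma frestrict_carr: "frestrict V (\<lambda>n. elts V n) = V"
  by (simp add: frestrict_def)

lemma zr_frestrict [simp]: "zr (frestrict V S) = zr V"
  by (simp add: zr_def fun_eq_iff)

lemma sub_fimod_restrict:
  assumes "sub_fimod V S" "sub_fimod V S'" "\<And>n. S n \<subseteq> S' n"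
  shows "sub_fimod (frestrict V S') S"
  using assms unfolding sub_fimod_def ksub_def by simp

lemma sub_smodule: "is_fimod V \<Longrightarrow> sub_fimod V S \<Longrightarrow> sub_fimod V S' \<Longrightarrow> (\<And>n. S n \<subseteq> S' n) \<Longrightarrow> smodule (frestrict V S') S"
  by (rule smodule.intro[OF frestrict_fimod sub_fimod_restrict])

lemma sub_ses:
  assumes "is_fimod V" "sub_fimod V S" "sub_fimod V S'" "\<And>n. S n \<subseteq> S' n"
  shows "ses (frestrict V S) (zr V) (frestrict V S') (zr V) (frestrict V S') S (\<lambda>n x. x) (\<lambda>n x. x)"
proof -
  interpret S: smodule "frestrict V S'" S by (rule sub_smodule[OF assms])
  have "smodule (frestrict V S') (zr V)"
    using zr_smodule[OF frestrict_fimod[OF assms(1,3)]] by simp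
  moreover have "zr V n \<subseteq> S n" for n
    using ksubD(2)[OF sub_fimodD(1)[OF assms(2)]] by (simp add: zr_def)
  ultimately have "ssurj (frestrict V S') (zr V) (frestrict V S') S (\<lambda>n x. x)"
  proof (intro ssurj.intro ssurj_axioms.intro S.smodule_axioms)
    fix c n assume c: "c \<in> elts (frestrict V S') n"
    then show "\<exists>b\<in>elts (frestrict V S') n. eqv (frestrict V S') S n c b"
      using S.c_refl by blast
  qed (auto simp: fhom_def lin_def)
  moreover have "pre (frestrict V S') (\<lambda>n x. x) S = S"
    using assms(4) by (auto simp: pre_def fun_eq_iff)
  ultimately show ?thesis using ssurj.ker_ses by fastforce
qed

lemma filtration_acy:
  fixes V :: "('k::comm_ring_1, 'g::group_add, 'a) fimod"
  assumes "is_fimod V" "sharp_filtered V"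
  shows "acy V (zr V)"
proof -
  obtain N :: nat and S :: "nat \<Rightarrow> nat \<Rightarrow> 'a set" where "(\<forall>j\<le>N. sub_fimod V (S j)) \<and> (\<forall>m. S 0 m = {zer (deg V m)}) \<and> (\<forall>m. S N m = elts V m) \<and>
    (\<forall>j. 1 \<le> j \<and> j \<le> N \<longrightarrow> (\<forall>m. S (j - 1) m \<subseteq> S j m) \<and> relproj (fquot (frestrict V (S j)) (S (j - 1))))"
    using assms(2) unfolding sharp_filtered_def by blast
  then have S: "\<And>j. j \<le> N \<Longrightarrow> sub_fimod V (S j)" "\<And>m. S 0 m = {zer (deg V m)}"
    "\<And>m. S N m = elts V m"
    "\<And>j m. 1 \<le> j \<Longrightarrow> j \<le> N \<Longrightarrow> S (j - 1) m \<subseteq> S j m"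
    "\<And>j. 1 \<le> j \<Longrightarrow> j \<le> N \<Longrightarrow> relproj (fquot (frestrict V (S j)) (S (j - 1)))"
    by simp_all
  have "acy (frestrict V (S j)) (zr V)" if "j \<le> N" for j
    using that
  proof (induction j)
    case 0
    have "smodule (frestrict V (S 0)) (zr V)"
      using zr_smodule[OF frestrict_fimod[OF assms(1) S(1)[OF 0]]] unfolding zr_frestrict .
    then show ?case by (rule acy_trivial) (simp add: S(2) zr_def)
  next
    case (Suc j)
    have le: "S j n \<subseteq> S (Suc j) n" for n using S(4)[of "Suc j"] Suc.prems by simp
    have sub: "sub_fimod V (S j)" "sub_fimod V (S (Suc j))" using S(1) Suc.prems by simp_all
    interpret q: smodule "frestrict V (S (Suc j))" "S j" by (rule sub_smodule[OF assms(1) sub le])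
    have "acy (frestrict V (S (Suc j))) (S j)"
      using relproj_acy[OF q.fquot_fimod] S(5)[of "Suc j"] Suc.prems q.fquot_acy by simp
    then show ?case using acy_mid[OF sub_ses[OF assms(1) sub le]] Suc by simp
  qed
  moreover have "S N = (\<lambda>n. elts V n)" using S(3) by auto
  ultimately show ?thesis using frestrict_carr[of V] by (metis order_refl)
qed

text \<open>The submodule generated in degrees below d. The strict bound makes
  \<open>gsub V 0\<close> zero, so that the filtration starts there.\<close>

definition gsub :: "('k::comm_ring_1, 'g::group_add, 'a) fimod \<Rightarrow> nat \<Rightarrow> nat \<Rightarrow> 'a set" where
  "gsub V d n = kspan (deg V n) (\<Union>m\<in>{..<d}. \<Union>phi\<in>Hom m n. fac V m n phi ` elts V m)"

lemma gsub_min: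
  assumes "ksub (deg V n) T" "\<And>m phi x. m < d \<Longrightarrow> phi \<in> Hom m n \<Longrightarrow> x \<in> elts V m \<Longrightarrow> fac V m n phi x \<in> T"
  shows "gsub V d n \<subseteq> T"
  unfolding gsub_def by (rule kspan_min) (use assms in auto)

lemma gsub_gen: "m < d \<Longrightarrow> phi \<in> Hom m n \<Longrightarrow> x \<in> elts V m \<Longrightarrow> fac V m n phi x \<in> gsub V d n"
  unfolding gsub_def by (rule kspan_base) blast

context
  fixes V :: "('k::comm_ring_1, 'g::group_add, 'a) fimod"
  assumes V: "is_fimod V"
begin

interpretation smodule V "zr V" by (rule zr_smodule[OF V])

lemma gsub_ksub: "ksub (deg V n) (gsub V d n)"
  unfolding gsub_def by (rule kspan_ksub[OF km]) auto

lemma gsub_sub: "sub_fimod V (gsub V d)"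
proof -
  have "fac V n m phi ` gsub V d n \<subseteq> gsub V d m" if phi: "phi \<in> Hom n m" for n m phi
  proof -
    have "gsub V d n \<subseteq> {x \<in> elts V n. fac V n m phi x \<in> gsub V d m}"
    proof (rule gsub_min[OF ksub_vimage[OF km km fac_lin[OF phi] gsub_ksub]])
      fix k x and psi :: "'g fiarr" assume h: "k < d" "psi \<in> Hom k n" "x \<in> elts V k"
      then have "fac V n m phi (fac V k n psi x) \<in> gsub V d m"
        using gsub_gen[OF h(1) comp_Hom[OF h(2) phi] h(3)] fac_comp[OF h(2) phi h(3)] by simp
      then show "fac V k n psi x \<in> {x \<in> elts V n. fac V n m phi x \<in> gsub V d m}" using h by simp
    qed
    then show ?thesis by blast
  qed
  then show ?thesis using gsub_ksub by (simp add: sub_fimod_def)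
qed

lemma gsub_carr: "gsub V d n \<subseteq> elts V n"
  using ksubD(1)[OF gsub_ksub] by blast

lemma gsub_low: "n < d \<Longrightarrow> gsub V d n = elts V n"
  using gsub_carr gsub_gen[of n d "idm n" n _ V] by fastforce

lemma gsub_mono: "gsub V d n \<subseteq> gsub V (Suc d) n"
  by (rule gsub_min[OF gsub_ksub]) (simp add: gsub_gen)

lemma gsub_0: "gsub V 0 n = {zer (deg V n)}"
  using gsub_min[OF ksub_zer[OF km], of 0 n] ksubD(2)[OF gsub_ksub] by fastforce

lemma gsub_top:
  assumes "gen_le r V (zr V)"
  shows "gsub V (Suc r) n = elts V n"
proof (induction n rule: less_induct)
  case (less n)
  show ?case
  proof (cases "n \<le> r")
    case False
    have "lt V (zr V) n \<subseteq> gsub V (Suc r) n"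
      by (rule lt_min[OF gsub_ksub])
        (use less sub_fimodD(2)[OF gsub_sub] ksubD(2)[OF gsub_ksub] in \<open>auto simp: zr_def\<close>)
    moreover have "elts V n \<subseteq> lt V (zr V) n" using assms False by (simp add: gen_le_def)
    ultimately show ?thesis using gsub_carr[of "Suc r" n] by blast
  qed (simp add: gsub_low)
qed

lemma gsub_gen_le: "gen_le d (frestrict V (gsub V (Suc d))) (zr V)"
  unfolding gen_le_def
proof (intro allI impI)
  fix n assume n: "d < n"
  interpret g: smodule "frestrict V (gsub V (Suc d))" "zr V"
    using zr_smodule[OF frestrict_fimod[OF V gsub_sub]] by simp
  have "ksub (deg V n) (lt (frestrict V (gsub V (Suc d))) (zr V) n)"
    using g.lt_ksub[of n] gsub_carr unfolding ksub_def by auto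
  then have "gsub V (Suc d) n \<subseteq> lt (frestrict V (gsub V (Suc d))) (zr V) n"
    by (rule gsub_min) (use g.lt_gen n gsub_low in auto)
  then show "elts (frestrict V (gsub V (Suc d))) n \<subseteq> lt (frestrict V (gsub V (Suc d))) (zr V) n" by simp
qed

end

definition prodfi :: "('k, 'g, 'a) fimod \<Rightarrow> ('k, 'g, 'b) fimod \<Rightarrow> ('k, 'g, 'a \<times> 'b) fimod" where
  "prodfi A B = \<lparr>deg = (\<lambda>n. \<lparr>carr = elts A n \<times> elts B n, zer = (zer (deg A n), zer (deg B n)),
      pls = (\<lambda>x y. (pls (deg A n) (fst x) (fst y), pls (deg B n) (snd x) (snd y))),
      sml = (\<lambda>a x. (sml (deg A n) a (fst x), sml (deg B n) a (snd x)))\<rparr>),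
    fac = (\<lambda>n m phi x. (fac A n m phi (fst x), fac B n m phi (snd x)))\<rparr>"

lemma prodfi_simps [simp]:
  "elts (prodfi A B) n = elts A n \<times> elts B n" "zer (deg (prodfi A B) n) = (zer (deg A n), zer (deg B n))"
  "pls (deg (prodfi A B) n) x y = (pls (deg A n) (fst x) (fst y), pls (deg B n) (snd x) (snd y))"
  "sml (deg (prodfi A B) n) a x = (sml (deg A n) a (fst x), sml (deg B n) a (snd x))"
  "fac (prodfi A B) n m phi x = (fac A n m phi (fst x), fac B n m phi (snd x))"
  by (simp_all add: prodfi_def)

lemma prodfi_fimod:
  assumes "is_fimod A" "is_fimod B"
  shows "is_fimod (prodfi A B)"
proof -
  note A = fimodD[OF assms(1)] and B = fimodD[OF assms(2)]
  have "is_kmod (deg (prodfi A B) n)" for n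
    unfolding is_kmod_def
    by (auto simp: A(1) B(1) km_assoc[OF A(1)] km_assoc[OF B(1)] km_sml_add[OF A(1)] km_sml_add[OF B(1)]
        km_sml_pls[OF A(1)] km_sml_pls[OF B(1)] km_sml_sml[OF A(1)] km_sml_sml[OF B(1)]
        intro: km_comm[OF A(1)] km_comm[OF B(1)])
  moreover have "lin (deg (prodfi A B) n) (deg (prodfi A B) m) (fac (prodfi A B) n m phi)" if "phi \<in> Hom n m" for n m phi
    using linD[OF A(2)[OF that]] linD[OF B(2)[OF that]] unfolding lin_def by auto
  ultimately show ?thesis using A(4,5) B(4,5) unfolding is_fimod_def by auto
qed

subsection \<open>The top quotient of an acyclic module\<close>

text \<open>A zero module available on any element type, used to extend W by zero outside degree
  d.\<close>

definition triv :: "('k, 'a) kmod" where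
  "triv = \<lparr>carr = {undefined}, zer = undefined, pls = (\<lambda>_ _. undefined), sml = (\<lambda>_ _. undefined)\<rparr>"

lemma triv_simps [simp]: "carr triv = {undefined}" "zer triv = undefined" "pls triv x y = undefined" "sml triv a x = undefined"
  by (simp_all add: triv_def)

text \<open>The assumptions on S characterise the submodule generated in degrees below d. They are
  stated as properties so that they can be verified for \<open>gsub V j\<close> inside
  \<open>gsub V (Suc j)\<close>.\<close>

locale top_quotient =
  fixes V :: "('k::comm_ring_1, 'g::group_add, 'a) fimod" and S :: "nat \<Rightarrow> 'a set" and d :: nat
  assumes V: "is_fimod V" and acyV: "acy V (zr V)" and S: "sub_fimod V S"
    and S_low: "n < d \<Longrightarrow> S n = elts V n"
    and S_min: "ksub (deg V n) T \<Longrightarrow>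
      (\<And>m phi x. m < d \<Longrightarrow> phi \<in> Hom m n \<Longrightarrow> x \<in> elts V m \<Longrightarrow> fac V m n phi x \<in> T) \<Longrightarrow> S n \<subseteq> T"
    and gen: "gen_le d V (zr V)"
begin

sublocale v: smodule V "zr V" by (rule zr_smodule[OF V])
sublocale vS: smodule V S by unfold_locales (fact V S)+

abbreviation "Q \<equiv> fquot V S"
abbreviation "q n \<equiv> kcoset (deg V n) (S n)"

sublocale qm: smodule Q "zr Q" by (rule zr_smodule[OF vS.fquot_fimod])

lemma q_carr: "elts Q n = q n ` elts V n"
  by (simp add: fquot_def kquot_def)

lemma q_zer: "x \<in> elts V n \<Longrightarrow> q n x = zer (deg Q n) \<longleftrightarrow> x \<in> S n"
  using kcoset_zer_iff[OF vS.km vS.ks] by (simp add: fquot_def)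

lemmas q_lin = fhomD(1)[OF vS.fquot_fhom] and q_in [simp] = fhomD(2)[OF vS.fquot_fhom]
  and q_fac = fhomD(3)[OF vS.fquot_fhom]

definition W :: "('k, 'g, 'a set) fbmod" where
  "W = \<lparr>bdeg = (\<lambda>n. if n = d then deg Q d else triv), bac = (\<lambda>n s w. if n = d then fac Q d d s w else w)\<rparr>"

lemma W_simps [simp]: "bdeg W d = deg Q d" "n \<noteq> d \<Longrightarrow> bdeg W n = triv" "bac W d s = fac Q d d s" "n \<noteq> d \<Longrightarrow> bac W n s = (\<lambda>w. w)"
  by (auto simp: W_def fun_eq_iff)

lemma W_fbmod: "is_fbmod W"
  unfolding is_fbmod_def
proof
  fix n
  show "is_kmod (bdeg W n) \<and> (\<forall>s\<in>Hom n n. lin (bdeg W n) (bdeg W n) (bac W n s))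
    \<and> (\<forall>w\<in>carr (bdeg W n). bac W n (idm n) w = w)
    \<and> (\<forall>s\<in>Hom n n. \<forall>t\<in>Hom n n. \<forall>w\<in>carr (bdeg W n). bac W n s (bac W n t w) = bac W n (comp s t) w)"
  proof (cases "n = d")
    case True
    then show ?thesis using qm.km qm.fac_lin qm.fac_comp by simp
  next
    case False
    then show ?thesis by (auto simp: is_kmod_def lin_def)
  qed
qed

sublocale w: fbmodule W by unfold_locales (rule W_fbmod)

text \<open>As W is concentrated in degree d, dividing F by the tensor relations R gives
  M(W).\<close>

abbreviation F :: "('k, 'g, 'a set \<times> 'g fiarr \<Rightarrow> 'k) fimod" where
  "F \<equiv> freefi (elts Q d) (\<lambda>_. d)"

lemma tfree_F: "tfree W d m = deg F m"
  by (simp add: tfree_eq)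

abbreviation "R \<equiv> tsub W d"

sublocale F: smodule F R
proof unfold_locales
  show "is_fimod F" by (rule freefi_fimod)
  show "sub_fimod F R"
    using w.tsub_ksub[of d] w.push_tsub unfolding sub_fimod_def tfree_F by auto
qed

end

locale top_quotient_map = top_quotient V S d
  for V :: "('k::comm_ring_1, 'g::group_add, 'a) fimod" and S :: "nat \<Rightarrow> 'a set" and d :: nat +
  fixes L :: "nat \<Rightarrow> ('a set \<times> 'g fiarr \<Rightarrow> 'k) \<Rightarrow> 'a set"
  assumes L: "fhom F Q L"
    and L_ind: "x \<in> elts Q d \<Longrightarrow> phi \<in> Hom d n \<Longrightarrow> L n (ind (x, phi)) = fac Q d n phi x"
begin

lemmas L_lin = fhomD(1)[OF L] and L_in = fhomD(2)[OF L] and L_fac = fhomD(3)[OF L]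

lemma L_R: "c \<in> R m \<Longrightarrow> L m c = zer (deg Q m)"
proof -
  assume c: "c \<in> R m"
  have lin: "lin (tfree W d m) (deg Q m) (L m)" using L_lin unfolding tfree_F .
  have "L m c \<in> zr Q m"
  proof (rule w.tsub_lift[OF qm.km qm.ks lin _ c])
    fix x y assume xy: "w.trel d m x y"
    have "L m x = L m y"
      using xy
    proof cases
      case (trel_pls u v phi)
      have uv: "u \<in> elts Q d" "v \<in> elts Q d" using trel_pls by simp_all
      show ?thesis
        unfolding trel_pls(1,2) linD(2)[OF lin w.ind_tfree[OF trel_pls(3,5)] w.ind_tfree[OF trel_pls(4,5)]]
        using L_ind[OF _ trel_pls(5)] uv linD(2)[OF qm.fac_lin[OF trel_pls(5)] uv] by simp
    next
      case (trel_sml u phi a)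
      have u: "u \<in> elts Q d" using trel_sml by simp
      show ?thesis
        unfolding trel_sml(1,2) linD(3)[OF lin w.ind_tfree[OF trel_sml(3,4)]]
        using L_ind[OF _ trel_sml(4)] u linD(3)[OF qm.fac_lin[OF trel_sml(4)] u] by simp
    next
      case (trel_act s u phi)
      have u: "u \<in> elts Q d" using trel_act by simp
      show ?thesis
        unfolding trel_act(1,2)
        using L_ind[OF _ trel_act(5)] L_ind[OF _ comp_Hom[OF trel_act(3,5)]] u trel_act(3) qm.fac_comp[OF trel_act(3,5) u] by simp
    qed
    then show "eqv Q (zr Q) m (L m x) (L m y)"
      using L_in[of x m] w.trel_carr(1)[OF xy] vS.fquot_fimod unfolding tfree_F by simp
  qed
  then show ?thesis by (simp add: zr_def)
qed

text \<open>Below d the quotient Q is zero, in degree d the identities hit everything, and above d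
  it is generated from below.\<close>

lemma L_surj: "v \<in> elts V n \<Longrightarrow> \<exists>c\<in>elts F n. L n c = q n v"
proof (induction n arbitrary: v rule: less_induct)
  case (less n)
  consider "n < d" | "n = d" | "n > d" by linarith
  then show ?case
  proof cases
    case 1
    then have "q n v = zer (deg Q n)" using q_zer[OF less.prems] S_low[OF 1] less.prems by blast
    then show ?thesis using lin_zer[OF F.km qm.km L_lin, of n] F.k_zer by metis
  next
    case 2
    have "L n (ind (q d v, idm d)) = q n v"
      using L_ind[of "q d v" "idm d" d] less.prems 2 by simp
    moreover have "ind (q d v, idm d) \<in> elts F n"
      unfolding freefi_simps using less.prems 2 by (intro ind_carr) simp
    ultimately show ?thesis by blast
  next
    case 3
    let ?T = "{v \<in> elts V n. q n v \<in> L n ` elts F n}"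
    have "ksub (deg V n) ?T"
      by (rule ksub_vimage[OF v.km qm.km q_lin ksub_image[OF F.km qm.km L_lin ksub_carr[OF F.km]]])
    then have "lt V (zr V) n \<subseteq> ?T"
    proof (rule v.lt_min)
      show "zr V n \<subseteq> ?T" using ksubD(2)[OF \<open>ksub (deg V n) ?T\<close>] by (simp add: zr_def)
      fix m x and phi :: "'g fiarr" assume h: "phi \<in> Hom m n" "m < n" "x \<in> elts V m"
      obtain c where c: "c \<in> elts F m" "L m c = q m x" using less.IH[OF h(2,3)] by blast
      have "q n (fac V m n phi x) = L n (fac F m n phi c)"
        using q_fac[OF h(1,3)] L_fac[OF h(1) c(1)] c(2) by simp
      then show "fac V m n phi x \<in> ?T" using F.fac_in[OF h(1) c(1)] v.fac_in[OF h(1,3)] by blast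
    qed
    moreover have "v \<in> lt V (zr V) n" using gen less.prems 3 unfolding gen_le_def by blast
    ultimately have "v \<in> ?T" by (rule subsetD)
    then show ?thesis unfolding mem_Collect_eq image_iff by metis
  qed
qed

text \<open>The pullback of \<open>F \<rightarrow> Q\<close> along \<open>V \<rightarrow> Q\<close> surjects onto \<open>V\<close>, with the same kernel as \<open>F \<rightarrow> Q\<close>.\<close>

abbreviation "A \<equiv> frestrict F (pre F L (zr Q))"

definition Xs :: "nat \<Rightarrow> (('a set \<times> 'g fiarr \<Rightarrow> 'k) \<times> 'a) set" where
  "Xs n = {x. fst x \<in> elts F n \<and> snd x \<in> elts V n \<and> L n (fst x) = q n (snd x)}"

abbreviation "X \<equiv> frestrict (prodfi F V) Xs"

text \<open>The copy of R inside the pullback, so that X / PX is the pullback of M(W) and V over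
  Q.\<close>

definition PX :: "nat \<Rightarrow> (('a set \<times> 'g fiarr \<Rightarrow> 'k) \<times> 'a) set" where
  "PX n = {x. fst x \<in> R n \<and> snd x = zer (deg V n)}"

lemma q_zero: "q n (zer (deg V n)) = zer (deg Q n)"
  using lin_zer[OF v.km qm.km q_lin] .

lemma fac_zero: "phi \<in> Hom n m \<Longrightarrow> fac V n m phi (zer (deg V n)) = zer (deg V m)"
  using lin_zer[OF v.km v.km v.fac_lin] .

lemma Xs_sub: "sub_fimod (prodfi F V) Xs"
  unfolding sub_fimod_def
proof (intro conjI allI ballI)
  show "ksub (deg (prodfi F V) n) (Xs n)" for n
    using lin_zer[OF F.km qm.km L_lin, of n] q_zero F.k_zer F.k_pls F.k_sml
      linD(2,3)[OF L_lin[of n]] linD(2,3)[OF q_lin[of n]]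
    unfolding ksub_def Xs_def by (auto simp del: freefi_simps)
  show "fac (prodfi F V) n m phi ` Xs n \<subseteq> Xs m" if "phi \<in> Hom n m" for n m phi
  proof
    fix y assume "y \<in> fac (prodfi F V) n m phi ` Xs n"
    then obtain x where x: "y = fac (prodfi F V) n m phi x" "fst x \<in> elts F n" "snd x \<in> elts V n"
      "L n (fst x) = q n (snd x)"
      unfolding Xs_def by blast
    show "y \<in> Xs m"
      unfolding Xs_def x(1) prodfi_simps
      using L_fac[OF that x(2)] q_fac[OF that x(3)] x(4) F.fac_in[OF that x(2)] v.fac_in[OF that x(3)] by simp
  qed
qed

lemma PX_sub: "sub_fimod (prodfi F V) PX"
  unfolding sub_fimod_def
proof (intro conjI allI ballI)
  show "ksub (deg (prodfi F V) n) (PX n)" for n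
    using ksubD[OF F.ks[of n]] km_zer_left[OF v.km, of "zer (deg V n)" n] km_sml_zer[OF v.km, of n]
    unfolding ksub_def PX_def by (auto simp del: freefi_simps)
  show "fac (prodfi F V) n m phi ` PX n \<subseteq> PX m" if "phi \<in> Hom n m" for n m phi
    using F.P_fac[OF that] fac_zero[OF that] by (auto simp: PX_def simp del: freefi_simps)
qed

lemma X_smodule: "smodule X PX"
proof (rule smodule_restrict[OF _ Xs_sub])
  show "smodule (prodfi F V) PX" by (rule smodule.intro[OF prodfi_fimod[OF F.fimod V] PX_sub])
  show "PX n \<subseteq> Xs n" for n using F.P_carr L_R q_zero by (auto simp: PX_def Xs_def simp del: freefi_simps)
qed

lemma A_smodule: "smodule A R"
proof (rule smodule_restrict[OF F.smodule_axioms pre_sub_fimod[OF F.fimod qm.fimod L qm.sub]])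
  show "R n \<subseteq> pre F L (zr Q) n" for n using F.P_carr L_R by (auto simp: pre_def zr_def simp del: freefi_simps)
qed

lemma A_iff: "c \<in> elts A n \<longleftrightarrow> c \<in> elts F n \<and> L n c = zer (deg Q n)"
  by (simp add: pre_def zr_def del: freefi_simps)

lemma X_iff: "x \<in> elts X n \<longleftrightarrow> fst x \<in> elts F n \<and> snd x \<in> elts V n \<and> L n (fst x) = q n (snd x)"
  by (simp add: Xs_def del: freefi_simps)

lemma X_ses: "ses A R X PX V (zr V) (\<lambda>n c. (c, zer (deg V n))) (\<lambda>n. snd)"
proof (intro ses.intro ses_axioms.intro)
  interpret X: smodule X PX by (rule X_smodule)
  show "smodule A R" "smodule X PX" "smodule V (zr V)" by (rule A_smodule, rule X_smodule, rule v.smodule_axioms)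
  have fin: "(c, zer (deg V n)) \<in> elts X n" if "c \<in> elts A n" for c n
    using that q_zero unfolding A_iff X_iff by simp
  show "fhom A X (\<lambda>n c. (c, zer (deg V n)))"
    unfolding fhom_def lin_def
    using fin km_zer_left[OF v.km] km_sml_zer[OF v.km] fac_zero by (auto simp del: freefi_simps)
  show "fhom X V (\<lambda>n. snd)" unfolding fhom_def lin_def using X_iff by (auto simp del: freefi_simps)
  show "(c, zer (deg V n)) \<in> PX n \<longleftrightarrow> c \<in> R n" for c n by (simp add: PX_def)
  show "snd x \<in> zr V n \<longleftrightarrow> (\<exists>c\<in>elts A n. eqv X PX n x (c, zer (deg V n)))"
    if x: "x \<in> elts X n" for x n
  proof
    assume "snd x \<in> zr V n"
    then have s: "x = (fst x, zer (deg V n))" by (simp add: zr_def prod_eq_iff)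
    then have "fst x \<in> elts A n" using x q_zero unfolding A_iff X_iff by (metis snd_conv)
    then show "\<exists>c\<in>elts A n. eqv X PX n x (c, zer (deg V n))"
      using s X.c_refl[OF x] by metis
  next
    assume "\<exists>c\<in>elts A n. eqv X PX n x (c, zer (deg V n))"
    then obtain c p where "p \<in> PX n" "x = pls (deg X n) (c, zer (deg V n)) p" by (auto simp: cg_def)
    then show "snd x \<in> zr V n" using km_zer_left[OF v.km, of "zer (deg V n)" n] by (simp add: PX_def zr_def)
  qed
  show "\<exists>x\<in>elts X n. eqv V (zr V) n v (snd x)" if v: "v \<in> elts V n" for v n
  proof -
    obtain c where "c \<in> elts F n" "L n c = q n v" using L_surj[OF v] by blast
    then have "(c, v) \<in> elts X n" using v unfolding X_iff by simp
    then show ?thesis using v V by force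
  qed
qed

text \<open>F is generated in degree d < n, and these generators lift to X; so (c, v) comes from
  lower degrees for some v. The error v lies in S, because L c = 0, and (0, v) comes from lower
  degrees as well. Subtracting gives (c, 0).\<close>

lemma A_lt_X:
  assumes n: "n > d" and c: "c \<in> elts A n"
  shows "(c, zer (deg V n)) \<in> lt X PX n"
proof -
  interpret X: smodule X PX by (rule X_smodule)
  note lk = X.lt_ksub[of n]
  let ?T = "{c \<in> elts F n. \<exists>v. (c, v) \<in> lt X PX n}"
  have "ksub (deg F n) ?T"
    unfolding ksub_def
  proof (intro conjI ballI allI)
    show "zer (deg F n) \<in> ?T" using ksubD(2)[OF lk] F.k_zer[of n] by (auto simp del: freefi_simps)
  next
    fix x y assume "x \<in> ?T" "y \<in> ?T"
    then obtain u v where "(x, u) \<in> lt X PX n" "(y, v) \<in> lt X PX n" and xy: "x \<in> elts F n" "y \<in> elts F n" by blast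
    then show "pls (deg F n) x y \<in> ?T" using ksubD(3)[OF lk, of "(x, u)" "(y, v)"] F.k_pls[OF xy] by (auto simp del: freefi_simps)
  next
    fix a x assume "x \<in> ?T"
    then obtain u where "(x, u) \<in> lt X PX n" and x: "x \<in> elts F n" by blast
    then show "sml (deg F n) a x \<in> ?T" using ksubD(4)[OF lk, of "(x, u)" a] F.k_sml[OF x] by (auto simp del: freefi_simps)
  qed blast
  moreover have "ind p \<in> ?T" if pk: "p \<in> keys (elts Q d) (\<lambda>_. d) n" for p
  proof -
    obtain w phi where p: "p = (w, phi)" "w \<in> elts Q d" "phi \<in> Hom d n" using pk by blast
    then obtain v where v: "v \<in> elts V d" "w = q d v" unfolding q_carr by blast
    have i: "(ind (w, idm d) :: _ \<Rightarrow> 'k) \<in> elts F d"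
      unfolding freefi_simps using p(2) by (intro ind_carr) simp
    have "(ind (w, idm d), v) \<in> elts X d"
      unfolding X_iff using i v L_ind[OF p(2), of "idm d" d] by simp
    then have "fac X d n phi (ind (w, idm d), v) \<in> lt X PX n" using X.lt_gen[OF p(3) n] by blast
    moreover have "push phi (ind (w, idm d) :: _ \<Rightarrow> 'k) = ind p"
      using push_ind[where d="\<lambda>_. d", OF p(3) p(2), of "idm d"] p by simp
    ultimately have "(ind p, fac V d n phi v) \<in> lt X PX n" by simp
    moreover have "(ind p :: _ \<Rightarrow> 'k) \<in> elts F n"
      unfolding freefi_simps using pk by (rule ind_carr)
    ultimately show ?thesis by blast
  qed
  ultimately have "c \<in> ?T" using freek_span[of "keys (elts Q d) (\<lambda>_. d) n" ?T c] c unfolding A_iff freefi_simps by blast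
  then obtain v where v: "(c, v) \<in> lt X PX n" by blast
  have "(c, v) \<in> elts X n" by (rule X.lt_carr[OF v])
  then have "v \<in> elts V n" "q n v = zer (deg Q n)" using c unfolding A_iff X_iff by simp_all
  then have vS: "v \<in> S n" using q_zer by blast
  \<comment> \<open>S is generated in degrees below d. There Q is zero, so (0, x) belongs to the
    pullback for every x in V.\<close>
  let ?U = "{v \<in> elts V n. (zer (deg F n), v) \<in> lt X PX n}"
  have Uz: "pls (deg F n) (zer (deg F n)) (zer (deg F n)) = zer (deg F n)" "sml (deg F n) a (zer (deg F n)) = zer (deg F n)" for a
    using km_zer_left[OF F.km, of "zer (deg F n)" n] km_sml_zer[OF F.km, of n] F.k_zer by blast+
  have "ksub (deg V n) ?U"
    unfolding ksub_def
  proof (intro conjI ballI allI)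
    show "zer (deg V n) \<in> ?U" using ksubD(2)[OF lk] v.k_zer by simp
  next
    fix x y assume "x \<in> ?U" "y \<in> ?U"
    then show "pls (deg V n) x y \<in> ?U"
      using ksubD(3)[OF lk, of "(zer (deg F n), x)" "(zer (deg F n), y)"] Uz by (simp del: freefi_simps)
  next
    fix a x assume "x \<in> ?U"
    then show "sml (deg V n) a x \<in> ?U"
      using ksubD(4)[OF lk, of "(zer (deg F n), x)" a] Uz by (simp del: freefi_simps)
  qed blast
  then have "S n \<subseteq> ?U"
  proof (rule S_min)
    fix m x and phi :: "'g fiarr" assume h: "m < d" "phi \<in> Hom m n" "x \<in> elts V m"
    have "(zer (deg F m), x) \<in> elts X m"
      unfolding X_iff using h F.k_zer lin_zer[OF F.km qm.km L_lin, of m] q_zer[OF h(3)] S_low[OF h(1)] by simp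
    moreover have "m < n" using h(1) n by simp
    ultimately have "fac X m n phi (zer (deg F m), x) \<in> lt X PX n" using X.lt_gen[OF h(2)] by blast
    moreover have "fac F m n phi (zer (deg F m)) = zer (deg F n)" by (rule lin_zer[OF F.km F.km F.fac_lin[OF h(2)]])
    ultimately have "(zer (deg F n), fac V m n phi x) \<in> lt X PX n" by simp
    then show "fac V m n phi x \<in> ?U" using h by simp
  qed
  then have z: "(zer (deg F n), v) \<in> lt X PX n" and vc: "v \<in> elts V n" using vS by auto
  have cF: "c \<in> elts F n" using c unfolding A_iff by blast
  have "pls (deg X n) (c, v) (sml (deg X n) (-1) (zer (deg F n), v)) \<in> lt X PX n"
    by (rule ksubD(3)[OF lk v ksubD(4)[OF lk z]])
  moreover have "pls (deg X n) (c, v) (sml (deg X n) (-1) (zer (deg F n), v)) = (c, zer (deg V n))"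
    using Uz km_zer_right[OF F.km cF] km_neg_right[OF v.km vc] by (simp del: freefi_simps)
  ultimately show ?thesis by simp
qed

text \<open>In degree d all morphisms are automorphisms and can be absorbed into W by the tensor
  relations. So modulo R each element is a single w with identity morphism, and L recovers
  w.\<close>

lemma R_top:
  assumes "c \<in> elts F d" "L d c = zer (deg Q d)"
  shows "c \<in> R d"
proof -
  let ?i = "\<lambda>w. ind (w, idm d) :: 'a set \<times> 'g fiarr \<Rightarrow> 'k"
  have i: "?i w \<in> elts F d" if "w \<in> elts Q d" for w
    using w.ind_tfree[of w d "idm d" d] that unfolding tfree_F by simp
  let ?T = "{c. \<exists>w\<in>elts Q d. eqv F R d c (?i w)}"
  have p: "eqv F R d (?i (pls (deg Q d) u v)) (pls (deg F d) (?i u) (?i v))"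
    if "u \<in> elts Q d" "v \<in> elts Q d" for u v
    using w.trel_cg[OF w.trel_pls[of u d v "idm d" d]] that unfolding tfree_F W_simps by simp
  have s: "eqv F R d (?i (sml (deg Q d) a u)) (sml (deg F d) a (?i u))"
    if "u \<in> elts Q d" for u a
    using w.trel_cg[OF w.trel_sml[of u d "idm d" d a]] that unfolding tfree_F W_simps by simp
  have z: "eqv F R d (zer (deg F d)) (?i (zer (deg Q d)))"
    using F.c_sym[OF s[of "zer (deg Q d)" 0]] km_sml_zero[OF F.km i] km_sml_zero[OF qm.km] qm.k_zer
    by (simp del: freefi_simps)
  have "ksub (deg F d) ?T"
    unfolding ksub_def
  proof (intro conjI ballI allI)
    show "?T \<subseteq> elts F d" by (auto simp: cg_def simp del: freefi_simps)
    show "zer (deg F d) \<in> ?T" using z qm.k_zer by blast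
  next
    fix x y assume "x \<in> ?T" "y \<in> ?T"
    then obtain u v where u: "u \<in> elts Q d" "v \<in> elts Q d" "eqv F R d x (?i u)" "eqv F R d y (?i v)" by blast
    have "eqv F R d (pls (deg F d) x y) (?i (pls (deg Q d) u v))"
      by (rule F.c_trans[OF F.c_pls[OF u(3,4)] F.c_sym[OF p[OF u(1,2)]]])
    then show "pls (deg F d) x y \<in> ?T" using u qm.k_pls by blast
  next
    fix a x assume "x \<in> ?T"
    then obtain u where u: "u \<in> elts Q d" "eqv F R d x (?i u)" by blast
    have "eqv F R d (sml (deg F d) a x) (?i (sml (deg Q d) a u))"
      by (rule F.c_trans[OF F.c_sml[OF u(2)] F.c_sym[OF s[OF u(1)]]])
    then show "sml (deg F d) a x \<in> ?T" using u qm.k_sml by blast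
  qed
  moreover have "ind p \<in> ?T" if pk: "p \<in> keys (elts Q d) (\<lambda>_. d) d" for p
  proof -
    obtain w phi where p: "p = (w, phi)" "w \<in> elts Q d" "phi \<in> Hom d d" using pk by blast
    have "eqv F R d (?i (fac Q d d phi w)) (ind p)"
      using w.trel_cg[OF w.trel_act[of phi d w "idm d" d]] p unfolding tfree_F W_simps by simp
    then show ?thesis using F.c_sym qm.fac_in[OF p(3,2)] by blast
  qed
  ultimately have "c \<in> ?T"
    using freek_span[of "keys (elts Q d) (\<lambda>_. d) d" ?T c] assms(1) unfolding freefi_simps by blast
  then obtain w where w: "w \<in> elts Q d" "eqv F R d c (?i w)" by blast
  obtain r where r: "r \<in> R d" "c = pls (deg F d) (?i w) r" using w(2) by (auto simp: cg_def simp del: freefi_simps)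
  have "L d c = pls (deg Q d) (L d (?i w)) (L d r)"
    unfolding r(2) by (rule linD(2)[OF L_lin i[OF w(1)] F.P_carr[OF r(1)]])
  then have "L d c = w" using L_R[OF r(1)] L_ind[OF w(1), of "idm d" d] w(1) km_zer_right[OF qm.km w(1)] by simp
  then have "eqv F R d c (zer (deg F d))" using w(2) assms(2) F.c_trans[OF w(2)] F.c_sym[OF z] by simp
  then show ?thesis by (rule F.c_zer(2))
qed

text \<open>Below d the module F is zero. Above d, acyclicity of V turns \<open>A_lt_X\<close> into
  the statement that the kernel A is generated from lower degrees modulo R, where it is contained in
  R by induction.\<close>

lemma L_kernel: "c \<in> elts F n \<Longrightarrow> L n c = zer (deg Q n) \<Longrightarrow> c \<in> R n"
proof (induction n arbitrary: c rule: less_induct)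
  case (less n)
  consider "n < d" | "n = d" | "n > d" by linarith
  then show ?case
  proof cases
    case 1
    have nk: "p \<notin> keys (elts Q d) (\<lambda>_. d) n" for p :: "'a set \<times> 'g fiarr" using Hom_card_le[of "snd p" d n] 1 by (cases p) auto
    have "c p = 0" for p by (rule freek_supp[OF less.prems(1)[unfolded freefi_simps] nk])
    then have "c = zer (deg F n)" unfolding freefi_simps freek_simps by (rule ext)
    then show ?thesis using ksubD(2)[OF F.ks] by simp
  next
    case 2
    then show ?thesis using R_top less.prems by blast
  next
    case 3
    interpret A: smodule A R by (rule A_smodule)
    have cA: "c \<in> elts A n" using less.prems unfolding A_iff by blast
    have "c \<in> lt A R n" using A_lt_X[OF 3 cA] by (rule acy_H0_inj[OF X_ses acyV cA])
    moreover have "lt A R n \<subseteq> R n"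
    proof (rule A.lt_min[OF A.ks order_refl])
      fix m x and phi :: "'g fiarr" assume h: "phi \<in> Hom m n" "m < n" "x \<in> elts A m"
      then have "x \<in> R m" using less.IH[OF h(2)] unfolding A_iff by blast
      then show "fac A m n phi x \<in> R n" by (rule A.P_fac[OF h(1)])
    qed
    ultimately show ?thesis by blast
  qed
qed

lemma tsub_other: "n \<noteq> d \<Longrightarrow> c \<in> carr (tfree W n m) \<Longrightarrow> c \<in> tsub W n m"
proof -
  assume n: "n \<noteq> d" and c: "c \<in> carr (tfree W n m)"
  have "ind p \<in> tsub W n m" if "p \<in> carr (bdeg W n) \<times> Hom n m" for p
  proof -
    obtain phi where p: "p = (undefined, phi)" "phi \<in> Hom n m" using \<open>p \<in> carr (bdeg W n) \<times> Hom n m\<close> n by auto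
    \<comment> \<open>In the zero module 0 times w is w, so the scalar relation for 0 identifies
      every basis element with 0.\<close>
    have "cg (tfree W n m) (tsub W n m) (ind p) (sml (tfree W n m) 0 (ind p))"
      using w.trel_cg[OF w.trel_sml[of undefined n phi m 0]] p n by simp
    moreover have "sml (tfree W n m) 0 (ind p) = zer (tfree W n m)" by (simp add: tfree_def)
    ultimately show ?thesis using cg_zer(2)[OF tfree_kmod w.tsub_ksub] by metis
  qed
  then show ?thesis using freek_span[OF w.tsub_ksub[unfolded tfree_def]] c unfolding tfree_def by blast
qed

lemma map_relproj: "relproj Q"
proof -
  define g where "g = (\<lambda>m (x :: nat \<Rightarrow> 'a set \<times> 'g fiarr \<Rightarrow> 'k). L m (x d))"
  have xd: "x d \<in> elts F m" if "x \<in> elts w.TW m" for x m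
    using that unfolding w.TW_simps tfree_F[symmetric] by blast
  have g: "fhom w.TW Q g"
    unfolding fhom_def lin_def g_def
  proof (intro conjI allI ballI image_subsetI)
    fix n x assume "x \<in> elts w.TW n"
    then show "L n (x d) \<in> elts Q n" using L_in xd by blast
  next
    fix n x y assume "x \<in> elts w.TW n" "y \<in> elts w.TW n"
    then show "L n (pls (deg w.TW n) x y d) = pls (deg Q n) (L n (x d)) (L n (y d))"
      using linD(2)[OF L_lin xd xd] unfolding w.TW_simps tfree_F by simp
  next
    fix n a x assume "x \<in> elts w.TW n"
    then show "L n (sml (deg w.TW n) a x d) = sml (deg Q n) a (L n (x d))"
      using linD(3)[OF L_lin xd] unfolding w.TW_simps tfree_F by simp
  next
    fix n m x and phi :: "'g fiarr" assume "phi \<in> Hom n m" "x \<in> elts w.TW n"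
    then show "L m (fac w.TW n m phi x d) = fac Q n m phi (L n (x d))"
      using L_fac xd unfolding w.TW_simps freefi_simps by blast
  qed
  have gs: "g n ` elts w.TW n = elts Q n" for n
  proof
    show "g n ` elts w.TW n \<subseteq> elts Q n" using fhomD(2)[OF g] by blast
    show "elts Q n \<subseteq> g n ` elts w.TW n"
    proof
      fix y assume "y \<in> elts Q n"
      then obtain v where v: "v \<in> elts V n" "y = q n v" unfolding q_carr by blast
      obtain c where c: "c \<in> elts F n" "L n c = q n v" using L_surj[OF v(1)] by blast
      let ?x = "(\<lambda>k. zer (tfree W k n))(d := c)"
      have "?x \<in> elts w.TW n" using c(1) unfolding w.TW_simps tfree_F[symmetric] by (simp add: km_zer[OF tfree_kmod])
      moreover have "g n ?x = y" using c v by (simp add: g_def)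
      ultimately show "y \<in> g n ` elts w.TW n" by blast
    qed
  qed
  have gk: "g n x = zer (deg Q n) \<longleftrightarrow> x \<in> w.TP n" if x: "x \<in> elts w.TW n" for n x
  proof
    assume "g n x = zer (deg Q n)"
    then have "x d \<in> tsub W d n" using L_kernel[OF xd[OF x]] by (simp add: g_def)
    moreover have "x k \<in> carr (tfree W k n)" for k using x by simp
    ultimately have "x k \<in> tsub W k n" for k using tsub_other by (cases "k = d") blast+
    then show "x \<in> w.TP n" unfolding w.TP_def by blast
  next
    assume "x \<in> w.TP n"
    then show "g n x = zer (deg Q n)" using L_R by (simp add: w.TP_def g_def)
  qed
  interpret TW: smodule w.TW w.TP by (rule w.TW_smodule)
  obtain h where "fiso (MW W) Q h"
    by (rule fiso_kernel[OF TW.fimod w.MW_fimod vS.fquot_fimod w.MW_fhom g w.MW_carr[symmetric] gs])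
       (simp only: gk w.toMW_zer_iff)
  then show ?thesis unfolding relproj_def using W_fbmod by blast
qed

end

lemma (in top_quotient) quotient_relproj: "relproj Q"
proof -
  obtain L where L: "fhom F Q L"
    "\<And>n x phi. x \<in> elts Q d \<Longrightarrow> phi \<in> Hom d n \<Longrightarrow> L n (ind (x, phi)) = fac Q d n phi x"
    by (rule freefi_hom[OF vS.fquot_fimod, of "elts Q d" "\<lambda>x. x" "\<lambda>_. d"]) auto
  interpret top_quotient_map V S d L by unfold_locales (use L in auto)
  show ?thesis by (rule map_relproj)
qed

text \<open>One step down the filtration: if the larger term is acyclic, the quotient is relatively
  projective, hence acyclic, and then so is the smaller term.\<close>

lemma gsub_step:
  assumes VV: "is_fimod V" and acy: "acy (frestrict V (gsub V (Suc j))) (zr V)"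
  shows "relproj (fquot (frestrict V (gsub V (Suc j))) (gsub V j))" "acy (frestrict V (gsub V j)) (zr V)"
proof -
  let ?U = "frestrict V (gsub V (Suc j))"
  note sub = gsub_sub[OF VV]
  interpret top_quotient ?U "gsub V j" j
  proof
    show "is_fimod ?U" by (rule frestrict_fimod[OF VV sub])
    show "acy ?U (zr ?U)" using acy by simp
    show "sub_fimod ?U (gsub V j)" by (rule sub_fimod_restrict[OF sub sub gsub_mono[OF VV]])
    show "gsub V j n = elts ?U n" if "n < j" for n using that gsub_low[OF VV] by simp
    show "gen_le j ?U (zr ?U)" using gsub_gen_le[OF VV] by simp
    fix T n
    assume T: "ksub (deg ?U n) T" and gen: "\<And>m phi x. m < j \<Longrightarrow> phi \<in> Hom m n \<Longrightarrow> x \<in> elts ?U m \<Longrightarrow> fac ?U m n phi x \<in> T"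
    have "ksub (deg V n) T" using T gsub_carr[OF VV, of "Suc j" n] unfolding ksub_def by auto
    then show "gsub V j n \<subseteq> T" by (rule gsub_min) (use gen gsub_low[OF VV] in auto)
  qed
  show rp: "relproj Q" by (rule quotient_relproj)
  have "acy ?U (gsub V j)" using relproj_acy[OF vS.fquot_fimod rp] vS.fquot_acy by simp
  then show "acy (frestrict V (gsub V j)) (zr V)"
    using acy_left[OF sub_ses[OF VV sub sub gsub_mono[OF VV]] acy] by blast
qed

lemma filtered_if_acy:
  assumes V: "is_fimod V" and acy: "acy V (zr V)" and gen: "gen_le r V (zr V)"
  shows "sharp_filtered V"
proof -
  have top: "gsub V (Suc r) = (\<lambda>n. elts V n)" using gsub_top[OF V gen] by auto
  have a: "acy (frestrict V (gsub V j)) (zr V)" if "j \<le> Suc r" for j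
    using that
  proof (induction rule: inc_induct)
    case base show ?case using acy unfolding top frestrict_carr .
  next
    case (step n) then show ?case using gsub_step(2)[OF V] by blast
  qed
  have "relproj (fquot (frestrict V (gsub V j)) (gsub V (j - 1)))" if "1 \<le> j" "j \<le> Suc r" for j
    using gsub_step(1)[OF V, of "j - 1"] a[of j] that by simp
  moreover have "gsub V (j - 1) m \<subseteq> gsub V j m" if "1 \<le> j" for j m
    using gsub_mono[OF V, of "j - 1" m] that by simp
  ultimately show ?thesis
    unfolding sharp_filtered_def
    by (intro exI[of _ "Suc r"] exI[of _ "gsub V"]) (simp add: gsub_sub[OF V] gsub_0[OF V] top)
qed

text \<open>In degree n > m every basis element of the free module is the image of a generator of
  degree at most m, hence comes from a lower degree; this survives in the image.\<close>

lemma gen_deg_le: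
  fixes V :: "('k::comm_ring_1, 'g::group_add, 'a) fimod"
  assumes V: "is_fimod V" and gen: "gen_deg V m"
  shows "gen_le m V (zr V)"
  unfolding gen_le_def
proof (intro allI impI subsetI)
  obtain I :: "('a, 'k, 'g) ix set" and d h where I: "\<forall>i\<in>I. d i \<le> m" and h: "fhom (freefi I d) V h" "fsurj (freefi I d) V h"
    using gen unfolding gen_deg_def by blast
  let ?F = "freefi I d :: ('k, 'g, ('a, 'k, 'g) ix \<times> 'g fiarr \<Rightarrow> 'k) fimod"
  interpret F: smodule ?F "zr ?F" by (rule zr_smodule[OF freefi_fimod])
  have "h n (zer (deg ?F n)) = zer (deg V n)" for n
    using lin_zer[OF F.km fimodD(1)[OF V] fhomD(1)[OF h(1)]] .
  then interpret ssurj ?F "zr ?F" V "zr V" h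
    by (intro ssurj_zr[OF F.smodule_axioms V h(1)]) (use h(2) in \<open>auto simp: fsurj_def zr_def\<close>)
  fix n x assume n: "m < n" and "x \<in> elts V n"
  then obtain c where c: "c \<in> elts ?F n" "x = h n c" using h(2) unfolding fsurj_def by blast
  have "(ind p :: _ \<Rightarrow> 'k) \<in> lt ?F (zr ?F) n" if pk: "p \<in> keys I d n" for p
  proof -
    obtain i phi where p: "p = (i, phi)" "i \<in> I" "phi \<in> Hom (d i) n" using pk by blast
    have "(ind (i, idm (d i)) :: _ \<Rightarrow> 'k) \<in> elts ?F (d i)"
      unfolding freefi_simps using p(2) by (intro ind_carr) simp
    then have "fac ?F (d i) n phi (ind (i, idm (d i)) :: _ \<Rightarrow> 'k) \<in> lt ?F (zr ?F) n"
      using F.lt_gen[OF p(3)] I p(2) n by fastforce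
    moreover have "push phi (ind (i, idm (d i)) :: _ \<Rightarrow> 'k) = ind p"
      using push_ind[where d=d, OF p(3,2), of "idm (d i)"] p by simp
    ultimately show ?thesis by simp
  qed
  then have "c \<in> lt ?F (zr ?F) n" using freek_span[of "keys I d n" "lt ?F (zr ?F) n" c] F.lt_ksub[of n] c(1) unfolding freefi_simps by blast
  then show "x \<in> lt V (zr V) n" unfolding c(2) by (rule g_lt)
qed

subsection \<open>Chains of surjections\<close>

definition qmap :: "('k, 'g::group_add, 'a) fimod \<Rightarrow> (nat \<Rightarrow> 'a set) \<Rightarrow> nat \<Rightarrow> 'a set \<Rightarrow> 'a set" where
  "qmap V S' n C = kcoset (deg V n) (S' n) (SOME x. x \<in> C)"

text \<open>The kernel of V / S -> V / S' consists of the cosets of S in S', which are literally the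
  elements of the quotient of S' by S. Hence the third statement is an equality, and relative
  projectivity transfers without an isomorphism.\<close>

lemma
  fixes V :: "('k::comm_ring_1, 'g::group_add, 'a) fimod"
  assumes V: "is_fimod V" and S: "sub_fimod V S" "sub_fimod V S'" "\<And>n. S n \<subseteq> S' n"
  shows qmap_fhom: "fhom (fquot V S) (fquot V S') (qmap V S')"
    and qmap_fsurj: "fsurj (fquot V S) (fquot V S') (qmap V S')"
    and qmap_ker: "frestrict (fquot V S) (fker (fquot V S) (fquot V S') (qmap V S')) = fquot (frestrict V S') S"
proof -
  interpret a: smodule V S by unfold_locales fact+
  interpret b: smodule V S' by unfold_locales fact+
  let ?q = "\<lambda>n. kcoset (deg V n) (S n)" and ?q' = "\<lambda>n. kcoset (deg V n) (S' n)"
  have qm: "qmap V S' n (?q n x) = ?q' n x" if "x \<in> elts V n" for n x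
  proof -
    have c: "eqv V S' n (SOME y. y \<in> ?q n x) x"
      by (rule cg_mono[OF kcoset_some[OF a.km a.ks that] S(3)])
    then show ?thesis unfolding qmap_def using kcoset_eq_iff[OF b.km b.ks cg_carr(1)[OF c] that] by simp
  qed
  have carr: "elts (fquot V S) n = ?q n ` elts V n" "elts (fquot V S') n = ?q' n ` elts V n" for n
    by (simp_all add: fquot_def kquot_def)
  note q = a.fquot_fhom and q' = b.fquot_fhom
  show "fhom (fquot V S) (fquot V S') (qmap V S')"
    unfolding fhom_def lin_def carr
  proof (intro conjI allI ballI image_subsetI)
    fix n C assume "C \<in> ?q n ` elts V n"
    then show "qmap V S' n C \<in> ?q' n ` elts V n" using qm by auto
  next
    fix n C D assume "C \<in> ?q n ` elts V n" "D \<in> ?q n ` elts V n"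
    then obtain x y where x: "x \<in> elts V n" "C = ?q n x" and y: "y \<in> elts V n" "D = ?q n y" by blast
    show "qmap V S' n (pls (deg (fquot V S) n) C D) = pls (deg (fquot V S') n) (qmap V S' n C) (qmap V S' n D)"
      unfolding x(2) y(2) qm[OF x(1)] qm[OF y(1)] linD(2)[OF fhomD(1)[OF q] x(1) y(1), symmetric]
        linD(2)[OF fhomD(1)[OF q'] x(1) y(1), symmetric] by (rule qm[OF a.k_pls[OF x(1) y(1)]])
  next
    fix n a C assume "C \<in> ?q n ` elts V n"
    then obtain x where x: "x \<in> elts V n" "C = ?q n x" by blast
    show "qmap V S' n (sml (deg (fquot V S) n) a C) = sml (deg (fquot V S') n) a (qmap V S' n C)"
      unfolding x(2) qm[OF x(1)] linD(3)[OF fhomD(1)[OF q] x(1), symmetric]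
        linD(3)[OF fhomD(1)[OF q'] x(1), symmetric] by (rule qm[OF a.k_sml[OF x(1)]])
  next
    fix n m C and phi :: "'g fiarr" assume phi: "phi \<in> Hom n m" and "C \<in> ?q n ` elts V n"
    then obtain x where x: "x \<in> elts V n" "C = ?q n x" by blast
    show "qmap V S' m (fac (fquot V S) n m phi C) = fac (fquot V S') n m phi (qmap V S' n C)"
      unfolding x(2) qm[OF x(1)] fhomD(3)[OF q phi x(1), symmetric]
        fhomD(3)[OF q' phi x(1), symmetric] by (rule qm[OF a.fac_in[OF phi x(1)]])
  qed
  show "fsurj (fquot V S) (fquot V S') (qmap V S')"
    unfolding fsurj_def carr using qm by (auto simp: image_iff)
  have "fker (fquot V S) (fquot V S') (qmap V S') n = ?q n ` S' n" for n
  proof -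
    have "qmap V S' n (?q n x) = zer (deg (fquot V S') n) \<longleftrightarrow> x \<in> S' n" if "x \<in> elts V n" for x
      unfolding qm[OF that] using kcoset_zer_iff[OF b.km b.ks that] by (simp add: fquot_def)
    then show ?thesis unfolding fker_def carr using b.P_carr by blast
  qed
  then have "fker (fquot V S) (fquot V S') (qmap V S') = (\<lambda>n. ?q n ` S' n)" by auto
  then show "frestrict (fquot V S) (fker (fquot V S) (fquot V S') (qmap V S')) = fquot (frestrict V S') S"
    by (simp add: frestrict_def fquot_def kquot_def)
qed

lemma filtered_surj_chain:
  fixes V :: "('k::comm_ring_1, 'g::group_add, 'a) fimod"
  assumes V: "is_fimod V" and "sharp_filtered V"
  shows "surj_chain TYPE('a set) V"
proof -
  obtain N :: nat and S :: "nat \<Rightarrow> nat \<Rightarrow> 'a set" where "(\<forall>j\<le>N. sub_fimod V (S j)) \<and> (\<forall>m. S 0 m = {zer (deg V m)}) \<and> (\<forall>m. S N m = elts V m) \<and>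
    (\<forall>j. 1 \<le> j \<and> j \<le> N \<longrightarrow> (\<forall>m. S (j - 1) m \<subseteq> S j m) \<and> relproj (fquot (frestrict V (S j)) (S (j - 1))))"
    using assms(2) unfolding sharp_filtered_def by blast
  then have S: "\<And>j. j \<le> N \<Longrightarrow> sub_fimod V (S j)" "\<And>m. S 0 m = {zer (deg V m)}"
    "\<And>m. S N m = elts V m"
    "\<And>j m. 1 \<le> j \<Longrightarrow> j \<le> N \<Longrightarrow> S (j - 1) m \<subseteq> S j m"
    "\<And>j. 1 \<le> j \<Longrightarrow> j \<le> N \<Longrightarrow> relproj (fquot (frestrict V (S j)) (S (j - 1)))"
    by simp_all
  have sm: "smodule V (S j)" if "j \<le> N" for j using V S(1)[OF that] by (rule smodule.intro)
  \<comment> \<open>The chain consists of modules of cosets, so V enters it as its quotient by the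
    zero submodule.\<close>
  obtain h where h: "fiso V (fquot V (S 0)) h"
  proof (rule fiso_kernel[OF V V smodule.fquot_fimod[OF sm[of 0]] _ smodule.fquot_fhom[OF sm[of 0]]])
    interpret smodule V "S 0" by (rule sm) simp
    show "fhom V V (\<lambda>n x. x)" by (auto simp: fhom_def lin_def)
    show "kcoset (deg V n) (S 0 n) ` elts V n = elts (fquot V (S 0)) n" for n by (simp add: fquot_def kquot_def)
    show "x = zer (deg V n) \<longleftrightarrow> kcoset (deg V n) (S 0 n) x = zer (deg (fquot V (S 0)) n)" if "x \<in> elts V n" for n x
      using kcoset_zer_iff[OF km ks that] S(2) by (simp add: fquot_def)
  qed auto
  \<comment> \<open>Larger submodules have smaller quotients, so the filtration is run through
    backwards.\<close>
  define Q where "Q = (\<lambda>j. fquot V (S (N - j)))"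
  have "fzero (Q 0)"
    unfolding fzero_def
  proof
    interpret smodule V "S N" by (rule sm) simp
    fix n
    have "kcoset (deg V n) (S N n) x = zer (deg (fquot V (S N)) n)" if "x \<in> elts V n" for x
      using kcoset_zer_iff[OF km ks that] S(3) that by (simp add: fquot_def)
    moreover have "elts (fquot V (S N)) n = kcoset (deg V n) (S N n) ` elts V n" by (simp add: fquot_def kquot_def)
    moreover have "elts V n \<noteq> {}" using k_zer[of n] by blast
    ultimately show "elts (Q 0) n = {zer (deg (Q 0) n)}" unfolding Q_def by auto
  qed
  moreover have "fhom (Q j) (Q (j - 1)) (qmap V (S (N - (j - 1)))) \<and> fsurj (Q j) (Q (j - 1)) (qmap V (S (N - (j - 1))))
     \<and> relproj (frestrict (Q j) (fker (Q j) (Q (j - 1)) (qmap V (S (N - (j - 1))))))" if j: "1 \<le> j" "j \<le> N" for j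
  proof -
    have e: "N - j = N - (j - 1) - 1" "1 \<le> N - (j - 1)" "N - (j - 1) \<le> N" using j by auto
    have le: "S (N - j) n \<subseteq> S (N - (j - 1)) n" for n using S(4)[OF e(2,3)] e(1) by metis
    have s: "sub_fimod V (S (N - j))" "sub_fimod V (S (N - (j - 1)))" using S(1) by simp_all
    show ?thesis
      unfolding Q_def qmap_ker[OF V s le] using qmap_fhom[OF V s le] qmap_fsurj[OF V s le] S(5)[OF e(2,3)] e(1) by metis
  qed
  moreover have "is_fimod (Q j)" for j
    unfolding Q_def by (rule smodule.fquot_fimod[OF sm]) simp
  moreover have "fiso V (Q N) h" using h by (simp add: Q_def)
  ultimately show ?thesis
    unfolding surj_chain_def
    by (intro exI[of _ N] exI[of _ Q] exI[of _ "\<lambda>j. qmap V (S (N - (j - 1)))"] exI[of _ h]) blast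
qed

lemma fker_pre: "fker B C g = pre B g (zr C)"
  by (simp add: fker_def pre_def zr_def fun_eq_iff)

lemma fker_sub: "is_fimod B \<Longrightarrow> is_fimod C \<Longrightarrow> fhom B C g \<Longrightarrow> sub_fimod B (fker B C g)"
  unfolding fker_pre by (rule pre_sub_fimod) (use smodule.sub[OF zr_smodule] in blast)+

lemma kernel_ses:
  assumes B: "is_fimod B" and C: "is_fimod C" and g: "fhom B C g" "\<And>n. g n ` elts B n = elts C n"
  shows "ses (frestrict B (fker B C g)) (zr B) B (zr B) C (zr C) (\<lambda>n x. x) g"
proof -
  have "g n (zer (deg B n)) = zer (deg C n)" for n
    using lin_zer[OF fimodD(1)[OF B] fimodD(1)[OF C] fhomD(1)[OF g(1)]] .
  then have "ssurj B (zr B) C (zr C) g"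
    by (intro ssurj_zr[OF zr_smodule[OF B] C g]) (auto simp: zr_def)
  then show ?thesis unfolding fker_pre by (rule ssurj.ker_ses)
qed

lemma image_ses:
  assumes B: "is_fimod B" and C: "is_fimod C" and g: "fhom B C g" and Z: "sub_fimod C Z" "fimg B g = Z"
  shows "ses (frestrict B (fker B C g)) (zr B) B (zr B) (frestrict C Z) (zr C) (\<lambda>n x. x) g"
proof -
  have i: "g n ` elts B n = Z n" for n using Z(2) by (auto simp: fimg_def)
  have "lin (deg B n) (deg (frestrict C Z) n) (g n)" for n
    using fhomD(1)[OF g, of n] i[of n] unfolding lin_def by simp
  then have "fhom B (frestrict C Z) g" using fhomD(3)[OF g] by (simp add: fhom_def)
  then have "ses (frestrict B (fker B (frestrict C Z) g)) (zr B) B (zr B) (frestrict C Z) (zr (frestrict C Z)) (\<lambda>n x. x) g"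
    by (intro kernel_ses[OF B frestrict_fimod[OF C Z(1)]]) (use i in simp_all)
  moreover have "fker B (frestrict C Z) g = fker B C g" by (simp add: fker_def fun_eq_iff)
  ultimately show ?thesis by simp
qed

lemma fzero_acy: "is_fimod V \<Longrightarrow> fzero V \<Longrightarrow> acy V (zr V)"
  by (rule acy_trivial[OF zr_smodule]) (simp_all add: fzero_def zr_def)

lemma surj_chain_acy:
  fixes V :: "('k::comm_ring_1, 'g::group_add, 'a) fimod"
  assumes V: "is_fimod V" and "surj_chain TYPE('q) V"
  shows "acy V (zr V)"
proof -
  obtain N :: nat and Q :: "nat \<Rightarrow> ('k, 'g, 'q) fimod" and pi h where "(\<forall>j\<le>N. is_fimod (Q j)) \<and> fiso V (Q N) h \<and> fzero (Q 0)
    \<and> (\<forall>j. 1 \<le> j \<and> j \<le> N \<longrightarrow> fhom (Q j) (Q (j - 1)) (pi j) \<and> fsurj (Q j) (Q (j - 1)) (pi j)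
           \<and> relproj (frestrict (Q j) (fker (Q j) (Q (j - 1)) (pi j))))"
    using assms(2) unfolding surj_chain_def by blast
  then have Q: "\<And>j. j \<le> N \<Longrightarrow> is_fimod (Q j)" "fiso V (Q N) h" "fzero (Q 0)"
    "\<And>j. Suc j \<le> N \<Longrightarrow> fhom (Q (Suc j)) (Q j) (pi (Suc j))"
    "\<And>j. Suc j \<le> N \<Longrightarrow> fsurj (Q (Suc j)) (Q j) (pi (Suc j))"
    "\<And>j. Suc j \<le> N \<Longrightarrow> relproj (frestrict (Q (Suc j)) (fker (Q (Suc j)) (Q j) (pi (Suc j))))"
    by force+
  have "acy (Q j) (zr (Q j))" if "j \<le> N" for j
    using that
  proof (induction j)
    case 0 show ?case by (rule fzero_acy[OF Q(1)[OF 0] Q(3)])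
  next
    case (Suc j)
    have F: "is_fimod (Q (Suc j))" "is_fimod (Q j)" using Q(1) Suc.prems by simp_all
    have s: "ses (frestrict (Q (Suc j)) (fker (Q (Suc j)) (Q j) (pi (Suc j)))) (zr (Q (Suc j))) (Q (Suc j)) (zr (Q (Suc j)))
        (Q j) (zr (Q j)) (\<lambda>n x. x) (pi (Suc j))"
      by (rule kernel_ses[OF F Q(4)[OF Suc.prems]]) (use Q(5)[OF Suc.prems] in \<open>simp add: fsurj_def\<close>)
    have "acy (frestrict (Q (Suc j)) (fker (Q (Suc j)) (Q j) (pi (Suc j)))) (zr (Q (Suc j)))"
      using relproj_acy[OF frestrict_fimod[OF F(1) fker_sub[OF F Q(4)[OF Suc.prems]]] Q(6)[OF Suc.prems]] by simp
    then show ?case using acy_mid[OF s] Suc by simp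
  qed
  then show ?thesis using fiso_acy[OF V Q(1) Q(2)] by simp
qed

text \<open>The last kernel is zero and each kernel is the image of the next term, so two out of
  three leads from the end of the resolution back to V. \<open>H\<close> supplies acyclicity of the
  terms at their own element type.\<close>

lemma acyc_res_acy:
  fixes V :: "('k::comm_ring_1, 'g::group_add, 'a) fimod"
  assumes V: "is_fimod V" and "acyc_res TYPE('p) V"
    and H: "\<And>P :: ('k, 'g, 'p) fimod. is_fimod P \<Longrightarrow> hom_acyclic P \<Longrightarrow> gen_fin P \<Longrightarrow> acy P (zr P)"
  shows "acy V (zr V)"
proof -
  obtain s :: nat and P :: "nat \<Rightarrow> ('k, 'g, 'p) fimod" and dd eps where "(\<forall>j\<le>s. is_fimod (P j) \<and> hom_acyclic (P j) \<and> gen_fin (P j))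
    \<and> fhom (P 0) V eps \<and> fsurj (P 0) V eps
    \<and> (s = 0 \<longrightarrow> fzero (frestrict (P 0) (fker (P 0) V eps)))
    \<and> (s > 0 \<longrightarrow> fimg (P 1) (dd 0) = fker (P 0) V eps
         \<and> (\<forall>j<s. fhom (P (Suc j)) (P j) (dd j))
         \<and> (\<forall>j. 1 \<le> j \<and> j < s \<longrightarrow> fimg (P (Suc j)) (dd j) = fker (P j) (P (j - 1)) (dd (j - 1)))
         \<and> fzero (frestrict (P s) (fker (P s) (P (s - 1)) (dd (s - 1)))))"
    using assms(2) unfolding acyc_res_def by blast
  then have P: "\<And>j. j \<le> s \<Longrightarrow> is_fimod (P j)" "\<And>j. j \<le> s \<Longrightarrow> hom_acyclic (P j)" "\<And>j. j \<le> s \<Longrightarrow> gen_fin (P j)"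
    and e: "fhom (P 0) V eps" "fsurj (P 0) V eps"
    and z: "s = 0 \<Longrightarrow> fzero (frestrict (P 0) (fker (P 0) V eps))"
    and r: "s > 0 \<Longrightarrow> fimg (P 1) (dd 0) = fker (P 0) V eps"
      "\<And>j. j < s \<Longrightarrow> fhom (P (Suc j)) (P j) (dd j)"
      "\<And>j. Suc j < s \<Longrightarrow> fimg (P (Suc (Suc j))) (dd (Suc j)) = fker (P (Suc j)) (P j) (dd j)"
      "s > 0 \<Longrightarrow> fzero (frestrict (P s) (fker (P s) (P (s - 1)) (dd (s - 1))))"
    by force+
  define Z where "Z = (\<lambda>j. case j of 0 \<Rightarrow> fker (P 0) V eps | Suc i \<Rightarrow> fker (P (Suc i)) (P i) (dd i))"
  have sub: "sub_fimod (P j) (Z j)" if "j \<le> s" for j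
    using that fker_sub[OF P(1) V e(1)] fker_sub[OF P(1) P(1) r(2)] by (cases j) (auto simp: Z_def)
  have im: "fimg (P (Suc j)) (dd j) = Z j" if "j < s" for j
    using that r(1,3) by (cases j) (auto simp: Z_def)
  have aP: "acy (P j) (zr (P j))" if "j \<le> s" for j using that P H by blast
  have zs: "fzero (frestrict (P s) (Z s))" using z r(4) by (cases s) (auto simp: Z_def)
  have "acy (frestrict (P j) (Z j)) (zr (P j))" if "j \<le> s" for j
    using that
  proof (induction rule: inc_induct)
    case base
    show ?case using fzero_acy[OF frestrict_fimod[OF P(1) sub] zs] by simp
  next
    case (step j)
    have "ses (frestrict (P (Suc j)) (fker (P (Suc j)) (P j) (dd j))) (zr (P (Suc j))) (P (Suc j)) (zr (P (Suc j)))
      (frestrict (P j) (Z j)) (zr (P j)) (\<lambda>n x. x) (dd j)"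
      using step.hyps by (intro image_ses P(1) r(2) sub im) simp_all
    then show ?case using acy_right step aP[of "Suc j"] by (auto simp: Z_def)
  qed
  then have "acy (frestrict (P 0) (fker (P 0) V eps)) (zr (P 0))" by (force simp: Z_def)
  moreover have "ses (frestrict (P 0) (fker (P 0) V eps)) (zr (P 0)) (P 0) (zr (P 0)) V (zr V) (\<lambda>n x. x) eps"
    by (rule kernel_ses[OF P(1) V e(1)]) (use e(2) in \<open>auto simp: fsurj_def\<close>)
  ultimately show ?thesis using acy_right aP by blast
qed

subsection \<open>Free resolutions\<close>

text \<open>Lists are folded with a pairing function of the infinite type. The length is recorded
  too, since folds of lists of different lengths may coincide.\<close>

lemma list_coding:
  assumes "infinite (UNIV :: 'i set)"
  obtains c :: "'i list \<Rightarrow> 'i" where "inj c"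
proof -
  obtain pr :: "'i \<times> 'i \<Rightarrow> 'i" where pr: "inj pr"
    using card_of_Times_same_infinite[OF assms] unfolding card_of_ordIso[symmetric] bij_betw_def by auto
  obtain nn :: "nat \<Rightarrow> 'i" where nn: "inj nn"
    using infinite_countable_subset[OF assms] by blast
  define go where "go = (\<lambda>xs. foldr (\<lambda>x y. pr (x, y)) xs undefined)"
  have "xs = ys" if "length xs = length ys" "go xs = go ys" for xs ys :: "'i list"
    using that by (induction xs ys rule: list_induct2) (auto simp: go_def dest!: injD[OF pr])
  then have "inj (\<lambda>xs. pr (nn (length xs), go xs))"
    by (intro injI) (auto dest!: injD[OF pr] injD[OF nn])
  then show ?thesis by (rule that)
qed

lemma Hom_eqI:
  assumes "phi \<in> Hom n m" "psi \<in> Hom n m'" "map (fst phi) [1..<Suc n] = map (fst psi) [1..<Suc n]"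
    "map (snd phi) [1..<Suc n] = map (snd psi) [1..<Suc n]"
  shows "phi = psi"
proof -
  have "fst phi x = fst psi x \<and> snd phi x = snd psi x" for x
  proof (cases "x \<in> {1..n}")
    case True
    then have "x \<in> set [1..<Suc n]" by auto
    then show ?thesis using assms(3,4) unfolding map_eq_conv by blast
  next
    case False
    then show ?thesis using assms(1,2) unfolding Hom_iff by simp
  qed
  then show ?thesis by (intro prod_eqI ext) auto
qed

text \<open>An element of a free module is finite data over its index type, the ring, the group and
  the naturals, all of which embed into the index type. So the elements of a syzygy can index the
  generators of the next free module without enlarging the type.\<close>

lemma keys_coding:
  fixes I :: "'i set" and kk :: "'k::comm_ring_1 \<Rightarrow> 'i" and gg :: "'g::group_add \<Rightarrow> 'i" and nn :: "nat \<Rightarrow> 'i"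
  assumes "infinite (UNIV :: 'i set)" "inj kk" "inj gg" "inj nn"
  obtains e :: "nat \<times> ('i \<times> 'g fiarr \<Rightarrow> 'k) \<Rightarrow> 'i" where "inj_on e (SIGMA n:UNIV. carr (freek (keys I d n)))"
proof -
  obtain c :: "'i list \<Rightarrow> 'i" where c: "inj c" using list_coding[OF assms(1)] .
  define ent where "ent = (\<lambda>(z :: 'i \<times> 'g fiarr \<Rightarrow> 'k) p. c (fst p # kk (z p) #
     c (map (\<lambda>x. nn (fst (snd p) x)) [1..<Suc (d (fst p))]) # [c (map (\<lambda>x. gg (snd (snd p) x)) [1..<Suc (d (fst p))])]))"
  define li where "li = (\<lambda>z :: 'i \<times> 'g fiarr \<Rightarrow> 'k. SOME l. set l = {p. z p \<noteq> 0})"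
  define e where "e = (\<lambda>(n, z). c (nn n # map (ent z) (li z)))"
  have li: "set (li z) = {p. z p \<noteq> 0}" if "z \<in> carr (freek (keys I d n))" for n z
    using someI_ex[OF finite_list[of "{p. z p \<noteq> 0}"]] that unfolding li_def by simp
  have ent: "p = p' \<and> z p = z' p'" if p: "p \<in> keys I d n" "p' \<in> keys I d n" and eq: "ent z p = ent z' p'" for n p p' z z'
  proof -
    obtain i phi i' phi' where ip: "p = (i, phi)" "p' = (i', phi')" "phi \<in> Hom (d i) n" "phi' \<in> Hom (d i') n"
      using p by blast
    have l: "i = i'" "kk (z p) = kk (z' p')"
      "map (\<lambda>x. nn (fst phi x)) [1..<Suc (d i)] = map (\<lambda>x. nn (fst phi' x)) [1..<Suc (d i')]"
      "map (\<lambda>x. gg (snd phi x)) [1..<Suc (d i)] = map (\<lambda>x. gg (snd phi' x)) [1..<Suc (d i')]"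
      using eq unfolding ent_def ip(1,2) inj_eq[OF c] list.inject fst_conv snd_conv by blast+
    have "map (fst phi) [1..<Suc (d i)] = map (fst phi') [1..<Suc (d i)]"
      using l(3) unfolding l(1)[symmetric] map_eq_conv inj_eq[OF assms(4)] .
    moreover have "map (snd phi) [1..<Suc (d i)] = map (snd phi') [1..<Suc (d i)]"
      using l(4) unfolding l(1)[symmetric] map_eq_conv inj_eq[OF assms(3)] .
    ultimately have "phi = phi'" using Hom_eqI ip(3,4) l(1) by metis
    then show ?thesis using l(1,2) ip(1,2) inj_eq[OF assms(2)] by simp
  qed
  have sub: "z p = z' p" if z: "z \<in> carr (freek (keys I d n))" "z' \<in> carr (freek (keys I d n))"
    and eq: "ent z ` set (li z) = ent z' ` set (li z')" and p: "z p \<noteq> 0" for n z z' p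
  proof -
    have "ent z p \<in> ent z' ` set (li z')" using eq li[OF z(1)] p by blast
    then obtain p' where p': "z' p' \<noteq> 0" "ent z p = ent z' p'" using li[OF z(2)] by blast
    have "p \<in> keys I d n" "p' \<in> keys I d n" using freek_supp[OF z(1), of p] freek_supp[OF z(2), of p'] p p'(1) by blast+
    then show ?thesis using ent[OF _ _ p'(2)] by blast
  qed
  have "inj_on e (SIGMA n:UNIV. carr (freek (keys I d n)))"
  proof (rule inj_onI)
    fix a b assume a: "a \<in> (SIGMA n:UNIV. carr (freek (keys I d n)))" and b: "b \<in> (SIGMA n:UNIV. carr (freek (keys I d n)))"
      and eq: "e a = e b"
    obtain n z n' z' where ab: "a = (n, z)" "b = (n', z')" by (cases a, cases b)
    have l: "n = n'" "map (ent z) (li z) = map (ent z') (li z')"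
      using eq unfolding ab e_def by (simp_all add: inj_eq[OF c] inj_eq[OF assms(4)])
    have z: "z \<in> carr (freek (keys I d n))" "z' \<in> carr (freek (keys I d n))"
      using a b ab l(1) by blast+
    have s: "ent z ` set (li z) = ent z' ` set (li z')" using l(2) by (metis set_map)
    have "z p = z' p" for p
      using sub[OF z s, of p] sub[OF z(2,1) s[symmetric], of p] by metis
    then show "a = b" using ab l(1) by auto
  qed
  then show ?thesis by (rule that)
qed

text \<open>One generator for each element of each degree, placed in that degree; the coding c names
  the generators.\<close>

lemma free_cover:
  fixes X :: "('k::comm_ring_1, 'g::group_add, 'x) fimod" and c :: "nat \<times> 'x \<Rightarrow> 'i"
  assumes X: "is_fimod X" and c: "inj_on c (SIGMA n:UNIV. elts X n)"
  obtains I :: "'i set" and d h where "fhom (freefi I d) X h" "\<And>n. h n ` elts (freefi I d) n = elts X n"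
proof -
  let ?S = "SIGMA n:UNIV. elts X n"
  define I where "I = c ` ?S"
  define x where "x = inv_into ?S c"
  have xc: "x (c p) = p" if "p \<in> ?S" for p using inv_into_f_f[OF c that] by (simp add: x_def)
  have xi: "snd (x i) \<in> elts X (fst (x i))" if "i \<in> I" for i
    using that xc unfolding I_def by auto
  obtain h where h: "fhom (freefi I (\<lambda>i. fst (x i))) X h"
    "\<And>n i phi. i \<in> I \<Longrightarrow> phi \<in> Hom (fst (x i)) n \<Longrightarrow> h n (ind (i, phi)) = fac X (fst (x i)) n phi (snd (x i))"
    using freefi_hom[OF X, of I "\<lambda>i. snd (x i)" "\<lambda>i. fst (x i)"] xi by blast
  have "h n ` elts (freefi I (\<lambda>i. fst (x i))) n = elts X n" for n
  proof
    show "h n ` elts (freefi I (\<lambda>i. fst (x i))) n \<subseteq> elts X n" using fhomD(2)[OF h(1)] by blast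
    show "elts X n \<subseteq> h n ` elts (freefi I (\<lambda>i. fst (x i))) n"
    proof
      fix v assume v: "v \<in> elts X n"
      then have p: "(n, v) \<in> ?S" by blast
      let ?i = "c (n, v)"
      have i: "?i \<in> I" "x ?i = (n, v)" using p xc I_def by auto
      have "h n (ind (?i, idm n)) = v"
        using h(2)[OF i(1), of "idm n" n] i(2) fimodD(4)[OF X v] by simp
      moreover have "(ind (?i, idm n) :: 'i \<times> 'g fiarr \<Rightarrow> 'k) \<in> elts (freefi I (\<lambda>i. fst (x i))) n"
        unfolding freefi_simps using i by (intro ind_carr) simp
      ultimately show "v \<in> h n ` elts (freefi I (\<lambda>i. fst (x i))) n" by (metis imageI)
    qed
  qed
  then show ?thesis using that h(1) by blast
qed

lemma ex_free_res:
  fixes V :: "('k::comm_ring_1, 'g::group_add, 'a) fimod"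
  assumes V: "is_fimod V"
  obtains I :: "nat \<Rightarrow> ('a, 'k, 'g) ix set" and d delta eps where "free_res V I d delta eps"
proof -
  have inf: "infinite (UNIV :: ('a, 'k, 'g) ix set)"
    by (simp add: finite_prod)
  have "inj_on (\<lambda>(n, x). (Inl x, n) :: ('a, 'k, 'g) ix) (SIGMA n:UNIV. elts V n)"
    by (auto simp: inj_on_def)
  from free_cover[OF V this] obtain I0 :: "('a, 'k, 'g) ix set" and d0 eps where
    eps: "fhom (freefi I0 d0) V eps" "\<And>n. eps n ` elts (freefi I0 d0) n = elts V n" by metis
  have step: "\<exists>(I' :: ('a, 'k, 'g) ix set) d' h. fhom (freefi I' d') (freefi I d) h \<and> fimg (freefi I' d') h = Z"
    if Z: "sub_fimod (freefi I d :: ('k, 'g, ('a, 'k, 'g) ix \<times> 'g fiarr \<Rightarrow> 'k) fimod) Z" for I :: "('a, 'k, 'g) ix set" and d Z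
  proof -
    let ?F = "freefi I d :: ('k, 'g, ('a, 'k, 'g) ix \<times> 'g fiarr \<Rightarrow> 'k) fimod"
    obtain e :: "nat \<times> (('a, 'k, 'g) ix \<times> 'g fiarr \<Rightarrow> 'k) \<Rightarrow> ('a, 'k, 'g) ix"
      where e: "inj_on e (SIGMA n:UNIV. carr (freek (keys I d n)))"
      by (rule keys_coding[OF inf, of "\<lambda>k. (Inr (Inl k), 0)" "\<lambda>g. (Inr (Inr g), 0)" "\<lambda>n. (undefined, n)"])
        (auto simp: inj_on_def)
    have "(SIGMA n:UNIV. elts (frestrict ?F Z) n) \<subseteq> (SIGMA n:UNIV. carr (freek (keys I d n)))"
      using sub_fimodD(3)[OF Z] unfolding frestrict_simps freefi_simps by blast
    then have "inj_on e (SIGMA n:UNIV. elts (frestrict ?F Z) n)" by (rule inj_on_subset[OF e])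
    from free_cover[OF frestrict_fimod[OF freefi_fimod Z] this] obtain I' :: "('a, 'k, 'g) ix set" and d' h where
      h: "fhom (freefi I' d') (frestrict ?F Z) h" "\<And>n. h n ` elts (freefi I' d') n = elts (frestrict ?F Z) n" by metis
    have "lin (deg (freefi I' d') n) (deg ?F n) (h n)" for n
      using fhomD(1)[OF h(1), of n] sub_fimodD(3)[OF Z, of _ n] unfolding lin_def frestrict_simps by blast
    then have "fhom (freefi I' d') ?F h" using fhomD(3)[OF h(1)] by (simp add: fhom_def)
    moreover have "fimg (freefi I' d') h = Z" using h(2) by (auto simp: fimg_def)
    ultimately show ?thesis by blast
  qed
  \<comment> \<open>A state consists of the index set, the degrees, the kernel still to be covered,
    and the map to the previous free module. The last entry is arbitrary in the initial
    state.\<close>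
  let ?ok = "\<lambda>s. sub_fimod (freefi (fst s) (fst (snd s)) :: ('k, 'g, ('a, 'k, 'g) ix \<times> 'g fiarr \<Rightarrow> 'k) fimod) (fst (snd (snd s)))"
  let ?s0 = "(I0, d0, fker (freefi I0 d0) V eps, undefined)"
  let ?R = "\<lambda>s t. fhom (freefi (fst t) (fst (snd t))) (freefi (fst s) (fst (snd s)) :: ('k, 'g, ('a, 'k, 'g) ix \<times> 'g fiarr \<Rightarrow> 'k) fimod) (snd (snd (snd t)))
     \<and> fimg (freefi (fst t) (fst (snd t))) (snd (snd (snd t))) = fst (snd (snd s))
     \<and> fst (snd (snd t)) = fker (freefi (fst t) (fst (snd t))) (freefi (fst s) (fst (snd s)) :: ('k, 'g, ('a, 'k, 'g) ix \<times> 'g fiarr \<Rightarrow> 'k) fimod) (snd (snd (snd t)))"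
  have "\<exists>f. \<forall>n. (?ok (f n) \<and> (n = 0 \<longrightarrow> f n = ?s0)) \<and> ?R (f n) (f (Suc n))"
  proof (rule dependent_nat_choice)
    show "\<exists>x. ?ok x \<and> (0 = (0::nat) \<longrightarrow> x = ?s0)"
      using fker_sub[OF freefi_fimod V eps(1)] by (intro exI[of _ ?s0]) simp
    fix s n assume "?ok s \<and> (n = (0::nat) \<longrightarrow> s = ?s0)"
    then obtain I' :: "('a, 'k, 'g) ix set" and d' h where
      h: "fhom (freefi I' d') (freefi (fst s) (fst (snd s)) :: ('k, 'g, ('a, 'k, 'g) ix \<times> 'g fiarr \<Rightarrow> 'k) fimod) h"
        "fimg (freefi I' d') h = fst (snd (snd s))"
      using step by blast
    let ?t = "(I', d', fker (freefi I' d') (freefi (fst s) (fst (snd s)) :: ('k, 'g, ('a, 'k, 'g) ix \<times> 'g fiarr \<Rightarrow> 'k) fimod) h, h)"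
    show "\<exists>t. (?ok t \<and> (Suc n = 0 \<longrightarrow> t = ?s0)) \<and> ?R s t"
      using h fker_sub[OF freefi_fimod freefi_fimod h(1)] by (intro exI[of _ ?t]) simp
  qed
  then obtain f where f: "\<And>n. ?ok (f n)" "f 0 = ?s0" "\<And>n. ?R (f n) (f (Suc n))" by blast
  have "free_res V (\<lambda>n. fst (f n)) (\<lambda>n. fst (snd (f n))) (\<lambda>n. snd (snd (snd (f (Suc n))))) eps"
    unfolding free_res_def
  proof (intro conjI allI)
    show "fhom (freefi (fst (f 0)) (fst (snd (f 0)))) V eps" using eps(1) f(2) by simp
    show "fsurj (freefi (fst (f 0)) (fst (snd (f 0)))) V eps" using eps(2) f(2) by (simp add: fsurj_def)
    show "fimg (freefi (fst (f 1)) (fst (snd (f 1)))) (snd (snd (snd (f (Suc 0))))) = fker (freefi (fst (f 0)) (fst (snd (f 0)))) V eps"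
      using f(3)[of 0] f(2) by simp
    fix j
    show "fhom (freefi (fst (f (Suc j))) (fst (snd (f (Suc j))))) (freefi (fst (f j)) (fst (snd (f j)))) (snd (snd (snd (f (Suc j)))))"
      using f(3)[of j] by blast
    show "fimg (freefi (fst (f (Suc (Suc j)))) (fst (snd (f (Suc (Suc j)))))) (snd (snd (snd (f (Suc (Suc j))))))
       = fker (freefi (fst (f (Suc j))) (fst (snd (f (Suc j))))) (freefi (fst (f j)) (fst (snd (f j)))) (snd (snd (snd (f (Suc j)))))"
      using f(3)[of j] f(3)[of "Suc j"] by simp
  qed
  then show ?thesis by (rule that)
qed

lemma ltdeg_eq: "is_fimod V \<Longrightarrow> ltdeg V n = lt V (zr V) n"
proof
  assume V: "is_fimod V"
  interpret smodule V "zr V" by (rule zr_smodule[OF V])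
  let ?X = "\<Union>m\<in>{..<n}. \<Union>phi\<in>Hom m n. fac V m n phi ` elts V m"
  have "ksub (deg V n) (kspan (deg V n) ?X)" by (rule kspan_ksub[OF km]) auto
  then show "lt V (zr V) n \<subseteq> ltdeg V n"
    unfolding ltdeg_def lt_def by (intro kspan_min) (auto simp: zr_def ksubD(2) intro: kspan_base)
  show "ltdeg V n \<subseteq> lt V (zr V) n"
    unfolding ltdeg_def by (rule kspan_min[OF lt_ksub]) (auto intro: lt_gen)
qed

section \<open>Syzygies and the vanishing of homology\<close>

locale resolution =
  fixes V :: "('k::comm_ring_1, 'g::group_add, 'a) fimod" and I :: "nat \<Rightarrow> 'i set" and d delta eps
  assumes V: "is_fimod V" and res: "free_res V I d delta eps"
begin

abbreviation Fr :: "nat \<Rightarrow> ('k, 'g, 'i \<times> 'g fiarr \<Rightarrow> 'k) fimod" where "Fr j \<equiv> freefi (I j) (d j)"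

text \<open>\<open>Z 0\<close> is the kernel of the augmentation; if V counts as the zeroth syzygy,
  \<open>Syz j\<close> is the syzygy with number j + 1.\<close>

definition Z :: "nat \<Rightarrow> nat \<Rightarrow> ('i \<times> 'g fiarr \<Rightarrow> 'k) set" where
  "Z j = (case j of 0 \<Rightarrow> fker (Fr 0) V eps | Suc i \<Rightarrow> fker (Fr (Suc i)) (Fr i) (delta i))"

abbreviation "Syz j \<equiv> frestrict (Fr j) (Z j)"

lemma r: "fhom (Fr 0) V eps" "fsurj (Fr 0) V eps" "fhom (Fr (Suc j)) (Fr j) (delta j)" "fimg (Fr (Suc j)) (delta j) = Z j"
  using res unfolding free_res_def Z_def by (auto split: nat.splits)

lemma Z_sub: "sub_fimod (Fr j) (Z j)"
  unfolding Z_def by (cases j) (simp_all add: fker_sub[OF freefi_fimod V r(1)] fker_sub[OF freefi_fimod freefi_fimod r(3)])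

lemma ses_0: "ses (Syz 0) (zr (Fr 0)) (Fr 0) (zr (Fr 0)) V (zr V) (\<lambda>n x. x) eps"
  unfolding Z_def nat.case by (rule kernel_ses[OF freefi_fimod V r(1)]) (use r(2) in \<open>simp add: fsurj_def\<close>)

lemma ses_Suc: "ses (Syz (Suc j)) (zr (Fr (Suc j))) (Fr (Suc j)) (zr (Fr (Suc j))) (Syz j) (zr (Fr j)) (\<lambda>n x. x) (delta j)"
  using image_ses[OF freefi_fimod freefi_fimod r(3) Z_sub r(4)] unfolding Z_def[of "Suc j"] nat.case .

lemma acy_Syz: "acy V (zr V) \<Longrightarrow> acy (Syz j) (zr (Fr j))"
proof (induction j)
  case 0 then show ?case using acy_left[OF ses_0 freefi_acy] by blast
next
  case (Suc j) then show ?case using acy_left[OF ses_Suc freefi_acy] by blast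
qed

lemma acy_if_Syz: "acy (Syz j) (zr (Fr j)) \<Longrightarrow> acy V (zr V)"
proof (induction j)
  case 0 then show ?case using acy_right[OF ses_0 _ freefi_acy] by blast
next
  case (Suc j) then show ?case using acy_right[OF ses_Suc _ freefi_acy] by blast
qed

lemma bev_Syz: "bev V (zr V) \<Longrightarrow> bev (Syz j) (zr (Fr j))"
proof (induction j)
  case 0 then show ?case using bev_left[OF _ ses_0 freefi_acy] by blast
next
  case (Suc j) then show ?case using bev_left[OF _ ses_Suc freefi_acy] by blast
qed

definition van :: "nat \<Rightarrow> bool" where
  "van i \<longleftrightarrow> (\<forall>n. \<forall>x\<in>elts (Fr i) n.
        delta (i - 1) n x \<in> ltdeg (Fr (i - 1)) n \<longrightarrow>
        (\<exists>y\<in>elts (Fr (Suc i)) n.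
           pls (deg (Fr i) n) x (sml (deg (Fr i) n) (-1) (delta i n y)) \<in> ltdeg (Fr i) n))"

text \<open>Dimension shifting: H_{j+1}(V) is the kernel of H_0(Syz j) -> H_0(F_j), because F_{j+1}
  maps onto \<open>Syz j\<close> and the kernel of this map is the image of F_{j+2}.\<close>

lemma van_iff: "van (Suc j) \<longleftrightarrow> (\<forall>n z. z \<in> Z j n \<longrightarrow> z \<in> lt (Fr j) (zr (Fr j)) n \<longrightarrow> z \<in> lt (Syz j) (zr (Fr j)) n)"
proof -
  interpret s: ses "Syz (Suc j)" "zr (Fr (Suc j))" "Fr (Suc j)" "zr (Fr (Suc j))" "Syz j" "zr (Fr j)" "\<lambda>n x. x" "delta j"
    by (rule ses_Suc)
  interpret q: ssurj "Fr (Suc j)" "zr (Fr (Suc j))" "Syz j" "zr (Fr j)" "delta j" by (rule s.is_ssurj)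
  have fm: "is_fimod (Syz j)" by (rule frestrict_fimod[OF freefi_fimod Z_sub])
  have cz: "eqv (Syz j) (zr (Fr j)) n a b \<Longrightarrow> a = b" for n a b
    using cg_zr[OF fm, of n a b] by simp
  have im: "Z i n = delta i n ` elts (Fr (Suc i)) n" for i n
    unfolding r(4)[symmetric] fimg_def ..
  have ker: "x \<in> Z (Suc j) n \<longleftrightarrow> x \<in> elts (Fr (Suc j)) n \<and> delta j n x = zer (deg (Fr j) n)" for x n
    by (simp add: Z_def fker_def)
  note dl = fhomD(1)[OF r(3)[of j]]
  have neg: "delta j n (pls (deg (Fr (Suc j)) n) x (sml (deg (Fr (Suc j)) n) (-1) y))
      = pls (deg (Fr j) n) (delta j n x) (sml (deg (Fr j) n) (-1) (delta j n y))"
    if "x \<in> elts (Fr (Suc j)) n" "y \<in> elts (Fr (Suc j)) n" for x y n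
    unfolding linD(2)[OF dl that(1) s.B.k_sml[OF that(2)]] linD(3)[OF dl that(2)] ..
  interpret f: smodule "Fr j" "zr (Fr j)" by (rule zr_smodule[OF freefi_fimod])
  have in_j: "delta j n x \<in> elts (Fr j) n" if "x \<in> elts (Fr (Suc j)) n" for x n
    using fhomD(2)[OF r(3) that] .
  show ?thesis
  proof
    assume v: "van (Suc j)"
    show "\<forall>n z. z \<in> Z j n \<longrightarrow> z \<in> lt (Fr j) (zr (Fr j)) n \<longrightarrow> z \<in> lt (Syz j) (zr (Fr j)) n"
    proof (intro allI impI)
      fix n z assume "z \<in> Z j n" and zl: "z \<in> lt (Fr j) (zr (Fr j)) n"
      then obtain x where x: "x \<in> elts (Fr (Suc j)) n" "z = delta j n x" unfolding im by blast
      then obtain y where y: "y \<in> elts (Fr (Suc (Suc j))) n"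
        "pls (deg (Fr (Suc j)) n) x (sml (deg (Fr (Suc j)) n) (-1) (delta (Suc j) n y)) \<in> lt (Fr (Suc j)) (zr (Fr (Suc j))) n"
        using v zl unfolding van_def diff_Suc_1 ltdeg_eq[OF freefi_fimod] by blast
      have dy: "delta (Suc j) n y \<in> Z (Suc j) n" using im y(1) by blast
      then have dyc: "delta (Suc j) n y \<in> elts (Fr (Suc j)) n" and dy0: "delta j n (delta (Suc j) n y) = zer (deg (Fr j) n)"
        unfolding ker by auto
      have "delta j n (pls (deg (Fr (Suc j)) n) x (sml (deg (Fr (Suc j)) n) (-1) (delta (Suc j) n y))) = z"
        unfolding neg[OF x(1) dyc] dy0 km_sml_zer[OF f.km] x(2) by (rule km_zer_right[OF f.km in_j[OF x(1)]])
      then show "z \<in> lt (Syz j) (zr (Fr j)) n" using q.g_lt[OF y(2)] by simp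
    qed
  next
    assume h: "\<forall>n z. z \<in> Z j n \<longrightarrow> z \<in> lt (Fr j) (zr (Fr j)) n \<longrightarrow> z \<in> lt (Syz j) (zr (Fr j)) n"
    show "van (Suc j)"
      unfolding van_def diff_Suc_1 ltdeg_eq[OF freefi_fimod]
    proof (intro allI ballI impI)
      fix n x assume x: "x \<in> elts (Fr (Suc j)) n" "delta j n x \<in> lt (Fr j) (zr (Fr j)) n"
      have "delta j n x \<in> lt (Syz j) (zr (Fr j)) n" using h x im by blast
      then obtain x' where x': "x' \<in> lt (Fr (Suc j)) (zr (Fr (Suc j))) n" "delta j n x = delta j n x'"
        using q.lt_lift cz by blast
      have x'c: "x' \<in> elts (Fr (Suc j)) n" by (rule s.B.lt_carr[OF x'(1)])
      let ?w = "pls (deg (Fr (Suc j)) n) x (sml (deg (Fr (Suc j)) n) (-1) x')"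
      have w: "?w \<in> elts (Fr (Suc j)) n" by (rule s.B.k_pls[OF x(1) s.B.k_sml[OF x'c]])
      have "delta j n ?w = zer (deg (Fr j) n)"
        unfolding neg[OF x(1) x'c] x'(2) by (rule km_neg_right[OF f.km in_j[OF x'c]])
      then have "?w \<in> Z (Suc j) n" using ker w by blast
      then obtain y where y: "y \<in> elts (Fr (Suc (Suc j))) n" "?w = delta (Suc j) n y" unfolding im by blast
      \<comment> \<open>This is x - (x - x') = x'.\<close>
      have "pls (deg (Fr (Suc j)) n) x (sml (deg (Fr (Suc j)) n) (-1) ?w) = x'"
        by (simp add: fun_eq_iff)
      then show "\<exists>y\<in>elts (Fr (Suc (Suc j))) n.
          pls (deg (Fr (Suc j)) n) x (sml (deg (Fr (Suc j)) n) (-1) (delta (Suc j) n y)) \<in> lt (Fr (Suc j)) (zr (Fr (Suc j))) n"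
        using x'(1) y by metis
    qed
  qed
qed

lemma van_if_acy:
  assumes "acy V (zr V)"
  shows "van (Suc j)"
  unfolding van_iff
proof (intro allI impI)
  fix n z assume z: "z \<in> Z j n" "z \<in> lt (Fr j) (zr (Fr j)) n"
  show "z \<in> lt (Syz j) (zr (Fr j)) n"
  proof (cases j)
    case 0
    show ?thesis using acy_H0_inj[OF ses_0 assms, of z n] z unfolding 0 by simp
  next
    case (Suc i)
    show ?thesis using acy_H0_inj[OF ses_Suc[of i] acy_Syz[OF assms], of z n] z unfolding Suc by simp
  qed
qed

text \<open>For H_1 the criterion \<open>acy_if_H0_inj\<close> is applied to V itself, for higher
  homology to a syzygy. That the syzygy satisfies \<open>ev\<close> is derived from the stronger
  \<open>bev\<close> for V, and acyclicity then descends to V.\<close>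

lemma acy_if_van:
  assumes "van (Suc j)" "ev V (zr V)" "j = 0 \<or> bev V (zr V)"
  shows "acy V (zr V)"
proof (cases j)
  case 0
  show ?thesis
    by (rule acy_if_H0_inj[OF assms(2) ses_0 freefi_acy]) (use assms(1)[unfolded van_iff] 0 in simp)
next
  case (Suc i)
  then have "ev (Syz i) (zr (Fr i))" using bev_ev[OF bev_Syz] assms(3) by blast
  then have "acy (Syz i) (zr (Fr i))"
    by (rule acy_if_H0_inj[OF _ ses_Suc freefi_acy]) (use assms(1)[unfolded van_iff] Suc in simp)
  then show ?thesis by (rule acy_if_Syz)
qed

end

lemma hom_acyclic_if_acy:
  fixes V :: "('k::comm_ring_1, 'g::group_add, 'a) fimod"
  assumes V: "is_fimod V" and "acy V (zr V)"
  shows "hom_acyclic V"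
  unfolding hom_acyclic_def
proof (intro allI impI)
  fix i :: nat assume "1 \<le> i"
  then obtain j where i: "i = Suc j" by (cases i) auto
  obtain I :: "nat \<Rightarrow> ('a, 'k, 'g) ix set" and d delta eps where res: "free_res V I d delta eps" using ex_free_res[OF V] .
  then interpret resolution V I d delta eps by unfold_locales (rule V)
  show "Hvan i V" unfolding Hvan_def using res van_if_acy[OF assms(2), of j] unfolding van_def i by blast
qed

text \<open>The argument is carried out in whichever resolution witnesses
  \<open>Hvan\<close>.\<close>

lemma acy_if_Hvan:
  fixes V :: "('k::comm_ring_1, 'g::group_add, 'a) fimod"
  assumes V: "is_fimod V" and "Hvan i V" "0 < i" "ev V (zr V)" "i = 1 \<or> bev V (zr V)"
  shows "acy V (zr V)"
proof -
  obtain j where i: "i = Suc j" using assms(3) by (cases i) auto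
  obtain I :: "nat \<Rightarrow> ('a, 'k, 'g) ix set" and d delta eps where hv: "free_res V I d delta eps \<and>
     (\<forall>n. \<forall>x\<in>elts (freefi (I i) (d i)) n.
        delta (i - 1) n x \<in> ltdeg (freefi (I (i - 1)) (d (i - 1))) n \<longrightarrow>
        (\<exists>y\<in>elts (freefi (I (Suc i)) (d (Suc i))) n.
           pls (deg (freefi (I i) (d i)) n) x (sml (deg (freefi (I i) (d i)) n) (-1) (delta i n y))
             \<in> ltdeg (freefi (I i) (d i)) n))"
    using assms(2) unfolding Hvan_def by blast
  then interpret resolution V I d delta eps by unfold_locales (use V in blast)+
  have "van (Suc j)" using hv unfolding van_def i by blast
  then show ?thesis using acy_if_van assms(4,5) i by simp
qed

lemma gen_fin_ev:
  assumes "is_fimod V" "gen_fin V"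
  shows "ev V (zr V)"
  using ev_if_gen_le[OF zr_smodule[OF assms(1)] gen_deg_le[OF assms(1)]] assms(2) unfolding gen_fin_def by blast

lemma pres_fin_bev:
  fixes V :: "('k::comm_ring_1, 'g::group_add, 'a) fimod"
  assumes V: "is_fimod V" and "pres_fin TYPE('m) V"
  shows "bev V (zr V)"
proof -
  obtain r and M :: "('k, 'g, 'm) fimod" and h where M: "is_fimod M" "relproj M" "fhom M V h" "fsurj M V h"
    "gen_deg (frestrict M (fker M V h)) r" and gen: "gen_fin V"
    using assms(2) unfolding pres_fin_def by blast
  have "ses (frestrict M (fker M V h)) (zr M) M (zr M) V (zr V) (\<lambda>n x. x) h"
    by (rule kernel_ses[OF M(1) V M(3)]) (use M(4) in \<open>simp add: fsurj_def\<close>)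
  moreover have "gen_le r (frestrict M (fker M V h)) (zr M)"
    using gen_deg_le[OF frestrict_fimod[OF M(1) fker_sub[OF M(1) V M(3)]] M(5)] by simp
  ultimately show ?thesis
    using bev_if_presented[OF gen_fin_ev[OF V gen] _ relproj_acy[OF M(1,2)]] by blast
qed

section \<open>Comparison of all conditions with derivative acyclicity\<close>

theorem theoremB:
  fixes V :: "('k::comm_ring_1, 'g::group_add, 'a) fimod"
  assumes "is_fimod V" and "gen_fin V"
  shows "(sharp_filtered V \<longleftrightarrow> surj_chain TYPE('a set) V)
       \<and> (surj_chain TYPE('q) V \<longrightarrow> sharp_filtered V)
       \<and> (sharp_filtered V \<longleftrightarrow> hom_acyclic V)
       \<and> (sharp_filtered V \<longleftrightarrow> Hvan 1 V)
       \<and> (sharp_filtered V \<longrightarrow> acyc_res TYPE('a) V)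
       \<and> (acyc_res TYPE('p) V \<longrightarrow> sharp_filtered V)
       \<and> (pres_fin TYPE('m) V \<longrightarrow> (sharp_filtered V \<longleftrightarrow> (\<exists>i>0. Hvan i V)))"
proof -
  note V = assms(1)
  have sharp: "sharp_filtered V \<longleftrightarrow> acy V (zr V)"
    using filtration_acy[OF V] filtered_if_acy[OF V _ gen_deg_le[OF V]] assms(2) unfolding gen_fin_def by blast
  have Hvan1: "acy P (zr P)" if "is_fimod P" "Hvan 1 P" "gen_fin P" for P :: "('k, 'g, 'b) fimod"
    using acy_if_Hvan[OF that(1,2)] gen_fin_ev[OF that(1,3)] by simp
  have Hvan1': "acy P (zr P)" if "is_fimod P" "hom_acyclic P" "gen_fin P" for P :: "('k, 'g, 'p) fimod"
    using acy_if_Hvan[OF that(1), of 1] that(2) gen_fin_ev[OF that(1,3)] unfolding hom_acyclic_def by simp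
  have HvanV: "Hvan 1 V \<Longrightarrow> acy V (zr V)"
    using acy_if_Hvan[OF V, of 1] gen_fin_ev[OF V assms(2)] by simp
  have hom: "hom_acyclic V \<longleftrightarrow> acy V (zr V)"
    using hom_acyclic_if_acy[OF V] HvanV unfolding hom_acyclic_def by blast
  have one: "Hvan 1 V \<longleftrightarrow> acy V (zr V)"
    using HvanV hom unfolding hom_acyclic_def by blast
  have "acyc_res TYPE('a) V" if "acy V (zr V)"
    unfolding acyc_res_def
  \<comment> \<open>V is its own resolution, of length zero.\<close>
  proof (intro exI[of _ 0] exI[of _ "\<lambda>_. V"] exI[of _ "\<lambda>_ _ x. x"] exI[of _ "\<lambda>_ x. x"] conjI)
    show "\<forall>j\<le>0. is_fimod V \<and> hom_acyclic V \<and> gen_fin V" using assms hom that by blast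
    show "fhom V V (\<lambda>_ x. x)" by (auto simp: fhom_def lin_def)
    show "fsurj V V (\<lambda>_ x. x)" by (simp add: fsurj_def)
    show "0 = (0::nat) \<longrightarrow> fzero (frestrict V (fker V V (\<lambda>_ x. x)))"
      using km_zer[OF fimodD(1)[OF V]] by (auto simp: fzero_def fker_def)
  qed auto
  moreover have "acy V (zr V)" if "acyc_res TYPE('p) V"
    by (rule acyc_res_acy[OF V that Hvan1'])
  moreover have "(\<exists>i>0. Hvan i V) \<longleftrightarrow> acy V (zr V)" if "pres_fin TYPE('m) V"
    using acy_if_Hvan[OF V _ _ gen_fin_ev[OF V assms(2)]] pres_fin_bev[OF V that] one by (metis zero_less_one)
  moreover have "surj_chain TYPE('a set) V \<longleftrightarrow> acy V (zr V)"
    using filtered_surj_chain[OF V] surj_chain_acy[OF V] sharp by blast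
  moreover have "surj_chain TYPE('q) V \<Longrightarrow> acy V (zr V)" by (rule surj_chain_acy[OF V])
  ultimately show ?thesis unfolding sharp hom one by blast
qed

end
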